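(* Let $Q$ and $Q'$ be quivers and let $I\subseteq KQ$ and $I'\subseteq KQ'$ be admissible ideals of the path algebras, generating ideals $\mathcal I$ and $\mathcal I'$ of the path categories $K\mathcal Q$ and $K\mathcal Q'$. Then there exists an isomorphism of $K$-categories $$\frac{K(\mathcal Q\times\mathcal Q')}{\mathcal I\,\square\,\mathcal I'}\;\cong\;\frac{K\mathcal Q}{\mathcal I}\otimes_K\frac{K\mathcal Q'}{\mathcal I'}.$$
   Context: $K$ is a field. A $K$-category is a category whose morphism sets are $K$-vector spaces and whose composition is $K$-bilinear. A quiver $Q=(Q_0,Q_1,s,t)$ has vertex set $Q_0$, arrow set $Q_1$, and source and target maps $s,t$. All quivers are assumed strongly locally finite: each vertex is the source of finitely many arrows and the target of finitely many arrows, and for any two vertices $x,y$ the set of paths from $x$ to $y$ is finite. The path category $K\mathcal Q$ is the additive category whose objects are the (finite) direct sums of indecomposable objects, the indecomposable objects being the vertices of $Q$; for vertices $a,b$ the space of morphisms $a\to b$ has as $K$-basis the set of all paths from $a$ to $b$ (including the trivial path if $a=b$), and composition is induced by composition of paths. $KQ$ denotes the path algebra of $Q$. A relation on $Q$ is a finite $K$-linear combination of paths of length $\ge 2$ with common source and common target. An ideal $I\subseteq KQ$ is admissible if it is generated by a set of relations. An ideal $I\subseteq KQ$ generates the ideal $\mathcal I$ of $K\mathcal Q$ consisting of the morphisms $(f_{ij})$ between finite direct sums of vertices all of whose components $f_{ij}$ lie in $I$; $K\mathcal Q/\mathcal I$ is the quotient category (same objects, morphism spaces $K\mathcal Q(X,Y)/\mathcal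 I(X,Y)$). The product quiver $Q\times Q'$ has vertices $Q_0\times Q_0'$ and arrows $(Q_0\times Q_1')\cup(Q_1\times Q_0')$: for $\alpha:p\to p'$ in $Q_1$ and $q\in Q_0'$ there is an arrow $(\alpha,q):(p,q)\to(p',q)$, and for $p\in Q_0$ and $\beta:q\to q'$ in $Q_1'$ there is an arrow $(p,\beta):(p,q)\to(p,q')$. Its path category is denoted $K(\mathcal Q\times\mathcal Q')$. The ideal $I\,\square\,I'$ of $K(Q\times Q')$ is generated by $(Q_0\times I')\cup(I\times Q_0')$ (the elements of $I'$ placed in each copy $\{p\}\times Q'$ and the elements of $I$ placed in each copy $Q\times\{q\}$) together with all relations $(p',\beta)(\alpha,q)-(\alpha,q')(p,\beta)$, compositions being written from right to left, for arrows $\alpha:p\to p'$ in $Q_1$ and $\beta:q\to q'$ in $Q_1'$. $\mathcal I\,\square\,\mathcal I'$ is the ideal of $K(\mathcal Q\times\mathcal Q')$ generated by $I\,\square\,I'$. For $K$-categories $\mathcal C,\mathcal C'$, the tensor product $\mathcal C\otimes_K\mathcal C'$ is the $K$-category whose objects are the pairs $(p,q)$ with $p$ an object of $\mathcal C$ and $q$ an object of $\mathcal C'$, whose morphisms $(p_1,q_1)\to(p_2,q_2)$ are the elements of $\mathcal C(p_1,p_2)\otimes_K\mathcal C'(q_1,q_2)$, and whose composition is given by $(f_2\otimes g_2)(f_1\otimes g_1)=f_2f_1\otimes g_2g_1$.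
   Formalization: Literally false (two arrowless points: the tensor product lacks (1,1)⊕(2,2)); proved instead as an isomorphism on vertices, an isomorphism with finite direct sums of pairs of vertices, and an equivalence with the tensor product closed under finite direct sums. *)

theory Defs
  imports "HOL-Library.FuncSet" "HOL-Library.Poly_Mapping" "Graph_Theory.Arc_Walk"
begin

section \<open>Finite linear combinations\<close>

text \<open>The free vector space over a field \<open>'k\<close> on a set \<open>A\<close> of type \<open>'p set\<close> consists of the
  \<open>f :: 'p \<Rightarrow>\<^sub>0 'k\<close> with \<open>Poly_Mapping.keys f \<subseteq> A\<close>.\<close>

definition pscale :: "'k::field \<Rightarrow> ('p \<Rightarrow>\<^sub>0 'k) \<Rightarrow> ('p \<Rightarrow>\<^sub>0 'k)" where
  "pscale c f = Poly_Mapping.map ((*) c) f"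

definition lin_ext :: "('p \<Rightarrow> ('q \<Rightarrow>\<^sub>0 'k)) \<Rightarrow> ('p \<Rightarrow>\<^sub>0 'k) \<Rightarrow> ('q \<Rightarrow>\<^sub>0 'k::field)" where
  "lin_ext \<phi> f = (\<Sum>a\<in>Poly_Mapping.keys f. pscale (Poly_Mapping.lookup f a) (\<phi> a))"

definition bilin_ext ::
  "('p \<Rightarrow> 'q \<Rightarrow> ('r \<Rightarrow>\<^sub>0 'k)) \<Rightarrow> ('p \<Rightarrow>\<^sub>0 'k) \<Rightarrow> ('q \<Rightarrow>\<^sub>0 'k) \<Rightarrow> ('r \<Rightarrow>\<^sub>0 'k::field)" where
  "bilin_ext \<mu> f g =
    (\<Sum>a\<in>Poly_Mapping.keys f. \<Sum>b\<in>Poly_Mapping.keys g.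
      pscale (Poly_Mapping.lookup f a * Poly_Mapping.lookup g b) (\<mu> a b))"


section \<open>\<open>K\<close>-categories\<close>

text \<open>All operations are indexed by objects, because the same element of \<open>'m\<close> may be a morphism
  between different pairs of objects. \<open>cmp C x y z g f\<close> is the composite \<open>g f\<close> of \<open>f : x \<rightarrow> y\<close>
  and \<open>g : y \<rightarrow> z\<close>.\<close>

record ('o, 'm, 'k) kcat =
  obj :: "'o set"
  hom :: "'o \<Rightarrow> 'o \<Rightarrow> 'm set"
  idm :: "'o \<Rightarrow> 'm"
  cmp :: "'o \<Rightarrow> 'o \<Rightarrow> 'o \<Rightarrow> 'm \<Rightarrow> 'm \<Rightarrow> 'm"
  zer :: "'o \<Rightarrow> 'o \<Rightarrow> 'm"
  add :: "'o \<Rightarrow> 'o \<Rightarrow> 'm \<Rightarrow> 'm \<Rightarrow> 'm"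
  scl :: "'o \<Rightarrow> 'o \<Rightarrow> 'k \<Rightarrow> 'm \<Rightarrow> 'm"

locale kcategory =
  fixes C :: "('o, 'm, 'k::field) kcat"
  assumes zer_hom: "\<lbrakk>x \<in> obj C; y \<in> obj C\<rbrakk> \<Longrightarrow> zer C x y \<in> hom C x y"
    and add_hom: "\<lbrakk>x \<in> obj C; y \<in> obj C; f \<in> hom C x y; g \<in> hom C x y\<rbrakk>
      \<Longrightarrow> add C x y f g \<in> hom C x y"
    and scl_hom: "\<lbrakk>x \<in> obj C; y \<in> obj C; f \<in> hom C x y\<rbrakk> \<Longrightarrow> scl C x y c f \<in> hom C x y"
    and add_assoc: "\<lbrakk>x \<in> obj C; y \<in> obj C; f \<in> hom C x y; g \<in> hom C x y; h \<in> hom C x y\<rbrakk>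
      \<Longrightarrow> add C x y (add C x y f g) h = add C x y f (add C x y g h)"
    and add_comm: "\<lbrakk>x \<in> obj C; y \<in> obj C; f \<in> hom C x y; g \<in> hom C x y\<rbrakk>
      \<Longrightarrow> add C x y f g = add C x y g f"
    and add_zer: "\<lbrakk>x \<in> obj C; y \<in> obj C; f \<in> hom C x y\<rbrakk> \<Longrightarrow> add C x y (zer C x y) f = f"
    and add_inv: "\<lbrakk>x \<in> obj C; y \<in> obj C; f \<in> hom C x y\<rbrakk>
      \<Longrightarrow> \<exists>g\<in>hom C x y. add C x y f g = zer C x y"
    and scl_one: "\<lbrakk>x \<in> obj C; y \<in> obj C; f \<in> hom C x y\<rbrakk> \<Longrightarrow> scl C x y 1 f = f"
    and scl_scl: "\<lbrakk>x \<in> obj C; y \<in> obj C; f \<in> hom C x y\<rbrakk>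
      \<Longrightarrow> scl C x y c (scl C x y d f) = scl C x y (c * d) f"
    and scl_add_left: "\<lbrakk>x \<in> obj C; y \<in> obj C; f \<in> hom C x y\<rbrakk>
      \<Longrightarrow> scl C x y (c + d) f = add C x y (scl C x y c f) (scl C x y d f)"
    and scl_add_right: "\<lbrakk>x \<in> obj C; y \<in> obj C; f \<in> hom C x y; g \<in> hom C x y\<rbrakk>
      \<Longrightarrow> scl C x y c (add C x y f g) = add C x y (scl C x y c f) (scl C x y c g)"
    and idm_hom: "x \<in> obj C \<Longrightarrow> idm C x \<in> hom C x x"
    and cmp_hom: "\<lbrakk>x \<in> obj C; y \<in> obj C; z \<in> obj C; f \<in> hom C x y; g \<in> hom C y z\<rbrakk>
      \<Longrightarrow> cmp C x y z g f \<in> hom C x z"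
    and cmp_idm_left: "\<lbrakk>x \<in> obj C; y \<in> obj C; f \<in> hom C x y\<rbrakk> \<Longrightarrow> cmp C x y y (idm C y) f = f"
    and cmp_idm_right: "\<lbrakk>x \<in> obj C; y \<in> obj C; f \<in> hom C x y\<rbrakk> \<Longrightarrow> cmp C x x y f (idm C x) = f"
    and cmp_assoc: "\<lbrakk>w \<in> obj C; x \<in> obj C; y \<in> obj C; z \<in> obj C;
        f \<in> hom C w x; g \<in> hom C x y; h \<in> hom C y z\<rbrakk>
      \<Longrightarrow> cmp C w x z (cmp C x y z h g) f = cmp C w y z h (cmp C w x y g f)"
    and cmp_add_left: "\<lbrakk>x \<in> obj C; y \<in> obj C; z \<in> obj C;
        f \<in> hom C x y; g \<in> hom C y z; h \<in> hom C y z\<rbrakk>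
      \<Longrightarrow> cmp C x y z (add C y z g h) f = add C x z (cmp C x y z g f) (cmp C x y z h f)"
    and cmp_add_right: "\<lbrakk>x \<in> obj C; y \<in> obj C; z \<in> obj C;
        f \<in> hom C x y; g \<in> hom C x y; h \<in> hom C y z\<rbrakk>
      \<Longrightarrow> cmp C x y z h (add C x y f g) = add C x z (cmp C x y z h f) (cmp C x y z h g)"
    and cmp_scl_left: "\<lbrakk>x \<in> obj C; y \<in> obj C; z \<in> obj C; f \<in> hom C x y; g \<in> hom C y z\<rbrakk>
      \<Longrightarrow> cmp C x y z (scl C y z c g) f = scl C x z c (cmp C x y z g f)"
    and cmp_scl_right: "\<lbrakk>x \<in> obj C; y \<in> obj C; z \<in> obj C; f \<in> hom C x y; g \<in> hom C y z\<rbrakk>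
      \<Longrightarrow> cmp C x y z g (scl C x y c f) = scl C x z c (cmp C x y z g f)"

locale kfunctor = dom: kcategory C + cod: kcategory D
  for C :: "('o, 'm, 'k::field) kcat" and D :: "('p, 'n, 'k) kcat" +
  fixes Fo :: "'o \<Rightarrow> 'p" and Fm :: "'o \<Rightarrow> 'o \<Rightarrow> 'm \<Rightarrow> 'n"
  assumes Fo_obj: "x \<in> obj C \<Longrightarrow> Fo x \<in> obj D"
    and Fm_hom: "\<lbrakk>x \<in> obj C; y \<in> obj C; f \<in> hom C x y\<rbrakk> \<Longrightarrow> Fm x y f \<in> hom D (Fo x) (Fo y)"
    and Fm_idm: "x \<in> obj C \<Longrightarrow> Fm x x (idm C x) = idm D (Fo x)"
    and Fm_cmp: "\<lbrakk>x \<in> obj C; y \<in> obj C; z \<in> obj C; f \<in> hom C x y; g \<in> hom C y z\<rbrakk>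
      \<Longrightarrow> Fm x z (cmp C x y z g f) = cmp D (Fo x) (Fo y) (Fo z) (Fm y z g) (Fm x y f)"
    and Fm_add: "\<lbrakk>x \<in> obj C; y \<in> obj C; f \<in> hom C x y; g \<in> hom C x y\<rbrakk>
      \<Longrightarrow> Fm x y (add C x y f g) = add D (Fo x) (Fo y) (Fm x y f) (Fm x y g)"
    and Fm_scl: "\<lbrakk>x \<in> obj C; y \<in> obj C; f \<in> hom C x y\<rbrakk>
      \<Longrightarrow> Fm x y (scl C x y c f) = scl D (Fo x) (Fo y) c (Fm x y f)"

definition fully_faithful ::
  "('o, 'm, 'k::field) kcat \<Rightarrow> ('p, 'n, 'k) kcat \<Rightarrow> ('o \<Rightarrow> 'p) \<Rightarrow> ('o \<Rightarrow> 'o \<Rightarrow> 'm \<Rightarrow> 'n) \<Rightarrow> bool" where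
  "fully_faithful C D Fo Fm \<longleftrightarrow>
    (\<forall>x\<in>obj C. \<forall>y\<in>obj C. bij_betw (Fm x y) (hom C x y) (hom D (Fo x) (Fo y)))"

definition iso_objs :: "('o, 'm, 'k::field) kcat \<Rightarrow> 'o \<Rightarrow> 'o \<Rightarrow> bool" where
  "iso_objs C x y \<longleftrightarrow>
    (\<exists>f\<in>hom C x y. \<exists>g\<in>hom C y x. cmp C x y x g f = idm C x \<and> cmp C y x y f g = idm C y)"

text \<open>Isomorphism is the strict notion: bijective on objects and on morphism spaces.\<close>

definition kcat_isomorphic ::
  "('o, 'm, 'k::field) kcat \<Rightarrow> ('p, 'n, 'k) kcat \<Rightarrow> bool" where
  "kcat_isomorphic C D \<longleftrightarrow>
    (\<exists>Fo Fm. kfunctor C D Fo Fm \<and> bij_betw Fo (obj C) (obj D) \<and> fully_faithful C D Fo Fm)"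

definition kcat_equivalent ::
  "('o, 'm, 'k::field) kcat \<Rightarrow> ('p, 'n, 'k) kcat \<Rightarrow> bool" where
  "kcat_equivalent C D \<longleftrightarrow>
    (\<exists>Fo Fm. kfunctor C D Fo Fm \<and> fully_faithful C D Fo Fm \<and>
      (\<forall>d\<in>obj D. \<exists>c\<in>obj C. iso_objs D (Fo c) d))"

definition full_subcat :: "('o, 'm, 'k::field) kcat \<Rightarrow> 'o set \<Rightarrow> ('o, 'm, 'k) kcat" where
  "full_subcat C S = C\<lparr>obj := obj C \<inter> S\<rparr>"


section \<open>Formal finite direct sums\<close>

text \<open>An object \<open>[x\<^sub>1, \<dots>, x\<^sub>n]\<close> stands for \<open>x\<^sub>1 \<oplus> \<dots> \<oplus> x\<^sub>n\<close>; the entry \<open>(i, j)\<close> of a morphism is its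
  component from the \<open>j\<close>-th summand of the source to the \<open>i\<close>-th summand of the target.\<close>

definition add_hull :: "('o, 'm, 'k::field) kcat \<Rightarrow> ('o list, nat \<times> nat \<Rightarrow> 'm, 'k) kcat" where
  "add_hull C = \<lparr>
    obj = lists (obj C),
    hom = (\<lambda>xs ys. \<Pi>\<^sub>E (i, j)\<in>{..<length ys} \<times> {..<length xs}. hom C (xs ! j) (ys ! i)),
    idm = (\<lambda>xs. \<lambda>(i, j)\<in>{..<length xs} \<times> {..<length xs}.
      if i = j then idm C (xs ! i) else zer C (xs ! j) (xs ! i)),
    cmp = (\<lambda>xs ys zs N M. \<lambda>(i, j)\<in>{..<length zs} \<times> {..<length xs}.
      foldr (add C (xs ! j) (zs ! i))
        (map (\<lambda>l. cmp C (xs ! j) (ys ! l) (zs ! i) (N (i, l)) (M (l, j))) [0..<length ys])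
        (zer C (xs ! j) (zs ! i))),
    zer = (\<lambda>xs ys. \<lambda>(i, j)\<in>{..<length ys} \<times> {..<length xs}. zer C (xs ! j) (ys ! i)),
    add = (\<lambda>xs ys M N. \<lambda>(i, j)\<in>{..<length ys} \<times> {..<length xs}.
      add C (xs ! j) (ys ! i) (M (i, j)) (N (i, j))),
    scl = (\<lambda>xs ys c M. \<lambda>(i, j)\<in>{..<length ys} \<times> {..<length xs}.
      scl C (xs ! j) (ys ! i) c (M (i, j)))\<rparr>"


section \<open>Quotients by ideals\<close>

definition coset :: "('o, 'm, 'k::field) kcat \<Rightarrow> ('o \<Rightarrow> 'o \<Rightarrow> 'm set) \<Rightarrow> 'o \<Rightarrow> 'o \<Rightarrow> 'm \<Rightarrow> 'm set" where
  "coset C J x y f = add C x y f ` J x y"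

text \<open>The unions below range over all choices of representatives. When \<open>J\<close> is an ideal, all choices
  give the same coset.\<close>

definition quot :: "('o, 'm, 'k::field) kcat \<Rightarrow> ('o \<Rightarrow> 'o \<Rightarrow> 'm set) \<Rightarrow> ('o, 'm set, 'k) kcat" where
  "quot C J = \<lparr>
    obj = obj C,
    hom = (\<lambda>x y. coset C J x y ` hom C x y),
    idm = (\<lambda>x. coset C J x x (idm C x)),
    cmp = (\<lambda>x y z G F. \<Union>g\<in>G. \<Union>f\<in>F. coset C J x z (cmp C x y z g f)),
    zer = (\<lambda>x y. coset C J x y (zer C x y)),
    add = (\<lambda>x y F G. \<Union>f\<in>F. \<Union>g\<in>G. coset C J x y (add C x y f g)),
    scl = (\<lambda>x y c F. \<Union>f\<in>F. coset C J x y (scl C x y c f))\<rparr>"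


section \<open>Tensor products\<close>

text \<open>\<open>V \<otimes>\<^sub>K W\<close> is the free vector space on \<open>V \<times> W\<close> modulo the subspace of bilinearity relations, and
  the composition of the tensor product category is the one induced by
  \<open>(g, g') (f, f') = (g f, g' f')\<close> on these bases. The tensor product of two categories with finite
  direct sums need not have them: in general \<open>(p, q) \<oplus> (p', q')\<close> is not of the form \<open>(x, y)\<close>.
  Direct sums are added by \<open>add_hull\<close>.\<close>

definition free_prod ::
  "('o, 'm, 'k::field) kcat \<Rightarrow> ('p, 'n, 'k) kcat \<Rightarrow> ('o \<times> 'p, ('m \<times> 'n) \<Rightarrow>\<^sub>0 'k, 'k) kcat" where
  "free_prod C D = \<lparr>
    obj = obj C \<times> obj D,
    hom = (\<lambda>(x, x') (y, y'). {t. Poly_Mapping.keys t \<subseteq> hom C x y \<times> hom D x' y'}),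
    idm = (\<lambda>(x, x'). Poly_Mapping.single (idm C x, idm D x') 1),
    cmp = (\<lambda>(x, x') (y, y') (z, z').
      bilin_ext (\<lambda>(g, g') (f, f'). Poly_Mapping.single (cmp C x y z g f, cmp D x' y' z' g' f') 1)),
    zer = (\<lambda>_ _. 0),
    add = (\<lambda>_ _. (+)),
    scl = (\<lambda>_ _. pscale)\<rparr>"

definition bilin_rels ::
  "('o, 'm, 'k::field) kcat \<Rightarrow> ('p, 'n, 'k) kcat \<Rightarrow> 'o \<times> 'p \<Rightarrow> 'o \<times> 'p \<Rightarrow> (('m \<times> 'n) \<Rightarrow>\<^sub>0 'k) set" where
  "bilin_rels C D = (\<lambda>(x, x') (y, y').
    {Poly_Mapping.single (add C x y f g, h) 1
        - Poly_Mapping.single (f, h) 1 - Poly_Mapping.single (g, h) 1 |f g h.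
      f \<in> hom C x y \<and> g \<in> hom C x y \<and> h \<in> hom D x' y'} \<union>
    {Poly_Mapping.single (f, add D x' y' g h) 1
        - Poly_Mapping.single (f, g) 1 - Poly_Mapping.single (f, h) 1 |f g h.
      f \<in> hom C x y \<and> g \<in> hom D x' y' \<and> h \<in> hom D x' y'} \<union>
    {Poly_Mapping.single (scl C x y c f, g) 1 - Poly_Mapping.single (f, g) c |c f g.
      f \<in> hom C x y \<and> g \<in> hom D x' y'} \<union>
    {Poly_Mapping.single (f, scl D x' y' c g) 1 - Poly_Mapping.single (f, g) c |c f g.
      f \<in> hom C x y \<and> g \<in> hom D x' y'})"

definition tensor ::
  "('o, 'm, 'k::field) kcat \<Rightarrow> ('p, 'n, 'k) kcat \<Rightarrow> ('o \<times> 'p, (('m \<times> 'n) \<Rightarrow>\<^sub>0 'k) set, 'k) kcat" where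
  "tensor C D = quot (free_prod C D) (\<lambda>x y. module.span pscale (bilin_rels C D x y))"


section \<open>Quivers, path algebras and admissible ideals\<close>

definition strongly_locally_finite :: "('v, 'a) pre_digraph \<Rightarrow> bool" where
  "strongly_locally_finite Q \<longleftrightarrow> wf_digraph Q \<and>
    (\<forall>x\<in>verts Q. finite (out_arcs Q x) \<and> finite (in_arcs Q x)) \<and>
    (\<forall>x\<in>verts Q. \<forall>y\<in>verts Q. finite {p. pre_digraph.awalk Q x p y})"

text \<open>A path is a starting vertex with the list of its arrows in the order in which they are
  traversed, so the first arrow is the right-most factor in the notation for composites.\<close>

type_synonym ('v, 'a) path = "'v \<times> 'a list"

definition paths_between :: "('v, 'a) pre_digraph \<Rightarrow> 'v \<Rightarrow> 'v \<Rightarrow> ('v, 'a) path set" where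
  "paths_between Q x y = {(x, p) |p. pre_digraph.awalk Q x p y}"

definition paths :: "('v, 'a) pre_digraph \<Rightarrow> ('v, 'a) path set" where
  "paths Q = (\<Union>x\<in>verts Q. \<Union>y\<in>verts Q. paths_between Q x y)"

definition path_prod ::
  "('v, 'a) pre_digraph \<Rightarrow> ('v, 'a) path \<Rightarrow> ('v, 'a) path \<Rightarrow> ('v, 'a) path \<Rightarrow>\<^sub>0 'k::field" where
  "path_prod Q = (\<lambda>(y, q) (x, p).
    if pre_digraph.cas Q x p y then Poly_Mapping.single (x, p @ q) 1 else 0)"

definition path_algebra :: "('v, 'a) pre_digraph \<Rightarrow> (('v, 'a) path \<Rightarrow>\<^sub>0 'k::field) set" where
  "path_algebra Q = {f. Poly_Mapping.keys f \<subseteq> paths Q}"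

definition path_mult ::
  "('v, 'a) pre_digraph \<Rightarrow> (('v, 'a) path \<Rightarrow>\<^sub>0 'k) \<Rightarrow> (('v, 'a) path \<Rightarrow>\<^sub>0 'k) \<Rightarrow> (('v, 'a) path \<Rightarrow>\<^sub>0 'k::field)" where
  "path_mult Q = bilin_ext (path_prod Q)"

definition path_algebra_ideal :: "('v, 'a) pre_digraph \<Rightarrow> (('v, 'a) path \<Rightarrow>\<^sub>0 'k::field) set \<Rightarrow> bool" where
  "path_algebra_ideal Q I \<longleftrightarrow> I \<subseteq> path_algebra Q \<and> module.subspace pscale I \<and>
    (\<forall>f\<in>I. \<forall>g\<in>path_algebra Q. path_mult Q g f \<in> I \<and> path_mult Q f g \<in> I)"

definition relation :: "('v, 'a) pre_digraph \<Rightarrow> (('v, 'a) path \<Rightarrow>\<^sub>0 'k::field) \<Rightarrow> bool" where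
  "relation Q r \<longleftrightarrow>
    (\<exists>x\<in>verts Q. \<exists>y\<in>verts Q. Poly_Mapping.keys r \<subseteq> {(u, p) \<in> paths_between Q x y. 2 \<le> length p})"

definition admissible :: "('v, 'a) pre_digraph \<Rightarrow> (('v, 'a) path \<Rightarrow>\<^sub>0 'k::field) set \<Rightarrow> bool" where
  "admissible Q I \<longleftrightarrow> (\<exists>R. (\<forall>r\<in>R. relation Q r) \<and> I = path_algebra_ideal Q hull R)"


section \<open>Path categories\<close>

definition vertex_kcat :: "('v, 'a) pre_digraph \<Rightarrow> ('v, ('v, 'a) path \<Rightarrow>\<^sub>0 'k::field, 'k) kcat" where
  "vertex_kcat Q = \<lparr>
    obj = verts Q,
    hom = (\<lambda>x y. {f. Poly_Mapping.keys f \<subseteq> paths_between Q x y}),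
    idm = (\<lambda>x. Poly_Mapping.single (x, []) 1),
    cmp = (\<lambda>_ _ _. path_mult Q),
    zer = (\<lambda>_ _. 0),
    add = (\<lambda>_ _. (+)),
    scl = (\<lambda>_ _. pscale)\<rparr>"

definition path_kcat ::
  "('v, 'a) pre_digraph \<Rightarrow> ('v list, nat \<times> nat \<Rightarrow> (('v, 'a) path \<Rightarrow>\<^sub>0 'k::field), 'k) kcat" where
  "path_kcat Q = add_hull (vertex_kcat Q)"

definition generated_ideal ::
  "('v, 'a) pre_digraph \<Rightarrow> (('v, 'a) path \<Rightarrow>\<^sub>0 'k::field) set \<Rightarrow>
    'v list \<Rightarrow> 'v list \<Rightarrow> (nat \<times> nat \<Rightarrow> (('v, 'a) path \<Rightarrow>\<^sub>0 'k)) set" where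
  "generated_ideal Q I xs ys =
    {M \<in> hom (path_kcat Q) xs ys. \<forall>i<length ys. \<forall>j<length xs. M (i, j) \<in> I}"

definition path_kcat_mod ::
  "('v, 'a) pre_digraph \<Rightarrow> (('v, 'a) path \<Rightarrow>\<^sub>0 'k::field) set \<Rightarrow>
    ('v list, (nat \<times> nat \<Rightarrow> (('v, 'a) path \<Rightarrow>\<^sub>0 'k)) set, 'k) kcat" where
  "path_kcat_mod Q I = quot (path_kcat Q) (generated_ideal Q I)"

text \<open>The full subcategory of \<open>path_kcat_mod Q I\<close> on the vertices, that is, on the direct sums with
  exactly one summand.\<close>

definition path_kcat_mod_vertices ::
  "('v, 'a) pre_digraph \<Rightarrow> (('v, 'a) path \<Rightarrow>\<^sub>0 'k::field) set \<Rightarrow>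
    ('v list, (nat \<times> nat \<Rightarrow> (('v, 'a) path \<Rightarrow>\<^sub>0 'k)) set, 'k) kcat" where
  "path_kcat_mod_vertices Q I = full_subcat (path_kcat_mod Q I) ((\<lambda>x. [x]) ` verts Q)"


section \<open>The product quiver and its ideal\<close>

definition prod_quiver ::
  "('v, 'a) pre_digraph \<Rightarrow> ('w, 'b) pre_digraph \<Rightarrow> ('v \<times> 'w, 'v \<times> 'b + 'a \<times> 'w) pre_digraph" where
  "prod_quiver Q Q' = \<lparr>
    verts = verts Q \<times> verts Q',
    arcs = (verts Q \<times> arcs Q') <+> (arcs Q \<times> verts Q'),
    tail = case_sum (\<lambda>(p, \<beta>). (p, tail Q' \<beta>)) (\<lambda>(\<alpha>, q). (tail Q \<alpha>, q)),
    head = case_sum (\<lambda>(p, \<beta>). (p, head Q' \<beta>)) (\<lambda>(\<alpha>, q). (head Q \<alpha>, q))\<rparr>"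

definition place_right ::
  "'v \<Rightarrow> (('w, 'b) path \<Rightarrow>\<^sub>0 'k) \<Rightarrow> (('v \<times> 'w, 'v \<times> 'b + 'a \<times> 'w) path \<Rightarrow>\<^sub>0 'k::field)" where
  "place_right p = lin_ext (\<lambda>(y, bs). Poly_Mapping.single ((p, y), map (\<lambda>\<beta>. Inl (p, \<beta>)) bs) 1)"

definition place_left ::
  "'w \<Rightarrow> (('v, 'a) path \<Rightarrow>\<^sub>0 'k) \<Rightarrow> (('v \<times> 'w, 'v \<times> 'b + 'a \<times> 'w) path \<Rightarrow>\<^sub>0 'k::field)" where
  "place_left q = lin_ext (\<lambda>(x, as). Poly_Mapping.single ((x, q), map (\<lambda>\<alpha>. Inr (\<alpha>, q)) as) 1)"

definition comm_relation ::
  "('v, 'a) pre_digraph \<Rightarrow> ('w, 'b) pre_digraph \<Rightarrow> 'a \<Rightarrow> 'b \<Rightarrow>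
    (('v \<times> 'w, 'v \<times> 'b + 'a \<times> 'w) path \<Rightarrow>\<^sub>0 'k::field)" where
  "comm_relation Q Q' \<alpha> \<beta> =
    Poly_Mapping.single ((tail Q \<alpha>, tail Q' \<beta>), [Inr (\<alpha>, tail Q' \<beta>), Inl (head Q \<alpha>, \<beta>)]) 1
    - Poly_Mapping.single ((tail Q \<alpha>, tail Q' \<beta>), [Inl (tail Q \<alpha>, \<beta>), Inr (\<alpha>, head Q' \<beta>)]) 1"

definition box_ideal ::
  "('v, 'a) pre_digraph \<Rightarrow> (('v, 'a) path \<Rightarrow>\<^sub>0 'k::field) set \<Rightarrow>
   ('w, 'b) pre_digraph \<Rightarrow> (('w, 'b) path \<Rightarrow>\<^sub>0 'k) set \<Rightarrow>
    (('v \<times> 'w, 'v \<times> 'b + 'a \<times> 'w) path \<Rightarrow>\<^sub>0 'k) set" where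
  "box_ideal Q I Q' I' = path_algebra_ideal (prod_quiver Q Q') hull
    ((\<Union>p\<in>verts Q. place_right p ` I') \<union> (\<Union>q\<in>verts Q'. place_left q ` I) \<union>
     {comm_relation Q Q' \<alpha> \<beta> |\<alpha> \<beta>. \<alpha> \<in> arcs Q \<and> \<beta> \<in> arcs Q'})"

end

theory Submission
  imports Defs
begin

text \<open>Splitting a path of \<open>Q \<times> Q'\<close> into its arrows from \<open>Q\<close> and its arrows from \<open>Q'\<close> gives a full functor
  from the vertices of \<open>K(Q \<times> Q')\<close> to the tensor product of the two quotients, sending a path to the simple
  tensor of its parts. Its kernel contains the box ideal because it contains the generators. For the converse,
  \<open>f \<otimes> g\<close> is sent to the path algebra element that first runs through a copy of \<open>f\<close> and then through a copy
  of \<open>g\<close>; modulo the box ideal this respects the relations of the tensor product, and the commutation relations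
  move every path to such a normal form, so it is a left inverse. Everything else is formal: a full functor
  that is bijective on objects with a given kernel induces such a functor between the categories of formal
  direct sums and an isomorphism from the quotient, and each object \<open>(x\<^sub>1 \<oplus> \<dots> \<oplus> x\<^sub>m, y\<^sub>1 \<oplus> \<dots> \<oplus> y\<^sub>n)\<close> of the tensor
  product is a biproduct of the \<open>(x\<^sub>i, y\<^sub>j)\<close>, which gives essential surjectivity in the third claim.\<close>


section \<open>Linear maps between spaces of finite linear combinations\<close>

text \<open>\<open>box_ideal\<close> is a hull in the path algebra, whereas the kernel of a functor
  is a family of subspaces of morphism spaces, to which minimality of the hull cannot be applied
  directly. It is applied instead to the set of those algebra elements all of whose components e_y f
  e_x lie in the kernel, and this set is an ideal of the algebra. The tensor product consists of
  formal combinations of pairs of morphisms modulo bilinearity. Splitting paths respects composition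
  before these relations are imposed. In the other direction preimages in the path categories must
  be chosen, and the choice need not be linear; the resulting map is linear on formal combinations
  only, and it sends the bilinearity relations into the box ideal because two choices differ by
  elements of \<open>I\<close> or \<open>I'\<close>. For vertices, and for formal sums of pairs of
  vertices, the functor is bijective on objects, which gives two isomorphisms. Formal sums of pairs
  \<open>(X, Y)\<close> in which \<open>X\<close> and \<open>Y\<close> are sums themselves are
  reached only up to isomorphism, so the last comparison is an equivalence.\<close>

lemma lookup_pscale [simp]: "Poly_Mapping.lookup (pscale c f) a = c * Poly_Mapping.lookup f a"
  unfolding pscale_def by (simp add: Poly_Mapping.map.rep_eq when_def)

interpretation pscale: vector_space "pscale :: 'k::field \<Rightarrow> ('p \<Rightarrow>\<^sub>0 'k) \<Rightarrow> ('p \<Rightarrow>\<^sub>0 'k)"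
  by unfold_locales (auto intro!: poly_mapping_eqI simp: lookup_add algebra_simps)

interpretation pscale_pair: module_pair
  "pscale :: 'k::field \<Rightarrow> ('p \<Rightarrow>\<^sub>0 'k) \<Rightarrow> ('p \<Rightarrow>\<^sub>0 'k)"
  "pscale :: 'k \<Rightarrow> ('q \<Rightarrow>\<^sub>0 'k) \<Rightarrow> ('q \<Rightarrow>\<^sub>0 'k)"
  by unfold_locales

abbreviation fin_linear :: "(('p \<Rightarrow>\<^sub>0 'k::field) \<Rightarrow> ('q \<Rightarrow>\<^sub>0 'k)) \<Rightarrow> bool" where
  "fin_linear \<equiv> module_hom pscale pscale"

lemma pscale_single [simp]: "pscale c (Poly_Mapping.single a d) = Poly_Mapping.single a (c * d)"
  by (rule poly_mapping_eqI) (simp add: lookup_single when_def)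

abbreviation basis :: "'p \<Rightarrow> ('p \<Rightarrow>\<^sub>0 'k::field)" where
  "basis a \<equiv> Poly_Mapping.single a 1"

lemma keys_pscale_subset: "Poly_Mapping.keys (pscale c f) \<subseteq> Poly_Mapping.keys f"
  by (auto simp: in_keys_iff)

lemma subspace_keys_subset:
  "pscale.subspace {f :: 'p \<Rightarrow>\<^sub>0 'k::field. Poly_Mapping.keys f \<subseteq> A}"
  by (rule pscale.subspaceI) (auto dest!: subsetD[OF keys_add] subsetD[OF keys_pscale_subset])

lemma sum_singles:
  "f = (\<Sum>a\<in>Poly_Mapping.keys f. pscale (Poly_Mapping.lookup f a) (basis a))"
  by (rule poly_mapping_eqI) (simp add: lookup_sum lookup_single when_def in_keys_iff)

text \<open>Linear conditions are proved with this rule: the vectors that satisfy the condition form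
  a subspace, so it only has to be checked on the basis vectors in the support of
  \<open>f\<close>.\<close>

lemma subspace_singles:
  assumes "pscale.subspace S" and "\<And>a. a \<in> Poly_Mapping.keys f \<Longrightarrow> basis a \<in> S"
  shows "f \<in> S"
  by (subst sum_singles) (intro pscale.subspace_sum pscale.subspace_scale assms)

text \<open>The kernel of \<open>S - T\<close> is a subspace. Agreement is asked only on the support
  of \<open>f\<close>, since the maps compared later are known to agree only on basis vectors that
  are paths with the right end points.\<close>

lemma fin_linear_eqI:
  assumes S: "fin_linear S" and T: "fin_linear T"
    and eq: "\<And>a. a \<in> Poly_Mapping.keys f \<Longrightarrow> S (basis a) = T (basis a)"
  shows "S f = T f"
proof -
  have "f \<in> {f. S f - T f = 0}"
    by (rule subspace_singles)
      (use eq module_hom.subspace_kernel[OF pscale_pair.module_hom_sub[OF S T]] in auto)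
  then show ?thesis by simp
qed

lemma fin_linear_ident: "fin_linear (\<lambda>x. x)"
  by unfold_locales simp_all

lemma fin_linear_comp: "fin_linear S \<Longrightarrow> fin_linear T \<Longrightarrow> fin_linear (\<lambda>x. S (T x))"
  using module_hom_compose[of pscale pscale T pscale S] by (simp add: o_def)

text \<open>Supports change under sums and multiples; a common finite index set makes the sums
  comparable. Points outside the support contribute zero.\<close>

lemma lin_ext_superset:
  assumes "finite A" and "Poly_Mapping.keys f \<subseteq> A"
  shows "lin_ext \<phi> f = (\<Sum>a\<in>A. pscale (Poly_Mapping.lookup f a) (\<phi> a))"
  unfolding lin_ext_def by (rule sum.mono_neutral_left) (use assms in \<open>auto simp: in_keys_iff\<close>)

lemma fin_linear_lin_ext:
  fixes \<phi> :: "'p \<Rightarrow> ('q \<Rightarrow>\<^sub>0 'k::field)"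
  shows "fin_linear (lin_ext \<phi>)"
proof (unfold_locales)
  fix f g :: "'p \<Rightarrow>\<^sub>0 'k"
  let ?A = "Poly_Mapping.keys f \<union> Poly_Mapping.keys g"
  have "lin_ext \<phi> (f + g) = (\<Sum>a\<in>?A. pscale (Poly_Mapping.lookup (f + g) a) (\<phi> a))"
    by (rule lin_ext_superset) (use keys_add[of f g] in auto)
  also have "\<dots> = lin_ext \<phi> f + lin_ext \<phi> g"
    by (simp add: lin_ext_superset[of ?A] lookup_add pscale.scale_left_distrib sum.distrib)
  finally show "lin_ext \<phi> (f + g) = lin_ext \<phi> f + lin_ext \<phi> g" .
next
  fix c and f :: "'p \<Rightarrow>\<^sub>0 'k"
  have "lin_ext \<phi> (pscale c f)
      = (\<Sum>a\<in>Poly_Mapping.keys f. pscale (Poly_Mapping.lookup (pscale c f) a) (\<phi> a))"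
    by (rule lin_ext_superset) (use keys_pscale_subset[of c f] in auto)
  then show "lin_ext \<phi> (pscale c f) = pscale c (lin_ext \<phi> f)"
    by (simp add: lin_ext_def pscale.scale_sum_right)
qed

lemma lin_ext_single [simp]: "lin_ext \<phi> (Poly_Mapping.single a c) = pscale c (\<phi> a)"
  \<comment> \<open>The support is empty for \<open>c = 0\<close>; summing over \<open>{a}\<close>
    covers both cases.\<close>
  using lin_ext_superset[of "{a}" "Poly_Mapping.single a c" \<phi>] by simp

lemma lin_ext_in_subspace:
  assumes "pscale.subspace S" and "\<And>a. a \<in> Poly_Mapping.keys f \<Longrightarrow> \<phi> a \<in> S"
  shows "lin_ext \<phi> f \<in> S"
  unfolding lin_ext_def by (intro pscale.subspace_sum pscale.subspace_scale assms)

lemma lin_ext_diff_in_subspace: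
  assumes S: "pscale.subspace S" and d: "\<And>a. a \<in> Poly_Mapping.keys f \<Longrightarrow> \<phi> a - \<psi> a \<in> S"
  shows "lin_ext \<phi> f - lin_ext \<psi> f \<in> S"
proof -
  have "lin_ext \<phi> f - lin_ext \<psi> f = lin_ext (\<lambda>a. \<phi> a - \<psi> a) f"
    by (simp add: lin_ext_def pscale.scale_right_diff_distrib sum_subtractf)
  then show ?thesis using lin_ext_in_subspace[OF S, of f "\<lambda>a. \<phi> a - \<psi> a"] d by simp
qed

text \<open>The vectors at which the two maps differ by an element of \<open>R\<close> are closed
  under sums and multiples. This serves for maps such as \<open>f \<mapsto> f \<otimes> g\<close>
  into formal combinations, which become linear only modulo the bilinearity relations.\<close>

lemma lin_ext_singles_diff:
  assumes R: "pscale.subspace R" and f: "Poly_Mapping.keys f \<subseteq> A"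
    and add: "\<And>g h. \<lbrakk>Poly_Mapping.keys g \<subseteq> A; Poly_Mapping.keys h \<subseteq> A\<rbrakk>
      \<Longrightarrow> \<phi> (g + h) - \<phi> g - \<phi> h \<in> R"
    and scale: "\<And>c g. Poly_Mapping.keys g \<subseteq> A \<Longrightarrow> \<phi> (pscale c g) - pscale c (\<phi> g) \<in> R"
  shows "lin_ext (\<lambda>a. \<phi> (basis a)) f - \<phi> f \<in> R"
proof -
  let ?L = "lin_ext (\<lambda>a. \<phi> (basis a))"
  let ?K = "{f. Poly_Mapping.keys f \<subseteq> A}"
  have "f \<in> {f \<in> ?K. ?L f - \<phi> f \<in> R}" (is "f \<in> ?S")
  proof (rule subspace_singles)
    show "pscale.subspace ?S"
    proof (rule pscale.subspaceI)
      \<comment> \<open>A map that is linear only modulo \<open>R\<close> need not send 0 to 0;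
        homogeneity with scalar 0 puts its value there in \<open>R\<close>.\<close>
      have "- \<phi> 0 \<in> R" using pscale.subspace_neg[OF R scale[of 0 0]] by simp
      then show "0 \<in> ?S" by (simp add: module_hom.zero[OF fin_linear_lin_ext])
    next
      fix g h assume gh: "g \<in> ?S" "h \<in> ?S"
      then have "?L g - \<phi> g \<in> R" "?L h - \<phi> h \<in> R" "\<phi> (g + h) - \<phi> g - \<phi> h \<in> R"
        using add[of g h] by simp_all
      from pscale.subspace_diff[OF R pscale.subspace_add[OF R this(1,2)] this(3)]
      have "?L (g + h) - \<phi> (g + h) \<in> R"
        by (simp add: module_hom.add[OF fin_linear_lin_ext] algebra_simps)
      then show "g + h \<in> ?S" using pscale.subspace_add[OF subspace_keys_subset, of g A h] gh by simp
    next
      fix c g assume g: "g \<in> ?S"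
      then have "?L g - \<phi> g \<in> R" "\<phi> (pscale c g) - pscale c (\<phi> g) \<in> R"
        using scale[of g c] by simp_all
      from pscale.subspace_diff[OF R pscale.subspace_scale[OF R this(1)] this(2), of c]
      have "?L (pscale c g) - \<phi> (pscale c g) \<in> R"
        by (simp add: module_hom.scale[OF fin_linear_lin_ext] pscale.scale_right_diff_distrib)
      then show "pscale c g \<in> ?S" using pscale.subspace_scale[OF subspace_keys_subset, of g A c] g by simp
    qed
    show "basis a \<in> ?S" if "a \<in> Poly_Mapping.keys f" for a
      using that f pscale.subspace_0[OF R] by auto
  qed
  then show ?thesis by simp
qed

section \<open>Bilinear extensions and categories with a multiplicative basis\<close>

lemma bilin_ext_eq_left: "bilin_ext \<mu> f g = lin_ext (\<lambda>a. lin_ext (\<mu> a) g) f"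
  by (simp add: bilin_ext_def lin_ext_def pscale.scale_sum_right)

lemma bilin_ext_eq_right: "bilin_ext \<mu> f g = lin_ext (\<lambda>b. lin_ext (\<lambda>a. \<mu> a b) f) g"
  unfolding bilin_ext_def
  by (subst sum.swap) (simp add: lin_ext_def pscale.scale_sum_right mult.commute)

lemma fin_linear_bilin_ext_left: "fin_linear (\<lambda>f. bilin_ext \<mu> f g)"
  unfolding bilin_ext_eq_left by (rule fin_linear_lin_ext)

lemma fin_linear_bilin_ext_right: "fin_linear (bilin_ext \<mu> f)"
proof -
  have "bilin_ext \<mu> f = (\<lambda>g. bilin_ext \<mu> f g)" ..
  then show ?thesis unfolding bilin_ext_eq_right by (simp only: fin_linear_lin_ext)
qed

lemmas bilin_ext_add_left = module_hom.add[OF fin_linear_bilin_ext_left]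
  and bilin_ext_add_right = module_hom.add[OF fin_linear_bilin_ext_right]
  and bilin_ext_diff_left = module_hom.diff[OF fin_linear_bilin_ext_left]
  and bilin_ext_diff_right = module_hom.diff[OF fin_linear_bilin_ext_right]
  and bilin_ext_scale_left = module_hom.scale[OF fin_linear_bilin_ext_left]
  and bilin_ext_scale_right = module_hom.scale[OF fin_linear_bilin_ext_right]
  and bilin_ext_zero_left [simp] = module_hom.zero[OF fin_linear_bilin_ext_left]
  and bilin_ext_zero_right [simp] = module_hom.zero[OF fin_linear_bilin_ext_right]

lemma bilin_ext_single [simp]:
  "bilin_ext \<mu> (Poly_Mapping.single a c) (Poly_Mapping.single b d) = pscale (c * d) (\<mu> a b)"
  by (simp add: bilin_ext_eq_left mult.commute)

lemma bilin_ext_in_subspace: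
  assumes "pscale.subspace S"
    and "\<And>a b. a \<in> Poly_Mapping.keys f \<Longrightarrow> b \<in> Poly_Mapping.keys g \<Longrightarrow> \<mu> a b \<in> S"
  shows "bilin_ext \<mu> f g \<in> S"
  unfolding bilin_ext_eq_left by (intro lin_ext_in_subspace assms)

text \<open>Composition is bilinear by construction, so only typing, unit laws and associativity
  carry content, and these need to be known only on basis elements, which compose to basis elements.
  The instances are the path category of a quiver and the formal combinations of pairs of morphisms
  behind the tensor product.\<close>

lemma kcategory_linearization:
  fixes C :: "('o, 'p \<Rightarrow>\<^sub>0 'k::field, 'k) kcat"
  assumes hom: "\<And>x y. hom C x y = {f. Poly_Mapping.keys f \<subseteq> B x y}"
    and zer: "\<And>x y. zer C x y = 0"
    and add: "\<And>x y. add C x y = (+)"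
    and scl: "\<And>x y. scl C x y = pscale"
    and cmp: "\<And>x y z. cmp C x y z = bilin_ext (\<mu> x y z)"
    and idm: "\<And>x. x \<in> obj C \<Longrightarrow> idm C x = basis (e x) \<and> e x \<in> B x x"
    and mult: "\<And>x y z a b. \<lbrakk>x \<in> obj C; y \<in> obj C; z \<in> obj C; a \<in> B x y; b \<in> B y z\<rbrakk>
      \<Longrightarrow> \<mu> x y z b a = basis (m x y z b a) \<and> m x y z b a \<in> B x z"
    and unit: "\<And>x y a. \<lbrakk>x \<in> obj C; y \<in> obj C; a \<in> B x y\<rbrakk>
      \<Longrightarrow> m x y y (e y) a = a \<and> m x x y a (e x) = a"
    and assoc: "\<And>w x y z a b c.
      \<lbrakk>w \<in> obj C; x \<in> obj C; y \<in> obj C; z \<in> obj C; a \<in> B w x; b \<in> B x y; c \<in> B y z\<rbrakk>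
      \<Longrightarrow> m w x z (m x y z c b) a = m w y z c (m w x y b a)"
  shows "kcategory C"
proof
  show "zer C x y \<in> hom C x y" for x y by (simp add: hom zer)
  show "add C x y f g \<in> hom C x y" if "f \<in> hom C x y" "g \<in> hom C x y" for x y f g
    using that subspace_keys_subset[THEN pscale.subspace_add, of f "B x y" g] by (simp add: hom add)
  show "scl C x y c f \<in> hom C x y" if "f \<in> hom C x y" for x y f c
    using that subspace_keys_subset[THEN pscale.subspace_scale, of f "B x y" c]
    by (simp add: hom scl)
  show "\<exists>g\<in>hom C x y. add C x y f g = zer C x y" if "f \<in> hom C x y" for x y f
    using that by (intro bexI[of _ "- f"]) (simp_all add: hom add zer)
  show "idm C x \<in> hom C x x" if "x \<in> obj C" for x
    using idm[OF that] by (simp add: hom)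
  show "cmp C x y z g f \<in> hom C x z"
    if "x \<in> obj C" "y \<in> obj C" "z \<in> obj C" "f \<in> hom C x y" "g \<in> hom C y z" for x y z f g
    unfolding hom cmp
    by (rule bilin_ext_in_subspace[OF subspace_keys_subset])
      (use that mult[of x y z] in \<open>fastforce simp: hom\<close>)
  show "cmp C x y y (idm C y) f = f" if "x \<in> obj C" "y \<in> obj C" "f \<in> hom C x y" for x y f
    unfolding cmp
    by (rule fin_linear_eqI[OF fin_linear_bilin_ext_right fin_linear_ident])
      (use that idm[of y] mult[of x y y] unit[of x y] in \<open>auto simp: hom\<close>)
  show "cmp C x x y f (idm C x) = f" if "x \<in> obj C" "y \<in> obj C" "f \<in> hom C x y" for x y f
    unfolding cmp
    by (rule fin_linear_eqI[OF fin_linear_bilin_ext_left fin_linear_ident])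
      (use that idm[of x] mult[of x x y] unit[of x y] in \<open>auto simp: hom\<close>)
  show "cmp C w x z (cmp C x y z h g) f = cmp C w y z h (cmp C w x y g f)"
    if ob: "w \<in> obj C" "x \<in> obj C" "y \<in> obj C" "z \<in> obj C"
      and f: "f \<in> hom C w x" and g: "g \<in> hom C x y" and h: "h \<in> hom C y z" for w x y z f g h
    unfolding cmp
  \<comment> \<open>Both sides are linear in each of \<open>f\<close>, \<open>g\<close> and
    \<open>h\<close>; these are replaced by basis elements one after the other.\<close>
  proof (rule fin_linear_eqI[of "\<lambda>f. bilin_ext (\<mu> w x z) (bilin_ext (\<mu> x y z) h g) f"
        "\<lambda>f. bilin_ext (\<mu> w y z) h (bilin_ext (\<mu> w x y) g f)"]; (intro fin_linear_bilin_ext_right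
        fin_linear_bilin_ext_left fin_linear_comp[of "bilin_ext (\<mu> w y z) h"])?)
    fix a assume "a \<in> Poly_Mapping.keys f"
    then have a: "a \<in> B w x" using f by (auto simp: hom)
    let ?a = "basis a :: 'p \<Rightarrow>\<^sub>0 'k"
    show "bilin_ext (\<mu> w x z) (bilin_ext (\<mu> x y z) h g) ?a
      = bilin_ext (\<mu> w y z) h (bilin_ext (\<mu> w x y) g ?a)"
    proof (rule fin_linear_eqI[of "\<lambda>g. bilin_ext (\<mu> w x z) (bilin_ext (\<mu> x y z) h g) ?a"
          "\<lambda>g. bilin_ext (\<mu> w y z) h (bilin_ext (\<mu> w x y) g ?a)"]; (intro fin_linear_bilin_ext_right
          fin_linear_bilin_ext_left fin_linear_comp[of "bilin_ext (\<mu> w y z) h"]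
          fin_linear_comp[of "\<lambda>h. bilin_ext (\<mu> w x z) h ?a"])?)
      fix b assume "b \<in> Poly_Mapping.keys g"
      then have b: "b \<in> B x y" using g by (auto simp: hom)
      let ?b = "basis b :: 'p \<Rightarrow>\<^sub>0 'k"
      show "bilin_ext (\<mu> w x z) (bilin_ext (\<mu> x y z) h ?b) ?a
        = bilin_ext (\<mu> w y z) h (bilin_ext (\<mu> w x y) ?b ?a)"
      proof (rule fin_linear_eqI[of "\<lambda>h. bilin_ext (\<mu> w x z) (bilin_ext (\<mu> x y z) h ?b) ?a"
            "\<lambda>h. bilin_ext (\<mu> w y z) h (bilin_ext (\<mu> w x y) ?b ?a)"]; (intro fin_linear_bilin_ext_left
            fin_linear_comp[of "\<lambda>h. bilin_ext (\<mu> w x z) h ?a"])?)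
        fix c assume "c \<in> Poly_Mapping.keys h"
        then have c: "c \<in> B y z" using h by (auto simp: hom)
        show "bilin_ext (\<mu> w x z) (bilin_ext (\<mu> x y z) (basis c) ?b) ?a
          = bilin_ext (\<mu> w y z) (basis c) (bilin_ext (\<mu> w x y) ?b ?a)"
          using mult[OF ob(1-3) a b] mult[OF ob(2-4) b c] assoc[OF ob a b c]
            mult[OF ob(1,2,4) a, of "m x y z c b"] mult[OF ob(1,3,4) _ c, of "m w x y b a"]
          by simp
      qed
    qed
  qed
qed (simp_all add: add zer scl cmp pscale.scale_left_distrib pscale.scale_right_distrib
    bilin_ext_add_left bilin_ext_add_right bilin_ext_scale_left bilin_ext_scale_right add.assoc add.commute)

section \<open>\<open>K\<close>-categories\<close>

text \<open>Addition of morphisms depends on the pair of objects, so sums are built from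
  \<open>add C x y\<close>. Adding the last term on the outside suits the inductions below, unlike
  the \<open>foldr\<close> in \<open>add_hull\<close>.\<close>

primrec ksum :: "('o, 'm, 'k::field) kcat \<Rightarrow> 'o \<Rightarrow> 'o \<Rightarrow> (nat \<Rightarrow> 'm) \<Rightarrow> nat \<Rightarrow> 'm" where
  "ksum C x y f 0 = zer C x y"
| "ksum C x y f (Suc n) = add C x y (ksum C x y f n) (f n)"

lemma ksum_cong:
  assumes "x = x'" "y = y'" "n = m" and "\<And>i. i < m \<Longrightarrow> f i = g i"
  shows "ksum C x y f n = ksum C x' y' g m"
proof -
  have "ksum C x y f m = ksum C x y g m" using assms(4) by (induction m) auto
  then show ?thesis using assms(1-3) by simp
qed

context kcategory
begin

lemma add_zer_right: "\<lbrakk>x \<in> obj C; y \<in> obj C; f \<in> hom C x y\<rbrakk> \<Longrightarrow> add C x y f (zer C x y) = f"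
  by (metis add_comm add_zer zer_hom)

lemma add_left_comm:
  "\<lbrakk>x \<in> obj C; y \<in> obj C; f \<in> hom C x y; g \<in> hom C x y; h \<in> hom C x y\<rbrakk>
    \<Longrightarrow> add C x y f (add C x y g h) = add C x y g (add C x y f h)"
  by (metis add_assoc add_comm)

lemma add_swap:
  assumes "x \<in> obj C" "y \<in> obj C" "f \<in> hom C x y" "g \<in> hom C x y" "h \<in> hom C x y" "k \<in> hom C x y"
  shows "add C x y (add C x y f g) (add C x y h k) = add C x y (add C x y f h) (add C x y g k)"
  using assms by (simp add: add_assoc add_left_comm add_hom)

lemma add_left_cancel:
  assumes ob: "x \<in> obj C" "y \<in> obj C" and h: "f \<in> hom C x y" "g \<in> hom C x y" "h \<in> hom C x y"
    and eq: "add C x y f g = add C x y f h"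
  shows "g = h"
proof -
  obtain k where k: "k \<in> hom C x y" "add C x y f k = zer C x y"
    using add_inv[OF ob h(1)] by blast
  have "add C x y k (add C x y f g) = add C x y k (add C x y f h)"
    using eq by simp
  then show ?thesis
    using k ob h by (metis add_assoc add_comm add_zer)
qed

lemma scl_zero:
  assumes ob: "x \<in> obj C" "y \<in> obj C" and f: "f \<in> hom C x y"
  shows "scl C x y 0 f = zer C x y"
proof (rule add_left_cancel[OF ob])
  show "add C x y (scl C x y 0 f) (scl C x y 0 f) = add C x y (scl C x y 0 f) (zer C x y)"
    using scl_add_left[OF ob f, of 0 0] by (simp add: add_zer add_zer_right ob f scl_hom)
qed (simp_all add: ob f scl_hom zer_hom)

lemma add_scl_minus_one:
  assumes ob: "x \<in> obj C" "y \<in> obj C" and f: "f \<in> hom C x y"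
  shows "add C x y f (scl C x y (- 1) f) = zer C x y"
  using scl_add_left[OF ob f, of 1 "- 1"] by (simp add: scl_zero scl_one ob f)

lemma scl_zer: "\<lbrakk>x \<in> obj C; y \<in> obj C\<rbrakk> \<Longrightarrow> scl C x y c (zer C x y) = zer C x y"
  by (metis mult_zero_right scl_scl scl_zero zer_hom)

lemma cmp_zer_left:
  "\<lbrakk>x \<in> obj C; y \<in> obj C; z \<in> obj C; f \<in> hom C x y\<rbrakk> \<Longrightarrow> cmp C x y z (zer C y z) f = zer C x z"
  by (metis cmp_hom cmp_scl_left scl_zero zer_hom)

lemma cmp_zer_right:
  "\<lbrakk>x \<in> obj C; y \<in> obj C; z \<in> obj C; g \<in> hom C y z\<rbrakk> \<Longrightarrow> cmp C x y z g (zer C x y) = zer C x z"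
  by (metis cmp_hom cmp_scl_right scl_zero zer_hom)

lemma ksum_hom:
  "\<lbrakk>x \<in> obj C; y \<in> obj C; \<And>i. i < n \<Longrightarrow> f i \<in> hom C x y\<rbrakk> \<Longrightarrow> ksum C x y f n \<in> hom C x y"
  by (induction n) (auto intro: zer_hom add_hom)

text \<open>Splitting the last entry off a list of summands turns it into the start value of
  \<open>foldr\<close>; this takes it out again as an ordinary summand, which links the sums of
  \<open>add_hull\<close> with \<open>ksum\<close>.\<close>

lemma foldr_add_acc:
  "\<lbrakk>x \<in> obj C; y \<in> obj C; set fs \<subseteq> hom C x y; g \<in> hom C x y\<rbrakk>
    \<Longrightarrow> foldr (add C x y) fs g = add C x y (foldr (add C x y) fs (zer C x y)) g
      \<and> foldr (add C x y) fs g \<in> hom C x y"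
proof (induction fs)
  case Nil
  then show ?case by (simp add: add_zer add_zer_right)
next
  case (Cons f fs)
  then have "foldr (add C x y) fs' (zer C x y) \<in> hom C x y" if "set fs' \<subseteq> hom C x y" for fs'
    using that by (induction fs') (auto intro: add_hom zer_hom)
  then show ?case using Cons by (simp add: add_assoc add_hom)
qed

lemma foldr_add_eq_ksum:
  "\<lbrakk>x \<in> obj C; y \<in> obj C; \<And>i. i < n \<Longrightarrow> f i \<in> hom C x y\<rbrakk>
    \<Longrightarrow> foldr (add C x y) (map f [0..<n]) (zer C x y) = ksum C x y f n"
proof (induction n)
  case (Suc n)
  have "foldr (add C x y) (map f [0..<n]) (f n)
      = add C x y (foldr (add C x y) (map f [0..<n]) (zer C x y)) (f n)"
    using Suc.prems by (intro conjunct1[OF foldr_add_acc]) auto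
  then show ?case using Suc by (simp add: add_zer add_zer_right)
qed simp

lemma ksum_zer:
  "\<lbrakk>x \<in> obj C; y \<in> obj C; \<And>i. i < n \<Longrightarrow> f i = zer C x y\<rbrakk> \<Longrightarrow> ksum C x y f n = zer C x y"
  by (induction n) (auto simp: add_zer add_zer_right zer_hom)

lemma ksum_single:
  "\<lbrakk>x \<in> obj C; y \<in> obj C; i < n; f i \<in> hom C x y; \<And>j. j < n \<Longrightarrow> j \<noteq> i \<Longrightarrow> f j = zer C x y\<rbrakk>
    \<Longrightarrow> ksum C x y f n = f i"
proof (induction n)
  case (Suc n)
  show ?case
  proof (cases "i = n")
    case True
    then have "ksum C x y f n = zer C x y"
      using Suc.prems by (intro ksum_zer) auto
    then show ?thesis using True Suc.prems by (simp add: add_zer add_zer_right)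
  next
    case False
    then show ?thesis using Suc by (simp add: add_zer add_zer_right)
  qed
qed simp

lemma ksum_add:
  "\<lbrakk>x \<in> obj C; y \<in> obj C; \<And>i. i < n \<Longrightarrow> f i \<in> hom C x y; \<And>i. i < n \<Longrightarrow> g i \<in> hom C x y\<rbrakk>
    \<Longrightarrow> ksum C x y (\<lambda>i. add C x y (f i) (g i)) n = add C x y (ksum C x y f n) (ksum C x y g n)"
  by (induction n) (auto simp: add_zer add_zer_right zer_hom add_swap ksum_hom)

lemma ksum_scl:
  "\<lbrakk>x \<in> obj C; y \<in> obj C; \<And>i. i < n \<Longrightarrow> f i \<in> hom C x y\<rbrakk>
    \<Longrightarrow> ksum C x y (\<lambda>i. scl C x y c (f i)) n = scl C x y c (ksum C x y f n)"
  by (induction n) (auto simp: scl_zer scl_add_right ksum_hom)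

lemma cmp_ksum_right:
  "\<lbrakk>x \<in> obj C; y \<in> obj C; z \<in> obj C; g \<in> hom C y z; \<And>i. i < n \<Longrightarrow> f i \<in> hom C x y\<rbrakk>
    \<Longrightarrow> cmp C x y z g (ksum C x y f n) = ksum C x z (\<lambda>i. cmp C x y z g (f i)) n"
  by (induction n) (auto simp: cmp_zer_right cmp_add_right ksum_hom)

lemma cmp_ksum_left:
  "\<lbrakk>x \<in> obj C; y \<in> obj C; z \<in> obj C; f \<in> hom C x y; \<And>i. i < n \<Longrightarrow> g i \<in> hom C y z\<rbrakk>
    \<Longrightarrow> cmp C x y z (ksum C y z g n) f = ksum C x z (\<lambda>i. cmp C x y z (g i) f) n"
  by (induction n) (auto simp: cmp_zer_left cmp_add_left ksum_hom)

lemma ksum_swap: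
  "\<lbrakk>x \<in> obj C; y \<in> obj C; \<And>i j. i < n \<Longrightarrow> j < m \<Longrightarrow> f i j \<in> hom C x y\<rbrakk>
    \<Longrightarrow> ksum C x y (\<lambda>i. ksum C x y (f i) m) n = ksum C x y (\<lambda>j. ksum C x y (\<lambda>i. f i j) n) m"
proof (induction n)
  case 0
  then show ?case by (simp add: ksum_zer)
next
  case (Suc n)
  then show ?case by (simp add: ksum_add ksum_hom)
qed

lemma ksum_split:
  "\<lbrakk>x \<in> obj C; y \<in> obj C; \<And>i. i < n + m \<Longrightarrow> f i \<in> hom C x y\<rbrakk>
    \<Longrightarrow> ksum C x y f (n + m) = add C x y (ksum C x y f n) (ksum C x y (\<lambda>i. f (n + i)) m)"
  by (induction m) (auto simp: add_zer add_zer_right add_assoc ksum_hom)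

text \<open>Pairs \<open>(i, j)\<close> with \<open>j < m\<close> are numbered by
  \<open>i * m + j\<close>. The summands of a tensor product of two biproducts are listed in this
  way.\<close>

lemma ksum_prod:
  "\<lbrakk>x \<in> obj C; y \<in> obj C; \<And>i j. i < n \<Longrightarrow> j < m \<Longrightarrow> f i j \<in> hom C x y\<rbrakk>
    \<Longrightarrow> ksum C x y (\<lambda>a. f (a div m) (a mod m)) (n * m) = ksum C x y (\<lambda>i. ksum C x y (f i) m) n"
proof (induction n)
  case (Suc n)
  have hom: "f (a div m) (a mod m) \<in> hom C x y" if "a < n * m + m" for a
  proof (rule Suc.prems(3))
    show "a div m < Suc n"
      using that less_mult_imp_div_less[of a "Suc n" m] by (simp add: add.commute)
    show "a mod m < m" using that by (cases m) auto
  qed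
  have "ksum C x y (\<lambda>a. f (a div m) (a mod m)) (n * m + m)
    = add C x y (ksum C x y (\<lambda>a. f (a div m) (a mod m)) (n * m))
        (ksum C x y (\<lambda>i. f ((n * m + i) div m) ((n * m + i) mod m)) m)"
    using Suc.prems hom by (intro ksum_split) auto
  also have "ksum C x y (\<lambda>i. f ((n * m + i) div m) ((n * m + i) mod m)) m = ksum C x y (f n) m"
    by (rule ksum_cong) auto
  finally show ?case using Suc by (simp add: add.commute)
qed simp

lemma kcategory_full_subcat: "kcategory (full_subcat C S)"
  by unfold_locales
    (auto simp: full_subcat_def intro: zer_hom add_hom scl_hom idm_hom cmp_hom add_assoc add_comm
      add_zer add_inv scl_one scl_scl scl_add_left scl_add_right cmp_idm_left cmp_idm_right
      cmp_assoc cmp_add_left cmp_add_right cmp_scl_left cmp_scl_right)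

end

context kfunctor
begin

lemma Fm_zer: "\<lbrakk>x \<in> obj C; y \<in> obj C\<rbrakk> \<Longrightarrow> Fm x y (zer C x y) = zer D (Fo x) (Fo y)"
  by (metis Fm_hom Fm_scl Fo_obj cod.scl_zero dom.scl_zero dom.zer_hom)

lemma Fm_ksum:
  "\<lbrakk>x \<in> obj C; y \<in> obj C; \<And>i. i < n \<Longrightarrow> f i \<in> hom C x y\<rbrakk>
    \<Longrightarrow> Fm x y (ksum C x y f n) = ksum D (Fo x) (Fo y) (\<lambda>i. Fm x y (f i)) n"
  by (induction n) (auto simp: Fm_zer Fm_add dom.ksum_hom)

end


section \<open>Categories of formal direct sums\<close>

lemma obj_add_hull [simp]: "obj (add_hull C) = lists (obj C)"
  by (simp add: add_hull_def)

lemma hom_add_hull: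
  "M \<in> hom (add_hull C) xs ys \<longleftrightarrow> M \<in> extensional ({..<length ys} \<times> {..<length xs}) \<and>
    (\<forall>i<length ys. \<forall>j<length xs. M (i, j) \<in> hom C (xs ! j) (ys ! i))"
  by (auto simp: add_hull_def PiE_def Pi_def)

lemma add_hull_entry_hom:
  "\<lbrakk>M \<in> hom (add_hull C) xs ys; i < length ys; j < length xs\<rbrakk> \<Longrightarrow> M (i, j) \<in> hom C (xs ! j) (ys ! i)"
  by (simp add: hom_add_hull)

lemma add_hull_eqI:
  assumes "M \<in> hom (add_hull C) xs ys" and "N \<in> hom (add_hull C) xs ys"
    and "\<And>i j. i < length ys \<Longrightarrow> j < length xs \<Longrightarrow> M (i, j) = N (i, j)"
  shows "M = N"
  by (rule extensionalityI[of _ "{..<length ys} \<times> {..<length xs}"])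
    (use assms in \<open>auto simp: hom_add_hull\<close>)

lemma lists_nth: "xs \<in> lists A \<Longrightarrow> i < length xs \<Longrightarrow> xs ! i \<in> A"
  by (simp add: in_lists_conv_set)

lemma add_hull_entries [simp]:
  assumes "i < length ys" and "j < length xs"
  shows "zer (add_hull C) xs ys (i, j) = zer C (xs ! j) (ys ! i)"
    and "add (add_hull C) xs ys M N (i, j) = add C (xs ! j) (ys ! i) (M (i, j)) (N (i, j))"
    and "scl (add_hull C) xs ys c M (i, j) = scl C (xs ! j) (ys ! i) c (M (i, j))"
  using assms by (simp_all add: add_hull_def)

lemma idm_add_hull_entry [simp]:
  "\<lbrakk>i < length xs; j < length xs\<rbrakk>
    \<Longrightarrow> idm (add_hull C) xs (i, j) = (if i = j then idm C (xs ! i) else zer C (xs ! j) (xs ! i))"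
  by (simp add: add_hull_def)

context kcategory
begin

text \<open>Replacing the \<open>foldr\<close> of the definition by \<open>ksum\<close> makes the
  summation rules available for matrix products.\<close>

lemma cmp_add_hull_entry:
  assumes "xs \<in> lists (obj C)" "ys \<in> lists (obj C)" "zs \<in> lists (obj C)"
    and "M \<in> hom (add_hull C) xs ys" "N \<in> hom (add_hull C) ys zs"
    and "i < length zs" "j < length xs"
  shows "cmp (add_hull C) xs ys zs N M (i, j) = ksum C (xs ! j) (zs ! i)
    (\<lambda>l. cmp C (xs ! j) (ys ! l) (zs ! i) (N (i, l)) (M (l, j))) (length ys)"
proof -
  have "cmp (add_hull C) xs ys zs N M (i, j) = foldr (add C (xs ! j) (zs ! i))
    (map (\<lambda>l. cmp C (xs ! j) (ys ! l) (zs ! i) (N (i, l)) (M (l, j))) [0..<length ys])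
    (zer C (xs ! j) (zs ! i))"
    using assms by (simp add: add_hull_def)
  then show ?thesis
    using assms by (simp add: foldr_add_eq_ksum lists_nth cmp_hom add_hull_entry_hom)
qed

lemma cmp_entries_hom:
  assumes "xs \<in> lists (obj C)" "ys \<in> lists (obj C)" "zs \<in> lists (obj C)"
    and "M \<in> hom (add_hull C) xs ys" "N \<in> hom (add_hull C) ys zs"
    and "i < length zs" "j < length xs" "l < length ys"
  shows "cmp C (xs ! j) (ys ! l) (zs ! i) (N (i, l)) (M (l, j)) \<in> hom C (xs ! j) (zs ! i)"
  using assms by (simp add: lists_nth cmp_hom add_hull_entry_hom)

lemma add_hull_homs:
  assumes "xs \<in> lists (obj C)" "ys \<in> lists (obj C)"
  shows "zer (add_hull C) xs ys \<in> hom (add_hull C) xs ys"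
    and "\<lbrakk>M \<in> hom (add_hull C) xs ys; N \<in> hom (add_hull C) xs ys\<rbrakk>
      \<Longrightarrow> add (add_hull C) xs ys M N \<in> hom (add_hull C) xs ys"
    and "M \<in> hom (add_hull C) xs ys \<Longrightarrow> scl (add_hull C) xs ys c M \<in> hom (add_hull C) xs ys"
    and "idm (add_hull C) xs \<in> hom (add_hull C) xs xs"
    and "\<lbrakk>zs \<in> lists (obj C); M \<in> hom (add_hull C) xs ys; N \<in> hom (add_hull C) ys zs\<rbrakk>
      \<Longrightarrow> cmp (add_hull C) xs ys zs N M \<in> hom (add_hull C) xs zs"
proof -
  show "zer (add_hull C) xs ys \<in> hom (add_hull C) xs ys"
    using assms by (auto simp: hom_add_hull zer_hom lists_nth) (simp add: add_hull_def)
  show "add (add_hull C) xs ys M N \<in> hom (add_hull C) xs ys"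
    if "M \<in> hom (add_hull C) xs ys" "N \<in> hom (add_hull C) xs ys"
    using assms that by (auto simp: hom_add_hull add_hom lists_nth) (simp add: add_hull_def)
  show "scl (add_hull C) xs ys c M \<in> hom (add_hull C) xs ys" if "M \<in> hom (add_hull C) xs ys"
    using assms that by (auto simp: hom_add_hull scl_hom lists_nth) (simp add: add_hull_def)
  show "idm (add_hull C) xs \<in> hom (add_hull C) xs xs"
    using assms by (auto simp: hom_add_hull idm_hom zer_hom lists_nth) (simp add: add_hull_def)
  show "cmp (add_hull C) xs ys zs N M \<in> hom (add_hull C) xs zs"
    if zs: "zs \<in> lists (obj C)" and M: "M \<in> hom (add_hull C) xs ys" and N: "N \<in> hom (add_hull C) ys zs"
  proof -
    have "cmp (add_hull C) xs ys zs N M \<in> extensional ({..<length zs} \<times> {..<length xs})"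
      by (simp add: add_hull_def)
    moreover have "cmp (add_hull C) xs ys zs N M (i, j) \<in> hom C (xs ! j) (zs ! i)"
      if "i < length zs" "j < length xs" for i j
      unfolding cmp_add_hull_entry[OF assms zs M N that]
      by (rule ksum_hom) (use assms zs that cmp_entries_hom[OF assms zs M N that] in \<open>auto simp: lists_nth\<close>)
    ultimately show ?thesis unfolding hom_add_hull by blast
  qed
qed

lemma idm_add_hull_hom: "xs \<in> lists (obj C) \<Longrightarrow> idm (add_hull C) xs \<in> hom (add_hull C) xs xs"
  by (rule add_hull_homs(4))

text \<open>Matrices agree as soon as their entries do, because both are extensional on the index
  range. Each axiom thus reduces to axioms of \<open>C\<close> for the entries, combined with rules
  for finite sums.\<close>

lemma kcategory_add_hull: "kcategory (add_hull C)"
proof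
  note [simp] = add_hull_entry_hom lists_nth cmp_hom ksum_hom add_hull_homs cmp_add_hull_entry
    zer_hom add_hom scl_hom idm_hom
  fix xs ys assume xs: "xs \<in> obj (add_hull C)" and ys: "ys \<in> obj (add_hull C)"
  then have o2: "xs \<in> lists (obj C)" "ys \<in> lists (obj C)" by simp_all
  show "zer (add_hull C) xs ys \<in> hom (add_hull C) xs ys" using o2 by simp
  show "idm (add_hull C) xs \<in> hom (add_hull C) xs xs" using o2 by simp
  fix M assume M: "M \<in> hom (add_hull C) xs ys"
  show "scl (add_hull C) xs ys c M \<in> hom (add_hull C) xs ys" for c using M o2 by simp
  show "add (add_hull C) xs ys (zer (add_hull C) xs ys) M = M"
    by (rule add_hull_eqI[of _ C xs ys]) (use M o2 in \<open>simp_all add: add_zer add_zer_right\<close>)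
  show "\<exists>N\<in>hom (add_hull C) xs ys. add (add_hull C) xs ys M N = zer (add_hull C) xs ys"
  proof
    show "add (add_hull C) xs ys M (scl (add_hull C) xs ys (- 1) M) = zer (add_hull C) xs ys"
      by (rule add_hull_eqI[of _ C xs ys]) (use M o2 in \<open>simp_all add: add_scl_minus_one\<close>)
  qed (use M o2 in simp)
  show "scl (add_hull C) xs ys 1 M = M"
    by (rule add_hull_eqI[of _ C xs ys]) (use M o2 in \<open>simp_all add: scl_one\<close>)
  show "scl (add_hull C) xs ys c (scl (add_hull C) xs ys d M) = scl (add_hull C) xs ys (c * d) M" for c d
    by (rule add_hull_eqI[of _ C xs ys]) (use M o2 in \<open>simp_all add: scl_scl\<close>)
  show "scl (add_hull C) xs ys (c + d) M
      = add (add_hull C) xs ys (scl (add_hull C) xs ys c M) (scl (add_hull C) xs ys d M)" for c d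
    by (rule add_hull_eqI[of _ C xs ys]) (use M o2 in \<open>simp_all add: scl_add_left\<close>)
  show "cmp (add_hull C) xs ys ys (idm (add_hull C) ys) M = M"
  proof (rule add_hull_eqI[of _ C xs ys])
    fix i j assume i: "i < length ys" and j: "j < length xs"
    let ?f = "\<lambda>l. cmp C (xs ! j) (ys ! l) (ys ! i) (idm (add_hull C) ys (i, l)) (M (l, j))"
    \<comment> \<open>Row \<open>i\<close> of the identity matrix is zero outside column
      \<open>i\<close>.\<close>
    have "ksum C (xs ! j) (ys ! i) ?f (length ys) = ?f i"
      by (rule ksum_single) (use M o2 i j in \<open>simp_all add: cmp_zer_left\<close>)
    then show "cmp (add_hull C) xs ys ys (idm (add_hull C) ys) M (i, j) = M (i, j)"
      using M o2 i j by (simp add: cmp_idm_left)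
  qed (use M o2 in simp_all)
  show "cmp (add_hull C) xs xs ys M (idm (add_hull C) xs) = M"
  proof (rule add_hull_eqI[of _ C xs ys])
    fix i j assume i: "i < length ys" and j: "j < length xs"
    let ?f = "\<lambda>l. cmp C (xs ! j) (xs ! l) (ys ! i) (M (i, l)) (idm (add_hull C) xs (l, j))"
    have "ksum C (xs ! j) (ys ! i) ?f (length xs) = ?f j"
      by (rule ksum_single) (use M o2 i j in \<open>simp_all add: cmp_zer_right\<close>)
    then show "cmp (add_hull C) xs xs ys M (idm (add_hull C) xs) (i, j) = M (i, j)"
      using M o2 i j by (simp add: cmp_idm_right)
  qed (use M o2 in simp_all)
  fix N assume N: "N \<in> hom (add_hull C) xs ys"
  show "add (add_hull C) xs ys M N \<in> hom (add_hull C) xs ys" using M N o2 by simp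
  show "add (add_hull C) xs ys M N = add (add_hull C) xs ys N M"
    by (rule add_hull_eqI[of _ C xs ys]) (use M N o2 in \<open>simp_all add: add_comm\<close>)
  show "scl (add_hull C) xs ys c (add (add_hull C) xs ys M N)
      = add (add_hull C) xs ys (scl (add_hull C) xs ys c M) (scl (add_hull C) xs ys c N)" for c
    by (rule add_hull_eqI[of _ C xs ys]) (use M N o2 in \<open>simp_all add: scl_add_right\<close>)
  show "add (add_hull C) xs ys (add (add_hull C) xs ys M N) L
      = add (add_hull C) xs ys M (add (add_hull C) xs ys N L)" if "L \<in> hom (add_hull C) xs ys" for L
    by (rule add_hull_eqI[of _ C xs ys]) (use M N that o2 in \<open>simp_all add: add_assoc\<close>)
next
  note [simp] = add_hull_entry_hom lists_nth cmp_hom ksum_hom add_hull_homs cmp_add_hull_entry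
    zer_hom add_hom scl_hom
  fix xs ys zs f g
  assume "xs \<in> obj (add_hull C)" "ys \<in> obj (add_hull C)" "zs \<in> obj (add_hull C)"
    and f: "f \<in> hom (add_hull C) xs ys" and g: "g \<in> hom (add_hull C) ys zs"
  then have o3: "xs \<in> lists (obj C)" "ys \<in> lists (obj C)" "zs \<in> lists (obj C)" by simp_all
  show "cmp (add_hull C) xs ys zs g f \<in> hom (add_hull C) xs zs"
    using f g o3 by simp
  show "cmp (add_hull C) xs ys zs (scl (add_hull C) ys zs c g) f
      = scl (add_hull C) xs zs c (cmp (add_hull C) xs ys zs g f)" for c
    by (rule add_hull_eqI[of _ C xs zs])
      (use f g o3 in \<open>simp_all add: cmp_scl_left ksum_scl[symmetric] cong: ksum_cong\<close>)
  show "cmp (add_hull C) xs ys zs g (scl (add_hull C) xs ys c f)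
      = scl (add_hull C) xs zs c (cmp (add_hull C) xs ys zs g f)" for c
    by (rule add_hull_eqI[of _ C xs zs])
      (use f g o3 in \<open>simp_all add: cmp_scl_right ksum_scl[symmetric] cong: ksum_cong\<close>)
  show "cmp (add_hull C) xs ys zs (add (add_hull C) ys zs g h) f
      = add (add_hull C) xs zs (cmp (add_hull C) xs ys zs g f) (cmp (add_hull C) xs ys zs h f)"
    if "h \<in> hom (add_hull C) ys zs" for h
    by (rule add_hull_eqI[of _ C xs zs])
      (use f g that o3 in \<open>simp_all add: cmp_add_left ksum_add[symmetric] cong: ksum_cong\<close>)
next
  note [simp] = add_hull_entry_hom lists_nth cmp_hom ksum_hom add_hull_homs cmp_add_hull_entry
    zer_hom add_hom scl_hom
  fix xs ys zs f g h
  assume "xs \<in> obj (add_hull C)" "ys \<in> obj (add_hull C)" "zs \<in> obj (add_hull C)"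
    and "f \<in> hom (add_hull C) xs ys" "g \<in> hom (add_hull C) xs ys" "h \<in> hom (add_hull C) ys zs"
  then show "cmp (add_hull C) xs ys zs h (add (add_hull C) xs ys f g)
      = add (add_hull C) xs zs (cmp (add_hull C) xs ys zs h f) (cmp (add_hull C) xs ys zs h g)"
    by (intro add_hull_eqI[of _ C xs zs])
      (simp_all add: cmp_add_right ksum_add[symmetric] cong: ksum_cong)
next
  note [simp] = add_hull_entry_hom lists_nth cmp_hom ksum_hom add_hull_homs cmp_add_hull_entry
  fix ws xs ys zs f g h
  assume "ws \<in> obj (add_hull C)" "xs \<in> obj (add_hull C)" "ys \<in> obj (add_hull C)"
    "zs \<in> obj (add_hull C)" and fgh: "f \<in> hom (add_hull C) ws xs" "g \<in> hom (add_hull C) xs ys"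
    "h \<in> hom (add_hull C) ys zs"
  then have o4: "ws \<in> lists (obj C)" "xs \<in> lists (obj C)" "ys \<in> lists (obj C)" "zs \<in> lists (obj C)"
    by simp_all
  show "cmp (add_hull C) ws xs zs (cmp (add_hull C) xs ys zs h g) f
      = cmp (add_hull C) ws ys zs h (cmp (add_hull C) ws xs ys g f)"
  proof (rule add_hull_eqI[of _ C ws zs])
    fix i j assume i: "i < length zs" and j: "j < length ws"
    \<comment> \<open>The common term of the two double sums, up to associativity in
      \<open>C\<close>; they differ only in the order of summation.\<close>
    let ?t = "\<lambda>l k. cmp C (ws ! j) (xs ! k) (zs ! i)
      (cmp C (xs ! k) (ys ! l) (zs ! i) (h (i, l)) (g (l, k))) (f (k, j))"
    have "cmp (add_hull C) ws xs zs (cmp (add_hull C) xs ys zs h g) f (i, j)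
      = ksum C (ws ! j) (zs ! i) (\<lambda>k. ksum C (ws ! j) (zs ! i) (\<lambda>l. ?t l k) (length ys)) (length xs)"
      using fgh o4 i j by (simp add: cmp_ksum_left cong: ksum_cong)
    also have "\<dots> = ksum C (ws ! j) (zs ! i)
        (\<lambda>l. ksum C (ws ! j) (zs ! i) (\<lambda>k. ?t l k) (length xs)) (length ys)"
      using fgh o4 i j by (intro ksum_swap) auto
    also have "\<dots> = cmp (add_hull C) ws ys zs h (cmp (add_hull C) ws xs ys g f) (i, j)"
      using fgh o4 i j by (simp add: cmp_ksum_right cmp_assoc cong: ksum_cong)
    finally show "cmp (add_hull C) ws xs zs (cmp (add_hull C) xs ys zs h g) f (i, j)
      = cmp (add_hull C) ws ys zs h (cmp (add_hull C) ws xs ys g f) (i, j)" .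
  qed (use fgh o4 in simp_all)
qed

end

section \<open>Ideals and quotients\<close>

locale kideal = kcategory C for C :: "('o, 'm, 'k::field) kcat" +
  fixes J :: "'o \<Rightarrow> 'o \<Rightarrow> 'm set"
  assumes ideal_sub: "\<lbrakk>x \<in> obj C; y \<in> obj C\<rbrakk> \<Longrightarrow> J x y \<subseteq> hom C x y"
    and ideal_zer: "\<lbrakk>x \<in> obj C; y \<in> obj C\<rbrakk> \<Longrightarrow> zer C x y \<in> J x y"
    and ideal_add: "\<lbrakk>x \<in> obj C; y \<in> obj C; f \<in> J x y; g \<in> J x y\<rbrakk> \<Longrightarrow> add C x y f g \<in> J x y"
    and ideal_scl: "\<lbrakk>x \<in> obj C; y \<in> obj C; f \<in> J x y\<rbrakk> \<Longrightarrow> scl C x y c f \<in> J x y"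
    and ideal_cmp_right: "\<lbrakk>x \<in> obj C; y \<in> obj C; z \<in> obj C; f \<in> J x y; g \<in> hom C y z\<rbrakk>
      \<Longrightarrow> cmp C x y z g f \<in> J x z"
    and ideal_cmp_left: "\<lbrakk>x \<in> obj C; y \<in> obj C; z \<in> obj C; f \<in> hom C x y; g \<in> J y z\<rbrakk>
      \<Longrightarrow> cmp C x y z g f \<in> J x z"
begin

lemma ideal_hom: "\<lbrakk>x \<in> obj C; y \<in> obj C; j \<in> J x y\<rbrakk> \<Longrightarrow> j \<in> hom C x y"
  using ideal_sub by blast

lemma self_in_coset: "\<lbrakk>x \<in> obj C; y \<in> obj C; f \<in> hom C x y\<rbrakk> \<Longrightarrow> f \<in> coset C J x y f"
  unfolding coset_def using ideal_zer add_zer_right by (metis imageI)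

text \<open>Needed to collapse the unions over representatives in \<open>quot\<close> to a single
  coset.\<close>

lemma coset_eqI:
  assumes ob: "x \<in> obj C" "y \<in> obj C" and f: "f \<in> hom C x y" and g: "g \<in> coset C J x y f"
  shows "coset C J x y g = coset C J x y f"
proof -
  obtain j where j: "j \<in> J x y" "g = add C x y f j" using g by (auto simp: coset_def)
  have jh: "j \<in> hom C x y" using ideal_hom ob j by blast
  show ?thesis
  proof (intro equalityI subsetI)
    fix h assume "h \<in> coset C J x y g"
    then obtain k where k: "k \<in> J x y" "h = add C x y g k" by (auto simp: coset_def)
    then have "h = add C x y f (add C x y j k)"
      using add_assoc[OF ob f jh] ideal_hom ob j by simp
    then show "h \<in> coset C J x y f" using ideal_add ob j k by (auto simp: coset_def)
  next
    fix h assume "h \<in> coset C J x y f"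
    then obtain k where k: "k \<in> J x y" "h = add C x y f k" by (auto simp: coset_def)
    \<comment> \<open>This is \<open>k - j\<close>: from \<open>g = f + j\<close> follows
      \<open>f + k = g + (k - j)\<close>.\<close>
    let ?l = "add C x y (scl C x y (- 1) j) k"
    have "?l \<in> J x y" using ideal_add ideal_scl ob j k by blast
    moreover have "h = add C x y g ?l"
    proof -
      have "add C x y g ?l = add C x y f (add C x y j ?l)"
        using j add_assoc[OF ob f jh, of ?l] ob k ideal_hom by (simp add: add_hom scl_hom)
      also have "add C x y j ?l = k"
        using add_assoc[OF ob jh, of "scl C x y (- 1) j" k] add_scl_minus_one[OF ob jh]
          k ob ideal_hom by (simp add: add_zer scl_hom jh)
      finally show ?thesis using k by simp
    qed
    ultimately show "h \<in> coset C J x y g" by (auto simp: coset_def)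
  qed
qed

lemma coset_hom: "\<lbrakk>x \<in> obj C; y \<in> obj C; f \<in> hom C x y; g \<in> coset C J x y f\<rbrakk> \<Longrightarrow> g \<in> hom C x y"
  by (auto simp: coset_def intro: add_hom ideal_hom)

lemma obj_quot [simp]: "obj (quot C J) = obj C"
  by (simp add: quot_def)

lemma hom_quot: "hom (quot C J) x y = coset C J x y ` hom C x y"
  by (simp add: quot_def)

lemma idm_quot: "idm (quot C J) x = coset C J x x (idm C x)"
  by (simp add: quot_def)

lemma zer_quot: "zer (quot C J) x y = coset C J x y (zer C x y)"
  by (simp add: quot_def)

lemma add_quot:
  assumes ob: "x \<in> obj C" "y \<in> obj C" and f: "f \<in> hom C x y" and g: "g \<in> hom C x y"
  shows "add (quot C J) x y (coset C J x y f) (coset C J x y g) = coset C J x y (add C x y f g)"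
proof -
  have "coset C J x y (add C x y f' g') = coset C J x y (add C x y f g)"
    if "f' \<in> coset C J x y f" "g' \<in> coset C J x y g" for f' g'
  proof (rule coset_eqI)
    obtain j k where jk: "j \<in> J x y" "f' = add C x y f j" "k \<in> J x y" "g' = add C x y g k"
      using \<open>f' \<in> _\<close> \<open>g' \<in> _\<close> by (auto simp: coset_def)
    have "add C x y f' g' = add C x y (add C x y f g) (add C x y j k)"
      using jk ob f g by (simp add: add_swap ideal_hom)
    then show "add C x y f' g' \<in> coset C J x y (add C x y f g)"
      using jk ob by (auto simp: coset_def ideal_add)
  qed (use ob f g in \<open>simp_all add: add_hom\<close>)
  then have "(\<Union>f'\<in>coset C J x y f. \<Union>g'\<in>coset C J x y g. coset C J x y (add C x y f' g'))
      = (\<Union>f'\<in>coset C J x y f. \<Union>g'\<in>coset C J x y g. coset C J x y (add C x y f g))"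
    by simp
  also have "\<dots> = coset C J x y (add C x y f g)"
    \<comment> \<open>Both index sets are nonempty, so the union of the constant family is this
      coset.\<close>
    using self_in_coset[OF ob f] self_in_coset[OF ob g] by auto
  finally show ?thesis by (simp add: quot_def)
qed

lemma scl_quot:
  assumes ob: "x \<in> obj C" "y \<in> obj C" and f: "f \<in> hom C x y"
  shows "scl (quot C J) x y c (coset C J x y f) = coset C J x y (scl C x y c f)"
proof -
  have "coset C J x y (scl C x y c f') = coset C J x y (scl C x y c f)"
    if f': "f' \<in> coset C J x y f" for f'
  proof (rule coset_eqI)
    obtain j where j: "j \<in> J x y" "f' = add C x y f j"
      using f' by (auto simp: coset_def)
    then show "scl C x y c f' \<in> coset C J x y (scl C x y c f)"
      using ob f by (auto simp: coset_def ideal_scl scl_add_right ideal_hom)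
  qed (use ob f in \<open>simp_all add: scl_hom\<close>)
  then have "(\<Union>f'\<in>coset C J x y f. coset C J x y (scl C x y c f'))
      = (\<Union>f'\<in>coset C J x y f. coset C J x y (scl C x y c f))"
    by simp
  also have "\<dots> = coset C J x y (scl C x y c f)"
    using self_in_coset[OF ob f] by auto
  finally show ?thesis by (simp add: quot_def)
qed

lemma cmp_quot:
  assumes ob: "x \<in> obj C" "y \<in> obj C" "z \<in> obj C" and f: "f \<in> hom C x y" and g: "g \<in> hom C y z"
  shows "cmp (quot C J) x y z (coset C J y z g) (coset C J x y f) = coset C J x z (cmp C x y z g f)"
proof -
  have "coset C J x z (cmp C x y z g' f') = coset C J x z (cmp C x y z g f)"
    if "f' \<in> coset C J x y f" "g' \<in> coset C J y z g" for f' g'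
  proof (rule coset_eqI)
    obtain j k where jk: "j \<in> J x y" "f' = add C x y f j" "k \<in> J y z" "g' = add C y z g k"
      using \<open>f' \<in> _\<close> \<open>g' \<in> _\<close> by (auto simp: coset_def)
    \<comment> \<open>With \<open>f' = f + j\<close> and \<open>g' = g + k\<close> the product is
      \<open>g f + (g j + k f')\<close>, and both terms in the bracket lie in the ideal.\<close>
    have "cmp C x y z g' f' = add C x z (cmp C x y z g f)
        (add C x z (cmp C x y z g j) (cmp C x y z k f'))"
      using jk ob f g
      by (simp add: cmp_add_left cmp_add_right ideal_hom cmp_hom add_hom add_assoc add_left_comm)
    moreover have "add C x z (cmp C x y z g j) (cmp C x y z k f') \<in> J x z"
      using jk ob f g ideal_add ideal_cmp_left ideal_cmp_right ideal_hom add_hom by simp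
    ultimately show "cmp C x y z g' f' \<in> coset C J x z (cmp C x y z g f)"
      by (auto simp: coset_def)
  qed (use ob f g in \<open>simp_all add: cmp_hom\<close>)
  then have "(\<Union>g'\<in>coset C J y z g. \<Union>f'\<in>coset C J x y f. coset C J x z (cmp C x y z g' f'))
      = (\<Union>g'\<in>coset C J y z g. \<Union>f'\<in>coset C J x y f. coset C J x z (cmp C x y z g f))"
    by simp
  also have "\<dots> = coset C J x z (cmp C x y z g f)"
    using self_in_coset[OF ob(1,2) f] self_in_coset[OF ob(2,3) g] by auto
  finally show ?thesis by (simp add: quot_def)
qed

lemma kcategory_quot: "kcategory (quot C J)"
proof
  show "\<exists>g\<in>hom (quot C J) x y. add (quot C J) x y f g = zer (quot C J) x y"
    if "x \<in> obj (quot C J)" "y \<in> obj (quot C J)" and f: "f \<in> hom (quot C J) x y" for x y f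
  proof -
    have ob: "x \<in> obj C" "y \<in> obj C" using that by simp_all
    obtain h where h: "h \<in> hom C x y" "f = coset C J x y h" using f by (auto simp: hom_quot)
    then show ?thesis
      using ob by (intro bexI[of _ "coset C J x y (scl C x y (- 1) h)"])
        (auto simp: add_quot zer_quot hom_quot scl_hom add_scl_minus_one)
  qed
  show "add (quot C J) x y f g = add (quot C J) x y g f"
    if "x \<in> obj (quot C J)" "y \<in> obj (quot C J)" "f \<in> hom (quot C J) x y" "g \<in> hom (quot C J) x y"
    for x y f g
    using that by (auto simp: hom_quot add_quot add_comm)
qed (auto simp: hom_quot zer_quot idm_quot add_quot scl_quot cmp_quot zer_hom add_hom scl_hom idm_hom
    cmp_hom add_assoc add_zer scl_one scl_scl scl_add_left scl_add_right cmp_idm_left cmp_idm_right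
    cmp_assoc cmp_add_left cmp_add_right cmp_scl_left cmp_scl_right)

lemma coset_eq_iff:
  assumes ob: "x \<in> obj C" "y \<in> obj C" and f: "f \<in> hom C x y" and g: "g \<in> hom C x y"
  shows "coset C J x y f = coset C J x y g \<longleftrightarrow> (\<exists>j\<in>J x y. f = add C x y g j)"
  using self_in_coset[OF ob f] coset_eqI[OF ob g, of f] by (auto simp: coset_def)

lemma coset_eq_zer_iff:
  assumes ob: "x \<in> obj C" "y \<in> obj C" and f: "f \<in> hom C x y"
  shows "coset C J x y f = zer (quot C J) x y \<longleftrightarrow> f \<in> J x y"
  unfolding zer_quot coset_eq_iff[OF ob f zer_hom[OF ob]]
  using add_zer[OF ob] ideal_hom[OF ob] by auto

lemma kfunctor_coset: "kfunctor C (quot C J) (\<lambda>x. x) (coset C J)"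
  by (intro kfunctor.intro kcategory_axioms kcategory_quot kfunctor_axioms.intro)
    (auto simp: hom_quot idm_quot add_quot scl_quot cmp_quot)

end

text \<open>\<open>full_subcat\<close> changes only the field \<open>obj\<close>, which enters
  neither the cosets nor the other fields of \<open>quot\<close>.\<close>

lemma quot_full_subcat: "quot (full_subcat C S) J = full_subcat (quot C J) S"
  by (simp add: quot_def full_subcat_def coset_def)

text \<open>For a path category and the family of morphisms lying in \<open>I\<close> this is
  \<open>generated_ideal\<close>, see \<open>generated_ideal_eq\<close>. Allowing any category and
  any family lets presentations pass to matrices in general.\<close>

definition matrix_ideal ::
  "('o, 'm, 'k::field) kcat \<Rightarrow> ('o \<Rightarrow> 'o \<Rightarrow> 'm set) \<Rightarrow> 'o list \<Rightarrow> 'o list \<Rightarrow> (nat \<times> nat \<Rightarrow> 'm) set" where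
  "matrix_ideal C J xs ys =
    {M \<in> hom (add_hull C) xs ys. \<forall>i<length ys. \<forall>j<length xs. M (i, j) \<in> J (xs ! j) (ys ! i)}"

context kideal
begin

lemma ideal_ksum:
  "\<lbrakk>x \<in> obj C; y \<in> obj C; \<And>i. i < n \<Longrightarrow> f i \<in> J x y\<rbrakk> \<Longrightarrow> ksum C x y f n \<in> J x y"
  by (induction n) (auto intro: ideal_zer ideal_add)

lemma kideal_matrix_ideal: "kideal (add_hull C) (matrix_ideal C J)"
proof (intro kideal.intro kcategory_add_hull kideal_axioms.intro)
  fix xs ys zs assume "xs \<in> obj (add_hull C)" "ys \<in> obj (add_hull C)" "zs \<in> obj (add_hull C)"
  then have ob: "xs \<in> lists (obj C)" "ys \<in> lists (obj C)" "zs \<in> lists (obj C)" by simp_all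
  note [simp] = matrix_ideal_def add_hull_homs cmp_add_hull_entry lists_nth add_hull_entry_hom
  show "cmp (add_hull C) xs ys zs g f \<in> matrix_ideal C J xs zs"
    if "f \<in> matrix_ideal C J xs ys" "g \<in> hom (add_hull C) ys zs" for f g
    using that ob by (auto intro!: ideal_ksum ideal_cmp_right)
  show "cmp (add_hull C) xs ys zs g f \<in> matrix_ideal C J xs zs"
    if "f \<in> hom (add_hull C) xs ys" "g \<in> matrix_ideal C J ys zs" for f g
    using that ob by (auto intro!: ideal_ksum ideal_cmp_left)
qed (auto simp: matrix_ideal_def add_hull_homs lists_nth ideal_zer ideal_add ideal_scl)

end

text \<open>A functor preserves zero, sums, multiples and composites, which gives the closure
  conditions. \<open>J\<close> is prescribed only on objects, so it may be given by another formula
  there, such as membership in an ideal of the path algebra.\<close>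

lemma (in kfunctor) kideal_kernel:
  assumes "\<And>x y. \<lbrakk>x \<in> obj C; y \<in> obj C\<rbrakk>
    \<Longrightarrow> J x y = {f \<in> hom C x y. Fm x y f = zer D (Fo x) (Fo y)}"
  shows "kideal C J"
  by unfold_locales
    (auto simp: assms dom.zer_hom Fm_zer dom.add_hom Fm_add dom.scl_hom Fm_scl dom.cmp_hom Fm_cmp
      cod.add_zer cod.scl_zer cod.zer_hom Fo_obj cod.cmp_zer_left cod.cmp_zer_right Fm_hom)


section \<open>Presentations of \<open>K\<close>-categories\<close>

text \<open>The hypotheses of the first isomorphism theorem: \<open>D\<close> is \<open>C\<close>
  modulo \<open>J\<close>, with objects relabelled by \<open>Fo\<close>. Such presentations are
  carried to tensor products and to direct sums, and \<open>kcat_isomorphic_quot\<close> turns each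
  of them into an isomorphism.\<close>

locale quotient_presentation = kfunctor C D Fo Fm
  for C :: "('o, 'm, 'k::field) kcat" and D :: "('p, 'n, 'k) kcat" and Fo Fm +
  fixes J :: "'o \<Rightarrow> 'o \<Rightarrow> 'm set"
  assumes bij_objs: "bij_betw Fo (obj C) (obj D)"
    and full: "\<lbrakk>x \<in> obj C; y \<in> obj C\<rbrakk> \<Longrightarrow> hom D (Fo x) (Fo y) \<subseteq> Fm x y ` hom C x y"
    and kernel: "\<lbrakk>x \<in> obj C; y \<in> obj C\<rbrakk>
      \<Longrightarrow> J x y = {f \<in> hom C x y. Fm x y f = zer D (Fo x) (Fo y)}"
begin

sublocale kideal C J
  by (rule kideal_kernel) (rule kernel)

text \<open>The difference \<open>f - g\<close>, written with the scalar -1, lies in the kernel when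
  the images agree. The two directions make the induced functor injective on cosets and well
  defined.\<close>

lemma coset_eq_iff_Fm_eq:
  assumes ob: "x \<in> obj C" "y \<in> obj C" and f: "f \<in> hom C x y" and g: "g \<in> hom C x y"
  shows "coset C J x y f = coset C J x y g \<longleftrightarrow> Fm x y f = Fm x y g"
proof
  assume "coset C J x y f = coset C J x y g"
  then obtain j where "j \<in> J x y" "f = add C x y g j"
    using coset_eq_iff[OF ob f g] by blast
  then show "Fm x y f = Fm x y g"
    using ob g by (auto simp: kernel Fm_add cod.add_zer_right Fm_hom Fo_obj)
next
  assume eq: "Fm x y f = Fm x y g"
  let ?j = "add C x y f (scl C x y (- 1) g)"
  have jh: "?j \<in> hom C x y" using ob f g by (simp add: dom.add_hom dom.scl_hom)
  have "?j \<in> J x y"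
    using ob f g jh eq
    by (simp add: kernel Fm_add Fm_scl dom.scl_hom cod.add_scl_minus_one Fm_hom Fo_obj)
  moreover have "f = add C x y g ?j"
    using ob f g dom.add_left_comm[OF ob g f, of "scl C x y (- 1) g"]
    by (simp add: dom.scl_hom dom.add_scl_minus_one dom.add_zer_right)
  ultimately show "coset C J x y f = coset C J x y g"
    using coset_eq_iff[OF ob f g] by blast
qed

text \<open>The choice is harmless: all members of a coset have the same image, see
  \<open>induced_coset\<close>.\<close>

definition induced :: "'o \<Rightarrow> 'o \<Rightarrow> 'm set \<Rightarrow> 'n" where
  "induced x y F = Fm x y (SOME f. f \<in> F)"

lemma induced_coset:
  assumes ob: "x \<in> obj C" "y \<in> obj C" and f: "f \<in> hom C x y"
  shows "induced x y (coset C J x y f) = Fm x y f"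
proof -
  define g where "g = (SOME g. g \<in> coset C J x y f)"
  have g: "g \<in> coset C J x y f"
    unfolding g_def by (rule someI) (rule self_in_coset[OF ob f])
  then have "Fm x y g = Fm x y f"
    using coset_eqI[OF ob f g] coset_eq_iff_Fm_eq[OF ob coset_hom[OF ob f g] f] by simp
  then show ?thesis by (simp add: induced_def g_def)
qed

lemma kfunctor_induced: "kfunctor (quot C J) D Fo induced"
  by (intro kfunctor.intro kcategory_quot cod.kcategory_axioms kfunctor_axioms.intro)
    (auto simp: Fo_obj hom_quot idm_quot add_quot scl_quot cmp_quot induced_coset Fm_hom
      dom.idm_hom dom.add_hom dom.scl_hom dom.cmp_hom Fm_idm Fm_add Fm_scl Fm_cmp)

lemma fully_faithful_induced: "fully_faithful (quot C J) D Fo induced"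
  unfolding fully_faithful_def bij_betw_def
proof (intro ballI conjI)
  fix x y assume "x \<in> obj (quot C J)" "y \<in> obj (quot C J)"
  then have ob: "x \<in> obj C" "y \<in> obj C" by simp_all
  show "inj_on (induced x y) (hom (quot C J) x y)"
    by (rule inj_onI) (clarsimp simp: hom_quot induced_coset coset_eq_iff_Fm_eq ob)
  have "induced x y ` hom (quot C J) x y = Fm x y ` hom C x y"
    by (auto simp: hom_quot image_image induced_coset ob cong: image_cong_simp)
  then show "induced x y ` hom (quot C J) x y = hom D (Fo x) (Fo y)"
    using full[OF ob] Fm_hom ob by auto
qed

lemma kcat_isomorphic_quot: "kcat_isomorphic (quot C J) D"
  unfolding kcat_isomorphic_def
  using kfunctor_induced fully_faithful_induced bij_objs by auto

end

section \<open>Presentations of categories of matrices\<close>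

definition matrix_map ::
  "('o \<Rightarrow> 'o \<Rightarrow> 'm \<Rightarrow> 'n) \<Rightarrow> 'o list \<Rightarrow> 'o list \<Rightarrow> (nat \<times> nat \<Rightarrow> 'm) \<Rightarrow> nat \<times> nat \<Rightarrow> 'n" where
  "matrix_map Fm xs ys M = (\<lambda>(i, j)\<in>{..<length ys} \<times> {..<length xs}. Fm (xs ! j) (ys ! i) (M (i, j)))"

lemma matrix_map_entry [simp]:
  "\<lbrakk>i < length ys; j < length xs\<rbrakk> \<Longrightarrow> matrix_map Fm xs ys M (i, j) = Fm (xs ! j) (ys ! i) (M (i, j))"
  by (simp add: matrix_map_def)

context kfunctor
begin

lemma map_Fo_lists: "xs \<in> lists (obj C) \<Longrightarrow> map Fo xs \<in> lists (obj D)"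
  using Fo_obj by (auto simp: in_lists_conv_set)

lemma matrix_map_hom:
  "\<lbrakk>xs \<in> lists (obj C); ys \<in> lists (obj C); M \<in> hom (add_hull C) xs ys\<rbrakk>
    \<Longrightarrow> matrix_map Fm xs ys M \<in> hom (add_hull D) (map Fo xs) (map Fo ys)"
  by (auto simp: hom_add_hull lists_nth Fm_hom) (simp add: matrix_map_def)

lemma kfunctor_matrix_map: "kfunctor (add_hull C) (add_hull D) (map Fo) (matrix_map Fm)"
proof (intro kfunctor.intro dom.kcategory_add_hull cod.kcategory_add_hull kfunctor_axioms.intro)
  note [simp] = dom.add_hull_homs cod.add_hull_homs dom.idm_add_hull_hom cod.idm_add_hull_hom matrix_map_hom map_Fo_lists lists_nth
    add_hull_entry_hom Fm_hom
  show "map Fo xs \<in> obj (add_hull D)" if "xs \<in> obj (add_hull C)" for xs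
    using that map_Fo_lists by simp
  show "matrix_map Fm xs xs (idm (add_hull C) xs) = idm (add_hull D) (map Fo xs)"
    if "xs \<in> obj (add_hull C)" for xs
    by (rule add_hull_eqI[of _ D "map Fo xs" "map Fo xs"])
      (use that in \<open>simp_all add: Fm_idm Fm_zer\<close>)
  fix xs ys f assume "xs \<in> obj (add_hull C)" "ys \<in> obj (add_hull C)" and f: "f \<in> hom (add_hull C) xs ys"
  then have ob: "xs \<in> lists (obj C)" "ys \<in> lists (obj C)" by simp_all
  show "matrix_map Fm xs ys f \<in> hom (add_hull D) (map Fo xs) (map Fo ys)"
    using f ob by simp
  show "matrix_map Fm xs ys (scl (add_hull C) xs ys c f)
      = scl (add_hull D) (map Fo xs) (map Fo ys) c (matrix_map Fm xs ys f)" for c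
    by (rule add_hull_eqI[of _ D "map Fo xs" "map Fo ys"]) (use f ob in \<open>simp_all add: Fm_scl\<close>)
  show "matrix_map Fm xs ys (add (add_hull C) xs ys f g)
      = add (add_hull D) (map Fo xs) (map Fo ys) (matrix_map Fm xs ys f) (matrix_map Fm xs ys g)"
    if "g \<in> hom (add_hull C) xs ys" for g
    by (rule add_hull_eqI[of _ D "map Fo xs" "map Fo ys"]) (use f that ob in \<open>simp_all add: Fm_add\<close>)
  fix zs g assume "zs \<in> obj (add_hull C)" and g: "g \<in> hom (add_hull C) ys zs"
  then have zs: "zs \<in> lists (obj C)" by simp
  show "matrix_map Fm xs zs (cmp (add_hull C) xs ys zs g f) = cmp (add_hull D) (map Fo xs) (map Fo ys)
      (map Fo zs) (matrix_map Fm ys zs g) (matrix_map Fm xs ys f)"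
    by (rule add_hull_eqI[of _ D "map Fo xs" "map Fo zs"])
      (use f g ob zs in \<open>simp_all add: dom.cmp_add_hull_entry cod.cmp_add_hull_entry Fm_ksum
        dom.cmp_hom Fm_cmp cong: ksum_cong\<close>)
qed

end

context quotient_presentation
begin

text \<open>Fullness and the kernel are conditions on single entries, and \<open>map Fo\<close> is
  bijective on lists because \<open>Fo\<close> is bijective on objects. This carries the result for
  vertices over to formal direct sums.\<close>

lemma quotient_presentation_add_hull:
  "quotient_presentation (add_hull C) (add_hull D) (map Fo) (matrix_map Fm) (matrix_ideal C J)"
proof (intro quotient_presentation.intro kfunctor_matrix_map quotient_presentation_axioms.intro)
  show "bij_betw (map Fo) (obj (add_hull C)) (obj (add_hull D))"
    using bij_lists[OF bij_objs] by simp
  fix xs ys assume "xs \<in> obj (add_hull C)" "ys \<in> obj (add_hull C)"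
  then have ob: "xs \<in> lists (obj C)" "ys \<in> lists (obj C)" by simp_all
  show "hom (add_hull D) (map Fo xs) (map Fo ys) \<subseteq> matrix_map Fm xs ys ` hom (add_hull C) xs ys"
  proof
    fix N assume N: "N \<in> hom (add_hull D) (map Fo xs) (map Fo ys)"
    \<comment> \<open>A preimage is chosen for each entry separately; the chosen entries form a
      preimage of the matrix.\<close>
    have "\<exists>f. f \<in> hom C (xs ! j) (ys ! i) \<and> Fm (xs ! j) (ys ! i) f = N (i, j)"
      if "i < length ys" "j < length xs" for i j
      using full[of "xs ! j" "ys ! i"] N that ob by (fastforce simp: hom_add_hull lists_nth)
    then obtain M where M: "\<And>i j. i < length ys \<Longrightarrow> j < length xs
        \<Longrightarrow> M i j \<in> hom C (xs ! j) (ys ! i) \<and> Fm (xs ! j) (ys ! i) (M i j) = N (i, j)"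
      by metis
    let ?M = "\<lambda>(i, j)\<in>{..<length ys} \<times> {..<length xs}. M i j"
    have M_hom: "?M \<in> hom (add_hull C) xs ys" using M by (auto simp: hom_add_hull)
    moreover have "N = matrix_map Fm xs ys ?M"
      by (rule add_hull_eqI[OF N matrix_map_hom[OF ob M_hom]]) (use M in simp)
    ultimately show "N \<in> matrix_map Fm xs ys ` hom (add_hull C) xs ys" by blast
  qed
  show "matrix_ideal C J xs ys = {M \<in> hom (add_hull C) xs ys.
      matrix_map Fm xs ys M = zer (add_hull D) (map Fo xs) (map Fo ys)}" (is "?L = ?R")
  proof (intro equalityI subsetI)
    fix M assume "M \<in> ?L"
    then have M: "M \<in> hom (add_hull C) xs ys"
      and ker: "\<And>i j. i < length ys \<Longrightarrow> j < length xs \<Longrightarrow> M (i, j) \<in> J (xs ! j) (ys ! i)"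
      by (auto simp: matrix_ideal_def)
    have "matrix_map Fm xs ys M = zer (add_hull D) (map Fo xs) (map Fo ys)"
      by (rule add_hull_eqI[OF matrix_map_hom[OF ob M] cod.add_hull_homs(1)])
        (use ob ker in \<open>simp_all add: map_Fo_lists kernel lists_nth\<close>)
    then show "M \<in> ?R" using M by simp
  next
    fix M assume "M \<in> ?R"
    then have M: "M \<in> hom (add_hull C) xs ys"
      and eq: "matrix_map Fm xs ys M = zer (add_hull D) (map Fo xs) (map Fo ys)" by auto
    have "M (i, j) \<in> J (xs ! j) (ys ! i)" if "i < length ys" "j < length xs" for i j
      using fun_cong[OF eq, of "(i, j)"] that ob M
      by (simp add: kernel lists_nth add_hull_entry_hom)
    then show "M \<in> ?L" using M by (simp add: matrix_ideal_def)
  qed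
qed

end

section \<open>Tensor products\<close>

abbreviation simple :: "'m \<Rightarrow> 'n \<Rightarrow> ('m \<times> 'n) \<Rightarrow>\<^sub>0 'k::field" where
  "simple f g \<equiv> basis (f, g)"

text \<open>Naming the composite of two basis elements makes the composition of
  \<open>free_prod\<close> a \<open>bilin_ext\<close>, so that the linearity rules apply to
  it.\<close>

definition free_prod_cmp ::
  "('o, 'm, 'k::field) kcat \<Rightarrow> ('p, 'n, 'k) kcat \<Rightarrow> 'o \<times> 'p \<Rightarrow> 'o \<times> 'p \<Rightarrow> 'o \<times> 'p \<Rightarrow>
    'm \<times> 'n \<Rightarrow> 'm \<times> 'n \<Rightarrow> ('m \<times> 'n) \<Rightarrow>\<^sub>0 'k" where
  "free_prod_cmp C D = (\<lambda>(x, x') (y, y') (z, z') (g, g') (f, f').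
    simple (cmp C x y z g f) (cmp D x' y' z' g' f'))"

lemma free_prod_cmp_simp [simp]:
  "free_prod_cmp C D (x, x') (y, y') (z, z') (g, g') (f, f')
    = simple (cmp C x y z g f) (cmp D x' y' z' g' f')"
  by (simp add: free_prod_cmp_def)

lemma free_prod_simps [simp]:
  "obj (free_prod C D) = obj C \<times> obj D"
  "hom (free_prod C D) (x, x') (y, y') = {t. Poly_Mapping.keys t \<subseteq> hom C x y \<times> hom D x' y'}"
  "idm (free_prod C D) (x, x') = simple (idm C x) (idm D x')"
  "zer (free_prod C D) a b = 0"
  "add (free_prod C D) a b = (+)"
  "scl (free_prod C D) a b = pscale"
  by (simp_all add: free_prod_def)

lemma cmp_free_prod: "cmp (free_prod C D) a b c = bilin_ext (free_prod_cmp C D a b c)"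
  by (cases a; cases b; cases c) (simp add: free_prod_def free_prod_cmp_def)

abbreviation tensor_rels where
  "tensor_rels C D a b \<equiv> module.span pscale (bilin_rels C D a b)"

locale kcategory_pair = C: kcategory C + D: kcategory D
  for C :: "('o, 'm, 'k::field) kcat" and D :: "('p, 'n, 'k) kcat"
begin

text \<open>Morphisms of \<open>C\<close> and \<open>D\<close> serve only as labels of basis
  elements here, and pairs compose as in a product category; sums of morphisms come into play only
  with the relations.\<close>

lemma kcategory_free_prod: "kcategory (free_prod C D)"
proof (rule kcategory_linearization[where \<mu> = "free_prod_cmp C D"
      and B = "\<lambda>(x, x') (y, y'). hom C x y \<times> hom D x' y'"
      and e = "\<lambda>(x, x'). (idm C x, idm D x')"
      and m = "\<lambda>(x, x') (y, y') (z, z') (g, g') (f, f'). (cmp C x y z g f, cmp D x' y' z' g' f')"])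
qed (auto simp: cmp_free_prod C.cmp_hom D.cmp_hom C.idm_hom D.idm_hom C.cmp_idm_left D.cmp_idm_left
    C.cmp_idm_right D.cmp_idm_right C.cmp_assoc D.cmp_assoc split: prod.splits)

lemma tensor_rels_add_left:
  "\<lbrakk>f \<in> hom C x y; g \<in> hom C x y; h \<in> hom D x' y'\<rbrakk>
    \<Longrightarrow> simple (add C x y f g) h - simple f h - simple g h \<in> tensor_rels C D (x, x') (y, y')"
  by (rule pscale.span_base) (auto simp: bilin_rels_def)

lemma tensor_rels_add_right:
  "\<lbrakk>f \<in> hom C x y; g \<in> hom D x' y'; h \<in> hom D x' y'\<rbrakk>
    \<Longrightarrow> simple f (add D x' y' g h) - simple f g - simple f h \<in> tensor_rels C D (x, x') (y, y')"
  by (rule pscale.span_base) (auto simp: bilin_rels_def)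

lemma tensor_rels_scl_left:
  "\<lbrakk>f \<in> hom C x y; g \<in> hom D x' y'\<rbrakk>
    \<Longrightarrow> simple (scl C x y c f) g - pscale c (simple f g) \<in> tensor_rels C D (x, x') (y, y')"
  by (rule pscale.span_base) (auto simp: bilin_rels_def)

lemma tensor_rels_scl_right:
  "\<lbrakk>f \<in> hom C x y; g \<in> hom D x' y'\<rbrakk>
    \<Longrightarrow> simple f (scl D x' y' c g) - pscale c (simple f g) \<in> tensor_rels C D (x, x') (y, y')"
  by (rule pscale.span_base) (auto simp: bilin_rels_def)

text \<open>A span lies in every subspace that contains its generators. With \<open>S\<close> the
  preimage of a subspace under a linear map, this tests the map on the four kinds of
  relations.\<close>

lemma tensor_rels_subset:
  assumes S: "pscale.subspace S"
    and add_left: "\<And>f g h. \<lbrakk>f \<in> hom C x y; g \<in> hom C x y; h \<in> hom D x' y'\<rbrakk>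
      \<Longrightarrow> simple (add C x y f g) h - simple f h - simple g h \<in> S"
    and add_right: "\<And>f g h. \<lbrakk>f \<in> hom C x y; g \<in> hom D x' y'; h \<in> hom D x' y'\<rbrakk>
      \<Longrightarrow> simple f (add D x' y' g h) - simple f g - simple f h \<in> S"
    and scl_left: "\<And>c f g. \<lbrakk>f \<in> hom C x y; g \<in> hom D x' y'\<rbrakk>
      \<Longrightarrow> simple (scl C x y c f) g - pscale c (simple f g) \<in> S"
    and scl_right: "\<And>c f g. \<lbrakk>f \<in> hom C x y; g \<in> hom D x' y'\<rbrakk>
      \<Longrightarrow> simple f (scl D x' y' c g) - pscale c (simple f g) \<in> S"
  shows "tensor_rels C D (x, x') (y, y') \<subseteq> S"
proof (rule pscale.span_minimal[OF _ S])
  show "bilin_rels C D (x, x') (y, y') \<subseteq> S"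
    using add_left add_right scl_left scl_right by (auto simp: bilin_rels_def)
qed

text \<open>Composing a bilinearity relation with a pair, on either side, gives a bilinearity
  relation of the same kind, because composition in \<open>C\<close> and in \<open>D\<close> is
  bilinear. The rest follows by linearity.\<close>

lemma kideal_tensor_rels: "kideal (free_prod C D) (tensor_rels C D)"
proof (intro kideal.intro kcategory_free_prod kideal_axioms.intro)
  fix a b c assume "a \<in> obj (free_prod C D)" "b \<in> obj (free_prod C D)"
  then obtain x x' y y' where ab: "a = (x, x')" "b = (y, y')"
    and ob: "x \<in> obj C" "x' \<in> obj D" "y \<in> obj C" "y' \<in> obj D"
    by (cases a; cases b) auto
  note [simp] = C.add_hom D.add_hom C.scl_hom D.scl_hom C.cmp_hom D.cmp_hom ob
  have single_hom: "simple f g \<in> hom (free_prod C D) a b" if "f \<in> hom C x y" "g \<in> hom D x' y'" for f g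
    using that by (simp add: ab)
  have subspace: "pscale.subspace (hom (free_prod C D) a b)"
    by (simp add: ab subspace_keys_subset)
  show "tensor_rels C D a b \<subseteq> hom (free_prod C D) a b"
    unfolding ab
    by (rule tensor_rels_subset;
        (intro pscale.subspace_diff pscale.subspace_scale subspace[unfolded ab]
          single_hom[unfolded ab])?) simp_all
  show "zer (free_prod C D) a b \<in> tensor_rels C D a b" by (simp add: pscale.span_zero)
  show "scl (free_prod C D) a b c f \<in> tensor_rels C D a b" if "f \<in> tensor_rels C D a b" for c f
    using that by (simp add: pscale.span_scale)
  show "add (free_prod C D) a b f g \<in> tensor_rels C D a b"
    if "f \<in> tensor_rels C D a b" "g \<in> tensor_rels C D a b" for f g
    using that by (simp add: pscale.span_add)
  assume "c \<in> obj (free_prod C D)"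
  then obtain z z' where c: "c = (z, z')" and ob': "z \<in> obj C" "z' \<in> obj D"
    by (cases c) auto
  note [simp] = ob'
  have sub: "pscale.subspace {t. T t \<in> tensor_rels C D a c}" if "fin_linear T" for T
    by (rule module_hom.subspace_linear_preimage[OF that]) simp
  show "cmp (free_prod C D) a b c g f \<in> tensor_rels C D a c"
    if f: "f \<in> tensor_rels C D a b" and g: "g \<in> hom (free_prod C D) b c" for f g
  proof -
    \<comment> \<open>For fixed \<open>f\<close> the condition is linear in \<open>g\<close>, so
      \<open>g\<close> may be a single pair; for such a pair it is linear in \<open>f\<close>, so
      \<open>f\<close> may be a generator.\<close>
    have "g \<in> {g. bilin_ext (free_prod_cmp C D a b c) g f \<in> tensor_rels C D a c}"
    proof (rule subspace_singles[OF sub[OF fin_linear_bilin_ext_left]])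
      fix k assume "k \<in> Poly_Mapping.keys g"
      then obtain h h' where k: "k = (h, h')" and h: "h \<in> hom C y z" "h' \<in> hom D y' z'"
        using g by (auto simp: ab c)
      have "tensor_rels C D a b
        \<subseteq> {f. bilin_ext (free_prod_cmp C D a b c) (simple h h') f \<in> tensor_rels C D a c}"
        using sub[OF fin_linear_bilin_ext_right]
        unfolding ab c
        by (intro tensor_rels_subset)
          (simp_all add: bilin_ext_diff_right bilin_ext_scale_right h C.cmp_add_right
            D.cmp_add_right C.cmp_scl_right D.cmp_scl_right tensor_rels_add_left
            tensor_rels_add_right tensor_rels_scl_left[simplified] tensor_rels_scl_right[simplified])
      then show "basis k
          \<in> {g. bilin_ext (free_prod_cmp C D a b c) g f \<in> tensor_rels C D a c}"
        using f k by auto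
    qed
    then show ?thesis by (simp add: cmp_free_prod)
  qed
  show "cmp (free_prod C D) a b c g f \<in> tensor_rels C D a c"
    if f: "f \<in> hom (free_prod C D) a b" and g: "g \<in> tensor_rels C D b c" for f g
  proof -
    have "f \<in> {f. bilin_ext (free_prod_cmp C D a b c) g f \<in> tensor_rels C D a c}"
    proof (rule subspace_singles[OF sub[OF fin_linear_bilin_ext_right]])
      fix k assume "k \<in> Poly_Mapping.keys f"
      then obtain h h' where k: "k = (h, h')" and h: "h \<in> hom C x y" "h' \<in> hom D x' y'"
        using f by (auto simp: ab c)
      have "tensor_rels C D b c
        \<subseteq> {g. bilin_ext (free_prod_cmp C D a b c) g (simple h h') \<in> tensor_rels C D a c}"
        using sub[OF fin_linear_bilin_ext_left]
        unfolding ab c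
        by (intro tensor_rels_subset)
          (simp_all add: bilin_ext_diff_left bilin_ext_scale_left h C.cmp_add_left
            D.cmp_add_left C.cmp_scl_left D.cmp_scl_left tensor_rels_add_left
            tensor_rels_add_right tensor_rels_scl_left[simplified] tensor_rels_scl_right[simplified])
      then show "basis k
          \<in> {f. bilin_ext (free_prod_cmp C D a b c) g f \<in> tensor_rels C D a c}"
        using g k by auto
    qed
    then show ?thesis by (simp add: cmp_free_prod)
  qed
qed

sublocale rels: kideal "free_prod C D" "tensor_rels C D"
  by (rule kideal_tensor_rels)

lemma tensor_eq_quot: "tensor C D = quot (free_prod C D) (tensor_rels C D)"
  by (simp add: tensor_def)

lemma kcategory_tensor: "kcategory (tensor C D)"
  unfolding tensor_eq_quot by (rule rels.kcategory_quot)

lemma obj_tensor [simp]: "obj (tensor C D) = obj C \<times> obj D"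
  by (simp add: tensor_eq_quot)

lemma coset_tensor_eqI:
  assumes "a \<in> obj C \<times> obj D" "b \<in> obj C \<times> obj D" "t \<in> hom (free_prod C D) a b"
    and "s - t \<in> tensor_rels C D a b"
  shows "coset (free_prod C D) (tensor_rels C D) a b s = coset (free_prod C D) (tensor_rels C D) a b t"
proof (rule rels.coset_eqI)
  have "s = add (free_prod C D) a b t (s - t)" by simp
  then show "s \<in> coset (free_prod C D) (tensor_rels C D) a b t"
    unfolding coset_def using assms(4) by blast
qed (use assms in simp_all)

definition tens :: "'o \<times> 'p \<Rightarrow> 'o \<times> 'p \<Rightarrow> 'm \<Rightarrow> 'n \<Rightarrow> (('m \<times> 'n) \<Rightarrow>\<^sub>0 'k) set" where
  "tens a b f g = coset (free_prod C D) (tensor_rels C D) a b (simple f g)"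

lemma tens_idm: "idm (tensor C D) (x, x') = tens (x, x') (x, x') (idm C x) (idm D x')"
  by (simp add: tens_def tensor_eq_quot rels.idm_quot)

context
  fixes x x' y y' assumes ob [simp]: "x \<in> obj C" "x' \<in> obj D" "y \<in> obj C" "y' \<in> obj D"
begin

lemma tens_hom:
  "\<lbrakk>f \<in> hom C x y; g \<in> hom D x' y'\<rbrakk> \<Longrightarrow> tens (x, x') (y, y') f g \<in> hom (tensor C D) (x, x') (y, y')"
  by (simp add: tens_def tensor_eq_quot rels.hom_quot)

lemma tens_cmp:
  assumes [simp]: "z \<in> obj C" "z' \<in> obj D" and "f \<in> hom C x y" "f' \<in> hom D x' y'"
    "g \<in> hom C y z" "g' \<in> hom D y' z'"
  shows "cmp (tensor C D) (x, x') (y, y') (z, z') (tens (y, y') (z, z') g g') (tens (x, x') (y, y') f f')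
    = tens (x, x') (z, z') (cmp C x y z g f) (cmp D x' y' z' g' f')"
proof -
  have "simple f f' \<in> hom (free_prod C D) (x, x') (y, y')"
    "simple g g' \<in> hom (free_prod C D) (y, y') (z, z')" using assms by auto
  then show ?thesis by (simp add: tens_def tensor_eq_quot rels.cmp_quot cmp_free_prod)
qed

lemma tens_add_left:
  assumes "f \<in> hom C x y" "g \<in> hom C x y" "h \<in> hom D x' y'"
  shows "tens (x, x') (y, y') (add C x y f g) h
    = add (tensor C D) (x, x') (y, y') (tens (x, x') (y, y') f h) (tens (x, x') (y, y') g h)"
proof -
  have h: "simple f h \<in> hom (free_prod C D) (x, x') (y, y')"
    "simple g h \<in> hom (free_prod C D) (x, x') (y, y')" using assms by auto
  have "tens (x, x') (y, y') (add C x y f g) h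
      = coset (free_prod C D) (tensor_rels C D) (x, x') (y, y') (simple f h + simple g h)"
    unfolding tens_def using rels.add_hom[OF _ _ h] tensor_rels_add_left[OF assms]
    by (intro coset_tensor_eqI) (auto simp: diff_diff_eq)
  then show ?thesis using rels.add_quot[OF _ _ h] by (simp add: tensor_eq_quot tens_def)
qed

lemma tens_add_right:
  assumes "f \<in> hom C x y" "g \<in> hom D x' y'" "h \<in> hom D x' y'"
  shows "tens (x, x') (y, y') f (add D x' y' g h)
    = add (tensor C D) (x, x') (y, y') (tens (x, x') (y, y') f g) (tens (x, x') (y, y') f h)"
proof -
  have h: "simple f g \<in> hom (free_prod C D) (x, x') (y, y')"
    "simple f h \<in> hom (free_prod C D) (x, x') (y, y')" using assms by auto
  have "tens (x, x') (y, y') f (add D x' y' g h)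
      = coset (free_prod C D) (tensor_rels C D) (x, x') (y, y') (simple f g + simple f h)"
    unfolding tens_def using rels.add_hom[OF _ _ h] tensor_rels_add_right[OF assms]
    by (intro coset_tensor_eqI) (auto simp: diff_diff_eq)
  then show ?thesis using rels.add_quot[OF _ _ h] by (simp add: tensor_eq_quot tens_def)
qed

text \<open>Homogeneity with scalar 0 relates this pair to 0 times itself, as a multiple of the zero
  morphism is the zero morphism.\<close>

lemma simple_zer_left:
  assumes "g \<in> hom D x' y'"
  shows "simple (zer C x y) g \<in> tensor_rels C D (x, x') (y, y')"
  using tensor_rels_scl_left[OF C.zer_hom[OF ob(1,3)] assms, of 0]
  by (simp add: C.scl_zer pscale.span_zero del: pscale_single)

lemma simple_zer_right:
  assumes "f \<in> hom C x y"
  shows "simple f (zer D x' y') \<in> tensor_rels C D (x, x') (y, y')"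
  using tensor_rels_scl_right[OF assms D.zer_hom[OF ob(2,4)], of 0]
  by (simp add: D.scl_zer pscale.span_zero del: pscale_single)

lemma tens_zer_left:
  "g \<in> hom D x' y' \<Longrightarrow> tens (x, x') (y, y') (zer C x y) g = zer (tensor C D) (x, x') (y, y')"
  unfolding tens_def tensor_eq_quot rels.zer_quot
  by (rule coset_tensor_eqI) (simp_all add: simple_zer_left)

lemma tens_zer_right:
  "f \<in> hom C x y \<Longrightarrow> tens (x, x') (y, y') f (zer D x' y') = zer (tensor C D) (x, x') (y, y')"
  unfolding tens_def tensor_eq_quot rels.zer_quot
  by (rule coset_tensor_eqI) (simp_all add: simple_zer_right)

lemma tens_ksum_left:
  "\<lbrakk>\<And>i. i < n \<Longrightarrow> f i \<in> hom C x y; g \<in> hom D x' y'\<rbrakk>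
    \<Longrightarrow> tens (x, x') (y, y') (ksum C x y f n) g
      = ksum (tensor C D) (x, x') (y, y') (\<lambda>i. tens (x, x') (y, y') (f i) g) n"
  by (induction n) (simp_all add: tens_zer_left tens_add_left C.ksum_hom)

lemma tens_ksum_right:
  "\<lbrakk>f \<in> hom C x y; \<And>i. i < n \<Longrightarrow> g i \<in> hom D x' y'\<rbrakk>
    \<Longrightarrow> tens (x, x') (y, y') f (ksum D x' y' g n)
      = ksum (tensor C D) (x, x') (y, y') (\<lambda>i. tens (x, x') (y, y') f (g i)) n"
  by (induction n) (simp_all add: tens_zer_right tens_add_right D.ksum_hom)

end

end

text \<open>Morphism spaces and relations do not depend on which objects are present. Together with
  \<open>add_hull_full_subcat\<close> this places the direct sums over the vertex tensor product
  inside those over the full tensor product.\<close>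

lemma tensor_full_subcat:
  "tensor (full_subcat C S) (full_subcat D T) = full_subcat (tensor C D) (S \<times> T)"
  by (auto simp: tensor_def quot_def full_subcat_def free_prod_def bilin_rels_def coset_def)

lemma add_hull_full_subcat: "add_hull (full_subcat C S) = full_subcat (add_hull C) (lists S)"
  by (simp add: add_hull_def full_subcat_def lists_Int_eq cong: if_cong)

section \<open>Biproducts\<close>

text \<open>Only equations between composites and sums occur, so every \<open>K\<close>-functor
  preserves biproducts in this form. For an empty list \<open>zs\<close> the last equation says that
  \<open>x\<close> is a zero object.\<close>

definition is_biproduct ::
  "('o, 'm, 'k::field) kcat \<Rightarrow> 'o \<Rightarrow> 'o list \<Rightarrow> (nat \<Rightarrow> 'm) \<Rightarrow> (nat \<Rightarrow> 'm) \<Rightarrow> bool" where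
  "is_biproduct C x zs \<iota> \<pi> \<longleftrightarrow> x \<in> obj C \<and> zs \<in> lists (obj C) \<and>
    (\<forall>i<length zs. \<iota> i \<in> hom C (zs ! i) x \<and> \<pi> i \<in> hom C x (zs ! i)) \<and>
    (\<forall>i<length zs. \<forall>j<length zs. cmp C (zs ! j) x (zs ! i) (\<pi> i) (\<iota> j)
      = (if i = j then idm C (zs ! i) else zer C (zs ! j) (zs ! i))) \<and>
    ksum C x x (\<lambda>i. cmp C x (zs ! i) x (\<iota> i) (\<pi> i)) (length zs) = idm C x"

lemma is_biproductD:
  assumes "is_biproduct C x zs \<iota> \<pi>"
  shows "x \<in> obj C" and "zs \<in> lists (obj C)"
    and "i < length zs \<Longrightarrow> \<iota> i \<in> hom C (zs ! i) x \<and> \<pi> i \<in> hom C x (zs ! i)"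
    and "\<lbrakk>i < length zs; j < length zs\<rbrakk> \<Longrightarrow> cmp C (zs ! j) x (zs ! i) (\<pi> i) (\<iota> j)
      = (if i = j then idm C (zs ! i) else zer C (zs ! j) (zs ! i))"
    and "ksum C x x (\<lambda>i. cmp C x (zs ! i) x (\<iota> i) (\<pi> i)) (length zs) = idm C x"
  using assms by (auto simp: is_biproduct_def)

lemma (in kfunctor) is_biproduct_map:
  assumes b: "is_biproduct C x zs \<iota> \<pi>"
  shows "is_biproduct D (Fo x) (map Fo zs) (\<lambda>i. Fm (zs ! i) x (\<iota> i)) (\<lambda>i. Fm x (zs ! i) (\<pi> i))"
proof -
  note x = is_biproductD(1)[OF b] and zs = is_biproductD(2)[OF b] and homs = is_biproductD(3)[OF b]
    and orth = is_biproductD(4)[OF b] and total = is_biproductD(5)[OF b]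
  have "ksum D (Fo x) (Fo x) (\<lambda>i. cmp D (Fo x) (Fo (zs ! i)) (Fo x) (Fm (zs ! i) x (\<iota> i))
        (Fm x (zs ! i) (\<pi> i))) (length zs)
      = Fm x x (ksum C x x (\<lambda>i. cmp C x (zs ! i) x (\<iota> i) (\<pi> i)) (length zs))"
    using x zs homs by (simp add: Fm_ksum Fm_cmp dom.cmp_hom lists_nth cong: ksum_cong)
  moreover have "cmp D (Fo (zs ! j)) (Fo x) (Fo (zs ! i)) (Fm x (zs ! i) (\<pi> i)) (Fm (zs ! j) x (\<iota> j))
      = (if i = j then idm D (Fo (zs ! i)) else zer D (Fo (zs ! j)) (Fo (zs ! i)))"
    if "i < length zs" "j < length zs" for i j
    using orth[OF that] Fm_cmp[of "zs ! j" x "zs ! i" "\<iota> j" "\<pi> i"] x zs homs that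
    by (auto simp: lists_nth Fm_idm Fm_zer)
  ultimately show ?thesis
    using x zs homs map_Fo_lists[OF zs]
    by (simp add: is_biproduct_def Fo_obj total Fm_idm Fm_hom lists_nth cong: ksum_cong)
qed

context kcategory
begin

lemma ksum_add_hull_entry:
  "\<lbrakk>i < length ys; j < length xs\<rbrakk>
    \<Longrightarrow> ksum (add_hull C) xs ys f n (i, j) = ksum C (xs ! j) (ys ! i) (\<lambda>l. f l (i, j)) n"
  by (induction n) simp_all

text \<open>The injections and projections are the columns and rows of the identity matrix.\<close>

lemma add_hull_biproduct:
  assumes xs: "xs \<in> lists (obj C)"
  shows "\<exists>\<iota> \<pi>. is_biproduct (add_hull C) xs (map (\<lambda>x. [x]) xs) \<iota> \<pi>"
proof (intro exI)
  let ?n = "length xs"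
  let ?\<iota> = "\<lambda>i. \<lambda>(k, l)\<in>{..<?n} \<times> {..<Suc 0}. if k = i then idm C (xs ! i) else zer C (xs ! i) (xs ! k)"
  let ?\<pi> = "\<lambda>i. \<lambda>(k, l)\<in>{..<Suc 0} \<times> {..<?n}. if l = i then idm C (xs ! i) else zer C (xs ! l) (xs ! i)"
  have ob: "xs ! i \<in> obj C" "[xs ! i] \<in> lists (obj C)" if "i < ?n" for i
    using that xs by (simp_all add: lists_nth)
  have \<iota>: "?\<iota> i \<in> hom (add_hull C) [xs ! i] xs" if "i < ?n" for i
    using that ob by (auto simp: hom_add_hull idm_hom zer_hom)
  have \<pi>: "?\<pi> i \<in> hom (add_hull C) xs [xs ! i]" if "i < ?n" for i
    using that ob by (auto simp: hom_add_hull idm_hom zer_hom)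
  have orth: "cmp (add_hull C) [xs ! j] xs [xs ! i] (?\<pi> i) (?\<iota> j)
      = (if i = j then idm (add_hull C) [xs ! i] else zer (add_hull C) [xs ! j] [xs ! i])"
    if i: "i < ?n" and j: "j < ?n" for i j
  proof (rule add_hull_eqI[of _ C "[xs ! j]" "[xs ! i]"])
    show "cmp (add_hull C) [xs ! j] xs [xs ! i] (?\<pi> i) (?\<iota> j) \<in> hom (add_hull C) [xs ! j] [xs ! i]"
      using ob i j xs \<iota> \<pi> by (intro add_hull_homs) auto
    show "(if i = j then idm (add_hull C) [xs ! i] else zer (add_hull C) [xs ! j] [xs ! i])
        \<in> hom (add_hull C) [xs ! j] [xs ! i]"
      using ob i j by (auto intro: add_hull_homs idm_add_hull_hom)
    fix a b assume "a < length [xs ! i]" "b < length [xs ! j]"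
    then have ab: "a = 0" "b = 0" by auto
    let ?f = "\<lambda>l. cmp C (xs ! j) (xs ! l) (xs ! i) (?\<pi> i (0, l)) (?\<iota> j (l, 0))"
    have "cmp (add_hull C) [xs ! j] xs [xs ! i] (?\<pi> i) (?\<iota> j) (0, 0) = ksum C (xs ! j) (xs ! i) ?f ?n"
      using cmp_add_hull_entry[OF ob(2)[OF j] xs ob(2)[OF i] \<iota>[OF j] \<pi>[OF i], of 0 0] by simp
    \<comment> \<open>Column \<open>j\<close> of the identity matrix kills all terms except the one
      at \<open>j\<close>.\<close>
    also have "\<dots> = ?f j"
      by (rule ksum_single)
        (use ob i j in \<open>auto simp: cmp_zer_right cmp_zer_left cmp_hom idm_hom zer_hom\<close>)
    also have "\<dots> = (if i = j then idm C (xs ! i) else zer C (xs ! j) (xs ! i))"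
      using ob i j by (auto simp: cmp_idm_right idm_hom zer_hom)
    finally show "cmp (add_hull C) [xs ! j] xs [xs ! i] (?\<pi> i) (?\<iota> j) (a, b)
        = (if i = j then idm (add_hull C) [xs ! i] else zer (add_hull C) [xs ! j] [xs ! i]) (a, b)"
      using ab by simp
  qed
  have total: "ksum (add_hull C) xs xs (\<lambda>i. cmp (add_hull C) xs [xs ! i] xs (?\<iota> i) (?\<pi> i)) ?n
      = idm (add_hull C) xs"
  proof (rule add_hull_eqI[of _ C xs xs])
    interpret hull: kcategory "add_hull C" by (rule kcategory_add_hull)
    show "ksum (add_hull C) xs xs (\<lambda>i. cmp (add_hull C) xs [xs ! i] xs (?\<iota> i) (?\<pi> i)) ?n
        \<in> hom (add_hull C) xs xs"
      by (rule hull.ksum_hom) (use ob xs \<iota> \<pi> in \<open>auto intro!: add_hull_homs\<close>)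
    show "idm (add_hull C) xs \<in> hom (add_hull C) xs xs" using xs by (rule idm_add_hull_hom)
    fix a b assume a: "a < ?n" and b: "b < ?n"
    have "ksum (add_hull C) xs xs (\<lambda>i. cmp (add_hull C) xs [xs ! i] xs (?\<iota> i) (?\<pi> i)) ?n (a, b)
        = ksum C (xs ! b) (xs ! a)
            (\<lambda>i. cmp C (xs ! b) (xs ! i) (xs ! a) (?\<iota> i (a, 0)) (?\<pi> i (0, b))) ?n"
      unfolding ksum_add_hull_entry[OF a b]
    proof (rule ksum_cong)
      fix i assume i: "i < ?n"
      have "cmp C (xs ! b) (xs ! i) (xs ! a) (?\<iota> i (a, 0)) (?\<pi> i (0, b)) \<in> hom C (xs ! b) (xs ! a)"
        using ob a b i by (auto intro!: cmp_hom idm_hom zer_hom)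
      then show "cmp (add_hull C) xs [xs ! i] xs (?\<iota> i) (?\<pi> i) (a, b)
          = cmp C (xs ! b) (xs ! i) (xs ! a) (?\<iota> i (a, 0)) (?\<pi> i (0, b))"
        using cmp_add_hull_entry[OF xs ob(2)[OF i] xs \<pi>[OF i] \<iota>[OF i] a b] ob a b
        by (simp add: add_zer)
    qed simp_all
    \<comment> \<open>Entry \<open>a\<close> of the \<open>i\<close>-th column vanishes unless
      \<open>i = a\<close>.\<close>
    also have "\<dots> = cmp C (xs ! b) (xs ! a) (xs ! a) (?\<iota> a (a, 0)) (?\<pi> a (0, b))"
      by (rule ksum_single)
        (use ob a b in \<open>auto simp: cmp_zer_right cmp_zer_left cmp_hom idm_hom zer_hom\<close>)
    also have "\<dots> = idm (add_hull C) xs (a, b)"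
      using ob a b by (auto simp: cmp_idm_left idm_hom zer_hom)
    finally show "ksum (add_hull C) xs xs (\<lambda>i. cmp (add_hull C) xs [xs ! i] xs (?\<iota> i) (?\<pi> i)) ?n (a, b)
        = idm (add_hull C) xs (a, b)" .
  qed
  show "is_biproduct (add_hull C) xs (map (\<lambda>x. [x]) xs) ?\<iota> ?\<pi>"
    unfolding is_biproduct_def
    using xs ob \<iota> \<pi> orth total by (simp add: in_lists_conv_set cong: ksum_cong)
qed

end

text \<open>Injections and projections are tensored pairwise. By bilinearity the sum of all tensors
  of the idempotents \<open>?e i\<close> and \<open>?e' j\<close> is the tensor of the two sums,
  hence the identity. The conclusion records only which pairs may occur in \<open>ws\<close>; this
  is what essential surjectivity asks for.\<close>

lemma (in kcategory_pair) tensor_biproduct: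
  assumes b: "is_biproduct C x zs \<iota> \<pi>" and b': "is_biproduct D x' zs' \<iota>' \<pi>'"
  shows "\<exists>ws \<kappa> \<rho>. set ws \<subseteq> set zs \<times> set zs' \<and> is_biproduct (tensor C D) (x, x') ws \<kappa> \<rho>"
proof -
  note x = is_biproductD(1)[OF b] and zs = is_biproductD(2)[OF b] and homs = is_biproductD(3)[OF b]
    and orth = is_biproductD(4)[OF b] and total = is_biproductD(5)[OF b]
  note x' = is_biproductD(1)[OF b'] and zs' = is_biproductD(2)[OF b'] and homs' = is_biproductD(3)[OF b']
    and orth' = is_biproductD(4)[OF b'] and total' = is_biproductD(5)[OF b']
  interpret T: kcategory "tensor C D" by (rule kcategory_tensor)
  define n m where "n = length zs" and "m = length zs'"
  let ?w = "\<lambda>a. (zs ! (a div m), zs' ! (a mod m))"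
  let ?ws = "map ?w [0..<n * m]"
  let ?\<kappa> = "\<lambda>a. tens (?w a) (x, x') (\<iota> (a div m)) (\<iota>' (a mod m))"
  let ?\<rho> = "\<lambda>a. tens (x, x') (?w a) (\<pi> (a div m)) (\<pi>' (a mod m))"
  have div_mod: "a div m < length zs" "a mod m < length zs'" if "a < n * m" for a
    using that unfolding n_def[symmetric] m_def[symmetric]
    by (simp add: less_mult_imp_div_less) (cases m; use that in auto)
  have ob: "zs ! i \<in> obj C" if "i < length zs" for i using that zs by (simp add: lists_nth)
  have ob': "zs' ! i \<in> obj D" if "i < length zs'" for i using that zs' by (simp add: lists_nth)
  let ?e = "\<lambda>i. cmp C x (zs ! i) x (\<iota> i) (\<pi> i)"
  let ?e' = "\<lambda>i. cmp D x' (zs' ! i) x' (\<iota>' i) (\<pi>' i)"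
  have e: "?e i \<in> hom C x x" if "i < n" for i
    using that x ob homs by (auto simp: n_def intro: C.cmp_hom)
  have e': "?e' i \<in> hom D x' x'" if "i < m" for i
    using that x' ob' homs' by (auto simp: m_def intro: D.cmp_hom)
  have "ksum (tensor C D) (x, x') (x, x')
      (\<lambda>a. cmp (tensor C D) (x, x') (?w a) (x, x') (?\<kappa> a) (?\<rho> a)) (n * m)
    = ksum (tensor C D) (x, x') (x, x')
      (\<lambda>a. tens (x, x') (x, x') (?e (a div m)) (?e' (a mod m))) (n * m)"
    by (rule ksum_cong) (use div_mod x x' ob ob' homs homs' in \<open>auto simp: tens_cmp\<close>)
  also have "\<dots> = ksum (tensor C D) (x, x') (x, x') (\<lambda>i. ksum (tensor C D) (x, x') (x, x')
      (\<lambda>j. tens (x, x') (x, x') (?e i) (?e' j)) m) n"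
    by (rule T.ksum_prod) (use x x' e e' in \<open>auto simp: tens_hom\<close>)
  also have "\<dots> = tens (x, x') (x, x') (ksum C x x ?e n) (ksum D x' x' ?e' m)"
    using x x' e e' by (simp add: tens_ksum_right[symmetric] tens_ksum_left D.ksum_hom cong: ksum_cong)
  also have "\<dots> = idm (tensor C D) (x, x')"
    using total total' x x' by (simp add: n_def m_def tens_idm)
  finally have tot: "ksum (tensor C D) (x, x') (x, x')
      (\<lambda>a. cmp (tensor C D) (x, x') (?w a) (x, x') (?\<kappa> a) (?\<rho> a)) (n * m) = idm (tensor C D) (x, x')" .
  have ort: "cmp (tensor C D) (?w c) (x, x') (?w a) (?\<rho> a) (?\<kappa> c)
      = (if a = c then idm (tensor C D) (?w a) else zer (tensor C D) (?w c) (?w a))"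
    if a: "a < n * m" and c: "c < n * m" for a c
  proof -
    have "cmp (tensor C D) (?w c) (x, x') (?w a) (?\<rho> a) (?\<kappa> c) = tens (?w c) (?w a)
        (cmp C (zs ! (c div m)) x (zs ! (a div m)) (\<pi> (a div m)) (\<iota> (c div m)))
        (cmp D (zs' ! (c mod m)) x' (zs' ! (a mod m)) (\<pi>' (a mod m)) (\<iota>' (c mod m)))"
      using div_mod[OF a] div_mod[OF c] x x' ob ob' homs homs' by (simp add: tens_cmp)
    \<comment> \<open>An index is recovered from quotient and remainder, so for
      \<open>a \<noteq> c\<close> at least one tensor factor of the composite is a zero
      morphism.\<close>
    moreover have "a = c" if "a div m = c div m" "a mod m = c mod m"
      using arg_cong2[of _ _ _ _ "\<lambda>q r. q * m + r", OF that] by simp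
    ultimately show ?thesis
      using div_mod[OF a] div_mod[OF c] ob ob' orth orth'
      by (cases "a div m = c div m"; cases "a mod m = c mod m"; cases "a = c")
        (simp_all add: tens_idm tens_zer_left tens_zer_right C.idm_hom D.idm_hom C.zer_hom D.zer_hom)
  qed
  have "is_biproduct (tensor C D) (x, x') ?ws ?\<kappa> ?\<rho>"
    unfolding is_biproduct_def
  proof (intro conjI allI impI)
    show "?ws \<in> lists (obj (tensor C D))"
      using div_mod ob ob' by (auto simp: in_lists_conv_set)
    show "ksum (tensor C D) (x, x') (x, x') (\<lambda>a. cmp (tensor C D) (x, x') (?ws ! a) (x, x') (?\<kappa> a) (?\<rho> a))
        (length ?ws) = idm (tensor C D) (x, x')"
      unfolding tot[symmetric] by (rule ksum_cong) simp_all
  next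
    fix a assume "a < length ?ws"
    then have a: "a < n * m" and nth: "?ws ! a = ?w a" by simp_all
    show "?\<kappa> a \<in> hom (tensor C D) (?ws ! a) (x, x')" "?\<rho> a \<in> hom (tensor C D) (x, x') (?ws ! a)"
      unfolding nth using div_mod[OF a] x x' ob ob' homs homs' by (simp_all add: tens_hom)
    fix c assume "c < length ?ws"
    then have c: "c < n * m" and nth': "?ws ! c = ?w c" by simp_all
    show "cmp (tensor C D) (?ws ! c) (x, x') (?ws ! a) (?\<rho> a) (?\<kappa> c)
        = (if a = c then idm (tensor C D) (?ws ! a) else zer (tensor C D) (?ws ! c) (?ws ! a))"
      unfolding nth nth' by (rule ort[OF a c])
  qed (use x x' in simp_all)
  moreover have "set ?ws \<subseteq> set zs \<times> set zs'" using div_mod by auto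
  ultimately show ?thesis by blast
qed

text \<open>A decomposition of all entries of \<open>xs\<close> at once: the summand \<open>zs ! a\<close> belongs to \<open>xs ! k a\<close>.\<close>

definition is_decomposition ::
  "('o, 'm, 'k::field) kcat \<Rightarrow> 'o list \<Rightarrow> 'o list \<Rightarrow> (nat \<Rightarrow> nat) \<Rightarrow> (nat \<Rightarrow> 'm) \<Rightarrow> (nat \<Rightarrow> 'm) \<Rightarrow> bool" where
  "is_decomposition C xs zs k \<iota> \<pi> \<longleftrightarrow>
    (\<forall>a<length zs. k a < length xs \<and> \<iota> a \<in> hom C (zs ! a) (xs ! k a)
      \<and> \<pi> a \<in> hom C (xs ! k a) (zs ! a)) \<and>
    (\<forall>a<length zs. \<forall>b<length zs. k a = k b \<longrightarrow> cmp C (zs ! b) (xs ! k a) (zs ! a) (\<pi> a) (\<iota> b)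
        = (if a = b then idm C (zs ! a) else zer C (zs ! b) (zs ! a))) \<and>
    (\<forall>j<length xs. ksum C (xs ! j) (xs ! j)
      (\<lambda>a. if k a = j then cmp C (xs ! j) (zs ! a) (xs ! j) (\<iota> a) (\<pi> a) else zer C (xs ! j) (xs ! j))
      (length zs) = idm C (xs ! j))"

lemma is_decompositionD:
  assumes "is_decomposition C xs zs k \<iota> \<pi>"
  shows "a < length zs \<Longrightarrow> k a < length xs"
    and "a < length zs \<Longrightarrow> \<iota> a \<in> hom C (zs ! a) (xs ! k a)"
    and "a < length zs \<Longrightarrow> \<pi> a \<in> hom C (xs ! k a) (zs ! a)"
    and "\<lbrakk>a < length zs; b < length zs; k a = k b\<rbrakk>
      \<Longrightarrow> cmp C (zs ! b) (xs ! k a) (zs ! a) (\<pi> a) (\<iota> b)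
        = (if a = b then idm C (zs ! a) else zer C (zs ! b) (zs ! a))"
    and "j < length xs \<Longrightarrow> ksum C (xs ! j) (xs ! j)
      (\<lambda>a. if k a = j then cmp C (xs ! j) (zs ! a) (xs ! j) (\<iota> a) (\<pi> a) else zer C (xs ! j) (xs ! j))
      (length zs) = idm C (xs ! j)"
  using assms by (simp_all add: is_decomposition_def)

section \<open>Decomposing formal direct sums of biproducts\<close>

context kcategory
begin

text \<open>Putting \<open>\<iota> a\<close> and \<open>\<pi> a\<close> into position
  \<open>k a\<close> of column and row \<open>a\<close>, with zeros elsewhere, gives mutually
  inverse matrices: orthogonality yields one composite and the sum formula the other.\<close>

lemma iso_objs_add_hullI:
  assumes zs: "zs \<in> lists (obj C)" and xs: "xs \<in> lists (obj C)"
    and dec: "is_decomposition C xs zs k \<iota> \<pi>"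
  shows "iso_objs (add_hull C) zs xs"
proof -
  note k = is_decompositionD(1)[OF dec] and \<iota> = is_decompositionD(2)[OF dec]
    and \<pi> = is_decompositionD(3)[OF dec] and orth = is_decompositionD(4)[OF dec]
    and total = is_decompositionD(5)[OF dec]
  define F where "F = (\<lambda>(j, a)\<in>{..<length xs} \<times> {..<length zs}.
    if k a = j then \<iota> a else zer C (zs ! a) (xs ! j))"
  define G where "G = (\<lambda>(a, j)\<in>{..<length zs} \<times> {..<length xs}.
    if k a = j then \<pi> a else zer C (xs ! j) (zs ! a))"
  have oz: "zs ! a \<in> obj C" if "a < length zs" for a using that zs by (simp add: lists_nth)
  have ox: "xs ! a \<in> obj C" if "a < length xs" for a using that xs by (simp add: lists_nth)
  have F: "F \<in> hom (add_hull C) zs xs"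
    using \<iota> oz ox by (auto simp: F_def hom_add_hull zer_hom)
  have G: "G \<in> hom (add_hull C) xs zs"
    using \<pi> oz ox by (auto simp: G_def hom_add_hull zer_hom)
  have "cmp (add_hull C) zs xs zs G F = idm (add_hull C) zs"
  proof (rule add_hull_eqI[of _ C zs zs])
    fix a b assume a: "a < length zs" and b: "b < length zs"
    let ?f = "\<lambda>j. cmp C (zs ! b) (xs ! j) (zs ! a) (G (a, j)) (F (j, b))"
    have "cmp (add_hull C) zs xs zs G F (a, b) = ksum C (zs ! b) (zs ! a) ?f (length xs)"
      by (rule cmp_add_hull_entry[OF zs xs zs F G a b])
    \<comment> \<open>Row \<open>a\<close> of \<open>G\<close> is zero outside column
      \<open>k a\<close>.\<close>
    also have "\<dots> = ?f (k a)"
    proof (rule ksum_single)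
      show "?f (k a) \<in> hom C (zs ! b) (zs ! a)"
        using F G a b oz ox k by (auto intro!: cmp_hom simp: add_hull_entry_hom)
      show "?f j = zer C (zs ! b) (zs ! a)" if "j < length xs" "j \<noteq> k a" for j
        using that a b oz ox F by (auto simp: G_def cmp_zer_left add_hull_entry_hom)
    qed (use a b oz k in auto)
    also have "\<dots> = idm (add_hull C) zs (a, b)"
    proof (cases "k a = k b")
      case True
      then show ?thesis using a b k[OF a] orth[OF a b True] by (simp add: F_def G_def)
    next
      case False
      then have "?f (k a) = zer C (zs ! b) (zs ! a)"
        using a b k[OF a] oz ox \<pi>[OF a] by (simp add: F_def G_def cmp_zer_right)
      moreover have "a \<noteq> b" using False by blast
      ultimately show ?thesis using a b by simp
    qed
    finally show "cmp (add_hull C) zs xs zs G F (a, b) = idm (add_hull C) zs (a, b)" .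
  qed (use zs xs F G in \<open>auto intro: add_hull_homs idm_add_hull_hom\<close>)
  moreover have "cmp (add_hull C) xs zs xs F G = idm (add_hull C) xs"
  proof (rule add_hull_eqI[of _ C xs xs])
    fix i j assume i: "i < length xs" and j: "j < length xs"
    have "cmp (add_hull C) xs zs xs F G (i, j) = ksum C (xs ! j) (xs ! i)
        (\<lambda>a. cmp C (xs ! j) (zs ! a) (xs ! i) (F (i, a)) (G (a, j))) (length zs)"
      by (rule cmp_add_hull_entry[OF xs zs xs G F i j])
    also have "\<dots> = idm (add_hull C) xs (i, j)"
    proof (cases "i = j")
      case True
      have "ksum C (xs ! j) (xs ! j)
          (\<lambda>a. cmp C (xs ! j) (zs ! a) (xs ! j) (F (j, a)) (G (a, j))) (length zs)
        = ksum C (xs ! j) (xs ! j) (\<lambda>a. if k a = j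
            then cmp C (xs ! j) (zs ! a) (xs ! j) (\<iota> a) (\<pi> a) else zer C (xs ! j) (xs ! j)) (length zs)"
        by (rule ksum_cong) (use j oz ox in \<open>auto simp: F_def G_def cmp_zer_left zer_hom\<close>)
      then show ?thesis using True total j by simp
    next
      case False
      \<comment> \<open>The summand \<open>a\<close> belongs to the single entry \<open>k a\<close>,
        so for \<open>i \<noteq> j\<close> at least one of the two factors is zero.\<close>
      then have "cmp C (xs ! j) (zs ! a) (xs ! i) (F (i, a)) (G (a, j)) = zer C (xs ! j) (xs ! i)"
        if "a < length zs" for a
        using that i j oz ox \<iota> \<pi> by (auto simp: F_def G_def cmp_zer_left cmp_zer_right zer_hom)
      then show ?thesis using False i j ox by (simp add: ksum_zer)
    qed
    finally show "cmp (add_hull C) xs zs xs F G (i, j) = idm (add_hull C) xs (i, j)" .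
  qed (use zs xs F G in \<open>auto intro: add_hull_homs idm_add_hull_hom\<close>)
  ultimately show ?thesis
    unfolding iso_objs_def using F G by blast
qed

text \<open>Objects are appended at the end of \<open>xs\<close>, so the positions already assigned
  by \<open>k\<close> stay valid; the summands of the new object all receive the new last
  position.\<close>

lemma add_hull_decomposition:
  assumes biprod: "\<And>x. x \<in> obj C \<Longrightarrow> \<exists>zs \<iota> \<pi>. set zs \<subseteq> S \<and> is_biproduct C x zs \<iota> \<pi>"
    and xs: "xs \<in> lists (obj C)"
  shows "\<exists>zs k \<iota> \<pi>. zs \<in> lists (obj C \<inter> S) \<and> is_decomposition C xs zs k \<iota> \<pi>"
  using xs
proof (induction xs rule: rev_induct)
  case Nil
  show ?case by (rule exI[of _ "[]"]) (simp add: is_decomposition_def)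
next
  case (snoc x xs)
  have x: "x \<in> obj C" and xs: "xs \<in> lists (obj C)" using snoc.prems by auto
  obtain zs k \<iota> \<pi> where zs: "zs \<in> lists (obj C \<inter> S)" and dec: "is_decomposition C xs zs k \<iota> \<pi>"
    using snoc.IH[OF xs] by blast
  have homs: "k a < length xs \<and> \<iota> a \<in> hom C (zs ! a) (xs ! k a) \<and> \<pi> a \<in> hom C (xs ! k a) (zs ! a)"
    if "a < length zs" for a
    using that is_decompositionD(1-3)[OF dec] by blast
  note orth = is_decompositionD(4)[OF dec] and total = is_decompositionD(5)[OF dec]
  obtain ws \<kappa> \<rho> where S: "set ws \<subseteq> S" and b: "is_biproduct C x ws \<kappa> \<rho>" using biprod[OF x] by blast
  note ws = is_biproductD(2)[OF b] and homs' = is_biproductD(3)[OF b]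
    and orth' = is_biproductD(4)[OF b] and total' = is_biproductD(5)[OF b]
  let ?n = "length zs" and ?xs = "xs @ [x]" and ?zs = "zs @ ws"
  let ?k = "\<lambda>a. if a < ?n then k a else length xs"
  let ?\<iota> = "\<lambda>a. if a < ?n then \<iota> a else \<kappa> (a - ?n)"
  let ?\<pi> = "\<lambda>a. if a < ?n then \<pi> a else \<rho> (a - ?n)"
  have oz: "zs ! a \<in> obj C" if "a < length zs" for a using lists_nth[OF zs that] by simp
  have ow: "ws ! a \<in> obj C" if "a < length ws" for a using that ws by (simp add: lists_nth)
  have ox: "xs ! a \<in> obj C" if "a < length xs" for a using that xs by (simp add: lists_nth)
  have k_less: "k a < length xs" if "a < ?n" for a using that homs by blast
  have k_neq: "k a \<noteq> length xs" if "a < ?n" for a using k_less[OF that] by simp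
  have D: "\<forall>j<length ?xs. ksum C (?xs ! j) (?xs ! j) (\<lambda>a. if ?k a = j
      then cmp C (?xs ! j) (?zs ! a) (?xs ! j) (?\<iota> a) (?\<pi> a) else zer C (?xs ! j) (?xs ! j))
      (length ?zs) = idm C (?xs ! j)"
  proof (intro allI impI)
    fix j assume j: "j < length ?xs"
    let ?t = "\<lambda>a. if ?k a = j
      then cmp C (?xs ! j) (?zs ! a) (?xs ! j) (?\<iota> a) (?\<pi> a) else zer C (?xs ! j) (?xs ! j)"
    have oj: "?xs ! j \<in> obj C" using j x ox by (auto simp: nth_append)
    have t_hom: "?t a \<in> hom C (?xs ! j) (?xs ! j)" if "a < ?n + length ws" for a
    proof (cases "a < ?n")
      case True
      then show ?thesis using oj oz homs by (auto simp: nth_append intro!: cmp_hom zer_hom)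
    next
      case False
      then have "a - ?n < length ws" using that by auto
      then show ?thesis using oj ow homs' False by (auto simp: nth_append intro!: cmp_hom zer_hom)
    qed
    have split: "ksum C (?xs ! j) (?xs ! j) ?t (?n + length ws)
      = add C (?xs ! j) (?xs ! j) (ksum C (?xs ! j) (?xs ! j) ?t ?n)
          (ksum C (?xs ! j) (?xs ! j) (\<lambda>i. ?t (?n + i)) (length ws))"
      by (rule ksum_split[OF oj oj t_hom])
    \<comment> \<open>For the last position only the new summands contribute, for an earlier one
      only the old summands.\<close>
    show "ksum C (?xs ! j) (?xs ! j) ?t (length ?zs) = idm C (?xs ! j)"
    proof (cases "j = length xs")
      case True
      have "ksum C (?xs ! j) (?xs ! j) ?t ?n = zer C x x"
        using True x k_neq by (auto intro!: ksum_zer)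
      moreover have "ksum C (?xs ! j) (?xs ! j) (\<lambda>i. ?t (?n + i)) (length ws) = idm C x"
        using True total' by (simp cong: ksum_cong)
      ultimately show ?thesis using True split x by (simp add: add_zer idm_hom)
    next
      case False
      then have jx: "j < length xs" "?xs ! j = xs ! j" using j by (auto simp: nth_append)
      have "ksum C (?xs ! j) (?xs ! j) ?t ?n = idm C (xs ! j)"
        unfolding total[OF jx(1), symmetric]
        by (rule ksum_cong) (use jx in \<open>auto simp: nth_append\<close>)
      moreover have "ksum C (?xs ! j) (?xs ! j) (\<lambda>i. ?t (?n + i)) (length ws) = zer C (xs ! j) (xs ! j)"
        using jx ox False by (auto intro!: ksum_zer)
      ultimately show ?thesis using split jx ox by (simp add: add_zer_right idm_hom)
    qed
  qed
  have "cmp C (?zs ! b) (?xs ! ?k a) (?zs ! a) (?\<pi> a) (?\<iota> b)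
      = (if a = b then idm C (?zs ! a) else zer C (?zs ! b) (?zs ! a))"
    if a: "a < length ?zs" and b: "b < length ?zs" and eq: "?k a = ?k b" for a b
  \<comment> \<open>Old summands have positions below \<open>length xs\<close> and new ones exactly
    this position, so equal positions never mix the two kinds.\<close>
  proof (cases "a < ?n")
    case True
    then have "b < ?n" using eq k_less[of a] by (auto split: if_splits)
    then show ?thesis using True eq orth[of a b] k_less[of a] by (simp add: nth_append)
  next
    case False
    then have "\<not> b < ?n" using eq k_less[of b] by (auto split: if_splits)
    then show ?thesis using False a b orth'[of "a - ?n" "b - ?n"] by (auto simp: nth_append)
  qed
  then have C: "\<forall>a<length ?zs. \<forall>b<length ?zs. ?k a = ?k b \<longrightarrow>
      cmp C (?zs ! b) (?xs ! ?k a) (?zs ! a) (?\<pi> a) (?\<iota> b)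
      = (if a = b then idm C (?zs ! a) else zer C (?zs ! b) (?zs ! a))"
    by (intro allI impI)
  have "?k a < length ?xs \<and> ?\<iota> a \<in> hom C (?zs ! a) (?xs ! ?k a)
      \<and> ?\<pi> a \<in> hom C (?xs ! ?k a) (?zs ! a)" if "a < length ?zs" for a
  proof (cases "a < ?n")
    case True
    then show ?thesis using homs[OF True] by (simp add: nth_append)
  next
    case False
    then show ?thesis using homs'[of "a - ?n"] that by (simp add: nth_append)
  qed
  then have B: "\<forall>a<length ?zs. ?k a < length ?xs \<and> ?\<iota> a \<in> hom C (?zs ! a) (?xs ! ?k a)
      \<and> ?\<pi> a \<in> hom C (?xs ! ?k a) (?zs ! a)"
    by (intro allI impI)
  have A: "?zs \<in> lists (obj C \<inter> S)" using zs ws S by (auto simp: in_lists_conv_set)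
  show ?case
    by (rule exI[of _ ?zs], rule exI[of _ ?k], rule exI[of _ ?\<iota>], rule exI[of _ ?\<pi>])
      (unfold is_decomposition_def, intro conjI A B C D)
qed

text \<open>This supplies essential surjectivity in the third claim, with \<open>S\<close> the pairs
  of vertices regarded as one-summand objects.\<close>

lemma add_hull_iso_lists:
  assumes "\<And>x. x \<in> obj C \<Longrightarrow> \<exists>zs \<iota> \<pi>. set zs \<subseteq> S \<and> is_biproduct C x zs \<iota> \<pi>"
    and xs: "xs \<in> lists (obj C)"
  shows "\<exists>zs\<in>lists (obj C \<inter> S). iso_objs (add_hull C) zs xs"
proof -
  obtain zs k \<iota> \<pi> where zs: "zs \<in> lists (obj C \<inter> S)" and dec: "is_decomposition C xs zs k \<iota> \<pi>"
    using add_hull_decomposition[OF assms] by blast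
  have "iso_objs (add_hull C) zs xs"
    by (rule iso_objs_add_hullI[OF _ xs dec]) (use zs in \<open>simp add: lists_Int_eq\<close>)
  then show ?thesis using zs by blast
qed

end

section \<open>Path algebras\<close>

lemma path_mult_single [simp]:
  "path_mult Q (Poly_Mapping.single (y, q) c) (Poly_Mapping.single (x, p) d)
    = (if pre_digraph.cas Q x p y then Poly_Mapping.single (x, p @ q) (c * d) else 0)"
  by (simp add: path_mult_def path_prod_def)

lemmas fin_linear_path_mult_left = fin_linear_bilin_ext_left[of "path_prod Q" for Q, folded path_mult_def]
  and fin_linear_path_mult_right = fin_linear_bilin_ext_right[of "path_prod Q" for Q, folded path_mult_def]

lemmas path_mult_diff_left = module_hom.diff[OF fin_linear_path_mult_left]
  and path_mult_diff_right = module_hom.diff[OF fin_linear_path_mult_right]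
  and path_mult_zero_left [simp] = module_hom.zero[OF fin_linear_path_mult_left]
  and path_mult_zero_right [simp] = module_hom.zero[OF fin_linear_path_mult_right]

lemma in_paths_between [simp]:
  "(u, p) \<in> paths_between Q x y \<longleftrightarrow> u = x \<and> pre_digraph.awalk Q x p y"
  by (auto simp: paths_between_def)

lemma vertex_kcat_simps [simp]:
  "obj (vertex_kcat Q) = verts Q"
  "hom (vertex_kcat Q) x y = {f. Poly_Mapping.keys f \<subseteq> paths_between Q x y}"
  "idm (vertex_kcat Q) x = basis (x, [])"
  "zer (vertex_kcat Q) x y = 0"
  "add (vertex_kcat Q) x y = (+)"
  "scl (vertex_kcat Q) x y = pscale"
  "cmp (vertex_kcat Q) x y z = path_mult Q"
  by (simp_all add: vertex_kcat_def)

lemma subspace_path_algebra: "pscale.subspace (path_algebra Q)"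
  unfolding path_algebra_def by (rule subspace_keys_subset)

lemma path_algebra_ideal_subspace: "path_algebra_ideal Q I \<Longrightarrow> pscale.subspace I"
  by (simp add: path_algebra_ideal_def)

lemma path_algebra_ideal_mult:
  assumes "path_algebra_ideal Q I" and "f \<in> I" and "g \<in> path_algebra Q"
  shows "path_mult Q g f \<in> I" and "path_mult Q f g \<in> I"
  using assms by (auto simp: path_algebra_ideal_def)

context wf_digraph
begin

lemma cas_end_unique: "cas x p y \<Longrightarrow> cas x p z \<Longrightarrow> y = z"
  using awlast_if_cas by blast

lemma in_paths_iff: "(x, p) \<in> paths G \<longleftrightarrow> (\<exists>y. awalk x p y)"
  by (auto simp: paths_def)

lemma single_in_path_algebra: "awalk x p y \<Longrightarrow> Poly_Mapping.single (x, p) c \<in> path_algebra G"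
  by (auto simp: path_algebra_def in_paths_iff)

lemma paths_between_subset: "paths_between G x y \<subseteq> paths G"
  by (auto simp: paths_between_def in_paths_iff)

lemma kcategory_vertex_kcat: "kcategory (vertex_kcat G)"
  by (rule kcategory_linearization[where \<mu> = "\<lambda>_ _ _. path_prod G" and B = "paths_between G"
        and e = "\<lambda>x. (x, [])" and m = "\<lambda>_ _ _ (y, q) (x, p). (x, p @ q)"])
    (auto simp: path_mult_def path_prod_def awalk_Nil_iff split: prod.splits
      intro!: awalk_appendI)

lemma hom_subset_path_algebra: "hom (vertex_kcat G) x y \<subseteq> path_algebra G"
  using paths_between_subset by (fastforce simp: path_algebra_def)

lemma path_mult_in_path_algebra:
  assumes f: "f \<in> path_algebra G" and g: "g \<in> path_algebra G"
  shows "path_mult G g f \<in> path_algebra G"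
  unfolding path_mult_def
proof (rule bilin_ext_in_subspace[OF subspace_path_algebra])
  fix b a assume "b \<in> Poly_Mapping.keys g" and "a \<in> Poly_Mapping.keys f"
  then have "b \<in> paths G" "a \<in> paths G" using f g by (auto simp: path_algebra_def)
  then obtain y q z x p y' where ab: "b = (y, q)" "awalk y q z" "a = (x, p)" "awalk x p y'"
    by (metis in_paths_iff prod.exhaust)
  have "awalk x (p @ q) z" if "cas x p y"
    using that ab cas_end_unique[of x p y y'] by (auto intro: awalk_appendI)
  then show "path_prod G b a \<in> path_algebra G"
    using ab by (auto simp: path_prod_def path_algebra_def in_paths_iff)
qed

lemma path_algebra_ideal_path_algebra: "path_algebra_ideal G (path_algebra G)"
  by (simp add: path_algebra_ideal_def subspace_path_algebra path_mult_in_path_algebra)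

text \<open>Ideals are closed under intersection. Since \<open>path_algebra_ideal\<close> includes
  containment in the path algebra, the intersected family must be nonempty; it contains the path
  algebra itself.\<close>

lemma path_algebra_ideal_hull:
  assumes "R \<subseteq> path_algebra G"
  shows "path_algebra_ideal G (path_algebra_ideal G hull R)"
proof -
  let ?T = "{T. path_algebra_ideal G T \<and> R \<subseteq> T}"
  have "path_algebra G \<in> ?T" using assms path_algebra_ideal_path_algebra by simp
  then have "\<Inter>?T \<subseteq> path_algebra G" by blast
  moreover have "pscale.subspace (\<Inter>?T)"
    by (rule pscale.subspace_Inter) (simp add: path_algebra_ideal_def)
  ultimately show ?thesis
    unfolding hull_def path_algebra_ideal_def[of G "\<Inter>?T"]
    using path_algebra_ideal_mult by blast
qed

lemma admissible_ideal:
  assumes "admissible G I"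
  shows "path_algebra_ideal G I"
proof -
  obtain R where R: "\<forall>r\<in>R. relation G r" and I: "I = path_algebra_ideal G hull R"
    using assms by (auto simp: admissible_def)
  have "R \<subseteq> path_algebra G"
  proof
    fix r assume "r \<in> R"
    then obtain x y where "Poly_Mapping.keys r \<subseteq> {(u, p) \<in> paths_between G x y. 2 \<le> length p}"
      using R by (auto simp: relation_def)
    then show "r \<in> path_algebra G"
      by (fastforce simp: path_algebra_def in_paths_iff)
  qed
  then show ?thesis unfolding I by (rule path_algebra_ideal_hull)
qed

text \<open>The Peirce component e_y f e_x. Selecting paths instead of multiplying yields a morphism
  from \<open>x\<close> to \<open>y\<close> for every formal combination \<open>f\<close>.\<close>

definition path_component :: "'a \<Rightarrow> 'a \<Rightarrow> (('a, 'b) path \<Rightarrow>\<^sub>0 'k::field) \<Rightarrow> ('a, 'b) path \<Rightarrow>\<^sub>0 'k" where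
  "path_component x y = lin_ext (\<lambda>p. if p \<in> paths_between G x y then basis p else 0)"

lemma path_component_hom: "path_component x y f \<in> hom (vertex_kcat G) x y"
  unfolding path_component_def vertex_kcat_simps
  by (rule lin_ext_in_subspace[OF subspace_keys_subset]) simp

text \<open>For elements of the path algebra the component is the product of \<open>f\<close> with
  the trivial paths at \<open>y\<close> and \<open>x\<close>, and the ideal is two-sided.\<close>

lemma path_component_ideal:
  fixes I :: "(('a, 'b) path \<Rightarrow>\<^sub>0 'k::field) set"
  assumes I: "path_algebra_ideal G I" and f: "f \<in> I" and x: "x \<in> verts G" and y: "y \<in> verts G"
  shows "path_component x y f \<in> I"
proof -
  let ?e = "\<lambda>x. basis (x, []) :: ('a, 'b) path \<Rightarrow>\<^sub>0 'k"
  have e: "?e x \<in> path_algebra G" "?e y \<in> path_algebra G"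
    using x y by (auto simp: path_algebra_def in_paths_iff awalk_Nil_iff)
  have "path_component x y f = path_mult G (?e y) (path_mult G f (?e x))"
    unfolding path_component_def
  proof (rule fin_linear_eqI[OF fin_linear_lin_ext fin_linear_comp[OF fin_linear_path_mult_right
          fin_linear_path_mult_left]])
    fix a assume "a \<in> Poly_Mapping.keys f"
    then have "a \<in> paths G" using f I by (auto simp: path_algebra_ideal_def path_algebra_def)
    then obtain u p v where "a = (u, p)" "awalk u p v"
      by (metis in_paths_iff prod.exhaust)
    then show "lin_ext (\<lambda>p. if p \<in> paths_between G x y then basis p else 0)
        (basis a) = path_mult G (?e y) (path_mult G (basis a) (?e x))"
      by (auto simp: awalk_def)
  qed
  then show ?thesis using path_algebra_ideal_mult[OF I] f e by simp
qed

end


section \<open>The product quiver\<close>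

text \<open>\<open>Inr\<close> carries the arrows coming from \<open>Q\<close> and
  \<open>Inl\<close> those coming from \<open>Q'\<close>, following the order of the summands in
  \<open>prod_quiver\<close>.\<close>

definition left_arcs :: "('v \<times> 'b + 'a \<times> 'w) list \<Rightarrow> 'a list" where
  "left_arcs w = concat (map (case_sum (\<lambda>_. []) (\<lambda>(\<alpha>, q). [\<alpha>])) w)"

definition right_arcs :: "('v \<times> 'b + 'a \<times> 'w) list \<Rightarrow> 'b list" where
  "right_arcs w = concat (map (case_sum (\<lambda>(p, \<beta>). [\<beta>]) (\<lambda>_. [])) w)"

abbreviation lift_left :: "'w \<Rightarrow> 'a list \<Rightarrow> ('v \<times> 'b + 'a \<times> 'w) list" where
  "lift_left q as \<equiv> map (\<lambda>\<alpha>. Inr (\<alpha>, q)) as"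

abbreviation lift_right :: "'v \<Rightarrow> 'b list \<Rightarrow> ('v \<times> 'b + 'a \<times> 'w) list" where
  "lift_right p bs \<equiv> map (\<lambda>\<beta>. Inl (p, \<beta>)) bs"

lemma left_arcs_simps [simp]:
  "left_arcs [] = []"
  "left_arcs (Inl (p, \<beta>) # w) = left_arcs w"
  "left_arcs (Inr (\<alpha>, q) # w) = \<alpha> # left_arcs w"
  "left_arcs (v @ w) = left_arcs v @ left_arcs w"
  by (simp_all add: left_arcs_def)

lemma right_arcs_simps [simp]:
  "right_arcs [] = []"
  "right_arcs (Inl (p, \<beta>) # w) = \<beta> # right_arcs w"
  "right_arcs (Inr (\<alpha>, q) # w) = right_arcs w"
  "right_arcs (v @ w) = right_arcs v @ right_arcs w"
  by (simp_all add: right_arcs_def)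

lemma left_arcs_lift [simp]: "left_arcs (lift_left q as) = as" "left_arcs (lift_right p bs) = []"
  by (induction as) (simp_all, induction bs, simp_all)

lemma right_arcs_lift [simp]: "right_arcs (lift_left q as) = []" "right_arcs (lift_right p bs) = bs"
  by (induction as) (simp_all, induction bs, simp_all)

lemma prod_quiver_simps [simp]:
  "verts (prod_quiver Q Q') = verts Q \<times> verts Q'"
  "Inl (p, \<beta>) \<in> arcs (prod_quiver Q Q') \<longleftrightarrow> p \<in> verts Q \<and> \<beta> \<in> arcs Q'"
  "Inr (\<alpha>, q) \<in> arcs (prod_quiver Q Q') \<longleftrightarrow> \<alpha> \<in> arcs Q \<and> q \<in> verts Q'"
  "tail (prod_quiver Q Q') (Inl (p, \<beta>)) = (p, tail Q' \<beta>)"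
  "tail (prod_quiver Q Q') (Inr (\<alpha>, q)) = (tail Q \<alpha>, q)"
  "head (prod_quiver Q Q') (Inl (p, \<beta>)) = (p, head Q' \<beta>)"
  "head (prod_quiver Q Q') (Inr (\<alpha>, q)) = (head Q \<alpha>, q)"
  by (auto simp: prod_quiver_def)

lemma place_right_single [simp]:
  "place_right p (Poly_Mapping.single (y, bs) c) = Poly_Mapping.single ((p, y), lift_right p bs) c"
  by (simp add: place_right_def)

lemma place_left_single [simp]:
  "place_left q (Poly_Mapping.single (x, as) c) = Poly_Mapping.single ((x, q), lift_left q as) c"
  by (simp add: place_left_def)

lemma fin_linear_place_right: "fin_linear (place_right p)"
  unfolding place_right_def by (rule fin_linear_lin_ext)

lemma fin_linear_place_left: "fin_linear (place_left q)"
  unfolding place_left_def by (rule fin_linear_lin_ext)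

locale quiver_pair = Q: wf_digraph Q + Q': wf_digraph Q'
  for Q :: "('v, 'a) pre_digraph" and Q' :: "('w, 'b) pre_digraph"
begin

abbreviation QQ where "QQ \<equiv> prod_quiver Q Q'"

sublocale QQ: wf_digraph QQ
proof
  fix e assume "e \<in> arcs QQ"
  then show "tail QQ e \<in> verts QQ" "head QQ e \<in> verts QQ"
    by (cases e; auto)+
qed

lemma awalk_Cons: "QQ.awalk a (e # w) b \<longleftrightarrow> e \<in> arcs QQ \<and> tail QQ e = a \<and> QQ.awalk (head QQ e) w b"
  by (auto simp: QQ.awalk_Cons_iff)

text \<open>An arrow coming from one factor leaves the other coordinate fixed, so dropping the
  arrows of the other factor keeps the walk connected.\<close>

lemma awalk_left_arcs:
  "QQ.awalk (x, x') w (y, y') \<Longrightarrow> Q.awalk x (left_arcs w) y \<and> Q'.awalk x' (right_arcs w) y'"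
proof (induction w arbitrary: x x')
  case Nil
  then show ?case by (auto simp: QQ.awalk_Nil_iff Q.awalk_Nil_iff Q'.awalk_Nil_iff)
next
  case (Cons e w)
  show ?case
  proof (cases e)
    case (Inl c)
    then obtain p \<beta> where "e = Inl (p, \<beta>)" by (cases c) auto
    then show ?thesis
      using Cons by (auto simp: awalk_Cons Q'.awalk_Cons_iff)
  next
    case (Inr c)
    then obtain \<alpha> q where "e = Inr (\<alpha>, q)" by (cases c) auto
    then show ?thesis
      using Cons by (auto simp: awalk_Cons Q.awalk_Cons_iff)
  qed
qed

lemma awalk_lift_left_iff:
  assumes "q \<in> verts Q'"
  shows "QQ.awalk (x, q) (lift_left q as) b \<longleftrightarrow> snd b = q \<and> Q.awalk x as (fst b)"
  using assms
  by (induction as arbitrary: x)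
    (auto simp: QQ.awalk_Nil_iff Q.awalk_Nil_iff awalk_Cons Q.awalk_Cons_iff)

lemma awalk_lift_right_iff:
  assumes "p \<in> verts Q"
  shows "QQ.awalk (p, x') (lift_right p bs) b \<longleftrightarrow> fst b = p \<and> Q'.awalk x' bs (snd b)"
  using assms
  by (induction bs arbitrary: x')
    (auto simp: QQ.awalk_Nil_iff Q'.awalk_Nil_iff awalk_Cons Q'.awalk_Cons_iff)

lemma place_left_hom:
  assumes "q \<in> verts Q'" and "f \<in> hom (vertex_kcat Q) x y"
  shows "place_left q f \<in> hom (vertex_kcat QQ) (x, q) (y, q)"
  unfolding place_left_def vertex_kcat_simps
  by (rule lin_ext_in_subspace[OF subspace_keys_subset])
    (use assms in \<open>auto simp: awalk_lift_left_iff\<close>)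

lemma place_right_hom:
  assumes "p \<in> verts Q" and "g \<in> hom (vertex_kcat Q') x' y'"
  shows "place_right p g \<in> hom (vertex_kcat QQ) (p, x') (p, y')"
  unfolding place_right_def vertex_kcat_simps
  by (rule lin_ext_in_subspace[OF subspace_keys_subset])
    (use assms in \<open>auto simp: awalk_lift_right_iff\<close>)

lemma place_left_path_algebra:
  assumes "q \<in> verts Q'" and "f \<in> path_algebra Q"
  shows "place_left q f \<in> path_algebra QQ"
  unfolding place_left_def
  by (rule lin_ext_in_subspace[OF subspace_path_algebra])
    (use assms in \<open>auto simp: path_algebra_def Q.in_paths_iff QQ.in_paths_iff awalk_lift_left_iff\<close>)

lemma place_right_path_algebra:
  assumes "p \<in> verts Q" and "g \<in> path_algebra Q'"
  shows "place_right p g \<in> path_algebra QQ"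
  unfolding place_right_def
  by (rule lin_ext_in_subspace[OF subspace_path_algebra])
    (use assms in \<open>auto simp: path_algebra_def Q'.in_paths_iff QQ.in_paths_iff awalk_lift_right_iff\<close>)

lemma comm_relation_hom:
  assumes "\<alpha> \<in> arcs Q" and "\<beta> \<in> arcs Q'"
  shows "comm_relation Q Q' \<alpha> \<beta>
    \<in> hom (vertex_kcat QQ) (tail Q \<alpha>, tail Q' \<beta>) (head Q \<alpha>, head Q' \<beta>)"
  unfolding comm_relation_def vertex_kcat_simps
  by (rule pscale.subspace_diff[OF subspace_keys_subset])
    (use assms in \<open>auto simp: awalk_Cons QQ.awalk_Nil_iff\<close>)

end

section \<open>Path categories of product quivers\<close>

lemma kfunctor_comp:
  assumes F: "kfunctor C D Fo Fm" and G: "kfunctor D E Go Gm"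
  shows "kfunctor C E (\<lambda>x. Go (Fo x)) (\<lambda>x y f. Gm (Fo x) (Fo y) (Fm x y f))"
proof -
  interpret F: kfunctor C D Fo Fm by (rule F)
  interpret G: kfunctor D E Go Gm by (rule G)
  show ?thesis
    by unfold_locales
      (simp_all add: F.Fo_obj G.Fo_obj F.Fm_hom G.Fm_hom F.Fm_idm G.Fm_idm F.Fm_cmp G.Fm_cmp
        F.Fm_add G.Fm_add F.Fm_scl G.Fm_scl)
qed

text \<open>\<open>V\<close> and \<open>V'\<close> stand for any presentations of the two quotients
  on vertices. The concrete ones consist of cosets of matrices with one entry; working with the
  presenting functors keeps this encoding out of the tensor argument.\<close>

locale presented_pair = quiver_pair Q Q' +
  V: quotient_presentation "vertex_kcat Q" V \<eta>o \<eta> "\<lambda>x y. {f \<in> hom (vertex_kcat Q) x y. f \<in> I}" +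
  V': quotient_presentation "vertex_kcat Q'" V' \<eta>o' \<eta>' "\<lambda>x y. {f \<in> hom (vertex_kcat Q') x y. f \<in> I'}"
  for Q :: "('v, 'a) pre_digraph" and Q' :: "('w, 'b) pre_digraph"
    and V :: "('o, 'm, 'k::field) kcat" and V' :: "('p, 'n, 'k) kcat"
    and \<eta>o \<eta> I \<eta>o' \<eta>' I' +
  assumes ideal: "path_algebra_ideal Q I" and ideal': "path_algebra_ideal Q' I'"
begin

sublocale kcategory_pair V V'
  by (intro kcategory_pair.intro V.cod.kcategory_axioms V'.cod.kcategory_axioms)

sublocale QK: kcategory "vertex_kcat QQ :: ('v \<times> 'w, ('v \<times> 'w, 'v \<times> 'b + 'a \<times> 'w) path \<Rightarrow>\<^sub>0 'k, 'k) kcat"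
  by (rule QQ.kcategory_vertex_kcat)

abbreviation box where "box \<equiv> box_ideal Q I Q' I'"

lemma gens_path_algebra:
  "(\<Union>p\<in>verts Q. place_right p ` I') \<union> (\<Union>q\<in>verts Q'. place_left q ` I) \<union>
     {comm_relation Q Q' \<alpha> \<beta> |\<alpha> \<beta>. \<alpha> \<in> arcs Q \<and> \<beta> \<in> arcs Q'} \<subseteq> path_algebra QQ"
  using ideal ideal' place_left_path_algebra place_right_path_algebra comm_relation_hom
    QQ.hom_subset_path_algebra unfolding path_algebra_ideal_def by blast

lemma box_is_ideal: "path_algebra_ideal QQ box"
  unfolding box_ideal_def by (rule QQ.path_algebra_ideal_hull[OF gens_path_algebra])

lemma subspace_box: "pscale.subspace box"
  by (rule path_algebra_ideal_subspace[OF box_is_ideal])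

lemma place_right_in_box: "p \<in> verts Q \<Longrightarrow> g \<in> I' \<Longrightarrow> place_right p g \<in> box"
  unfolding box_ideal_def by (rule hull_inc) blast

lemma place_left_in_box: "q \<in> verts Q' \<Longrightarrow> f \<in> I \<Longrightarrow> place_left q f \<in> box"
  unfolding box_ideal_def by (rule hull_inc) blast

lemma comm_relation_in_box: "\<alpha> \<in> arcs Q \<Longrightarrow> \<beta> \<in> arcs Q' \<Longrightarrow> comm_relation Q Q' \<alpha> \<beta> \<in> box"
  unfolding box_ideal_def by (rule hull_inc) blast

lemma \<eta>_eq_iff:
  assumes "x \<in> verts Q" "y \<in> verts Q"
    and "f \<in> hom (vertex_kcat Q) x y" "g \<in> hom (vertex_kcat Q) x y"
  shows "\<eta> x y f = \<eta> x y g \<longleftrightarrow> f - g \<in> I"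
proof -
  have "f - g \<in> hom (vertex_kcat Q) x y"
    using pscale.subspace_diff[OF subspace_keys_subset] assms(3,4) by auto
  moreover have "f = g + j \<longleftrightarrow> j = f - g" for j by (auto simp: algebra_simps)
  ultimately show ?thesis
    using V.coset_eq_iff_Fm_eq[of x y f g] V.coset_eq_iff[of x y f g] assms by auto
qed

lemma \<eta>'_eq_iff:
  assumes "x \<in> verts Q'" "y \<in> verts Q'"
    and "f \<in> hom (vertex_kcat Q') x y" "g \<in> hom (vertex_kcat Q') x y"
  shows "\<eta>' x y f = \<eta>' x y g \<longleftrightarrow> f - g \<in> I'"
proof -
  have "f - g \<in> hom (vertex_kcat Q') x y"
    using pscale.subspace_diff[OF subspace_keys_subset] assms(3,4) by auto
  moreover have "f = g + j \<longleftrightarrow> j = f - g" for j by (auto simp: algebra_simps)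
  ultimately show ?thesis
    using V'.coset_eq_iff_Fm_eq[of x y f g] V'.coset_eq_iff[of x y f g] assms by auto
qed

section \<open>Splitting paths into their two parts\<close>

definition path_tensor ::
  "'v \<times> 'w \<Rightarrow> 'v \<times> 'w \<Rightarrow> ('v \<times> 'w, 'v \<times> 'b + 'a \<times> 'w) path \<Rightarrow> ('m \<times> 'n) \<Rightarrow>\<^sub>0 'k" where
  "path_tensor a b w = simple
    (\<eta> (fst a) (fst b) (basis (fst a, left_arcs (snd w))))
    (\<eta>' (snd a) (snd b) (basis (snd a, right_arcs (snd w))))"

text \<open>The values are formal combinations of pairs, not yet classes modulo the bilinearity
  relations; \<open>tensor_split\<close> passes to the classes.\<close>

definition split_paths ::
  "'v \<times> 'w \<Rightarrow> 'v \<times> 'w \<Rightarrow> (('v \<times> 'w, 'v \<times> 'b + 'a \<times> 'w) path \<Rightarrow>\<^sub>0 'k) \<Rightarrow> ('m \<times> 'n) \<Rightarrow>\<^sub>0 'k" where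
  "split_paths a b = lin_ext (path_tensor a b)"

abbreviation \<eta>\<eta>o where "\<eta>\<eta>o \<equiv> map_prod \<eta>o \<eta>o'"

lemma single_awalk_hom:
  "Q.awalk x p y \<Longrightarrow> basis (x, p) \<in> hom (vertex_kcat Q) x y"
  "Q'.awalk x' q y' \<Longrightarrow> basis (x', q) \<in> hom (vertex_kcat Q') x' y'"
  by simp_all

lemma path_tensor_hom:
  assumes "w \<in> paths_between QQ a b" "a \<in> verts QQ" "b \<in> verts QQ"
  shows "path_tensor a b w \<in> hom (free_prod V V') (\<eta>\<eta>o a) (\<eta>\<eta>o b)"
proof -
  obtain x x' y y' v where ab: "a = (x, x')" "b = (y, y')" "w = (a, v)"
    using assms(1) by (cases a; cases b) (auto simp: paths_between_def)
  then have "Q.awalk x (left_arcs v) y" "Q'.awalk x' (right_arcs v) y'"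
    using awalk_left_arcs[of x x' v y y'] assms by auto
  then show ?thesis
    using V.Fm_hom[OF _ _ single_awalk_hom(1)] V'.Fm_hom[OF _ _ single_awalk_hom(2)] assms ab
    by (auto simp: path_tensor_def)
qed

lemma split_paths_hom:
  assumes "f \<in> hom (vertex_kcat QQ) a b" and ab: "a \<in> verts QQ" "b \<in> verts QQ"
  shows "split_paths a b f \<in> hom (free_prod V V') (\<eta>\<eta>o a) (\<eta>\<eta>o b)"
  unfolding split_paths_def
proof (rule lin_ext_in_subspace)
  show "pscale.subspace (hom (free_prod V V') (\<eta>\<eta>o a) (\<eta>\<eta>o b))"
    by (cases a; cases b) (simp add: subspace_keys_subset)
qed (use assms path_tensor_hom in auto)

lemma fin_linear_split_paths: "fin_linear (split_paths a b)"
  unfolding split_paths_def by (rule fin_linear_lin_ext)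

text \<open>The parts of a concatenation are the concatenations of the parts, and \<eta> and \<eta>'
  preserve composites. As a composite of pairs is again a pair, equality holds before any relation
  is imposed.\<close>

lemma split_paths_cmp:
  assumes ob: "a \<in> verts QQ" "b \<in> verts QQ" "c \<in> verts QQ"
    and f: "f \<in> hom (vertex_kcat QQ) a b" and g: "g \<in> hom (vertex_kcat QQ) b c"
  shows "split_paths a c (path_mult QQ g f)
    = bilin_ext (free_prod_cmp V V' (\<eta>\<eta>o a) (\<eta>\<eta>o b) (\<eta>\<eta>o c)) (split_paths b c g) (split_paths a b f)"
proof (rule fin_linear_eqI[of "\<lambda>g. split_paths a c (path_mult QQ g f)"
      "\<lambda>g. bilin_ext (free_prod_cmp V V' (\<eta>\<eta>o a) (\<eta>\<eta>o b) (\<eta>\<eta>o c)) (split_paths b c g) (split_paths a b f)"])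
  fix k assume "k \<in> Poly_Mapping.keys g"
  then have k: "k \<in> paths_between QQ b c" using g by auto
  show "split_paths a c (path_mult QQ (basis k) f)
    = bilin_ext (free_prod_cmp V V' (\<eta>\<eta>o a) (\<eta>\<eta>o b) (\<eta>\<eta>o c))
        (split_paths b c (basis k)) (split_paths a b f)"
  proof (rule fin_linear_eqI[of "\<lambda>f. split_paths a c (path_mult QQ (basis k) f)"
        "\<lambda>f. bilin_ext (free_prod_cmp V V' (\<eta>\<eta>o a) (\<eta>\<eta>o b) (\<eta>\<eta>o c))
          (split_paths b c (basis k)) (split_paths a b f)"])
    fix l assume "l \<in> Poly_Mapping.keys f"
    then have l: "l \<in> paths_between QQ a b" using f by auto
    obtain x x' y y' z z' where abc: "a = (x, x')" "b = (y, y')" "c = (z, z')"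
      by (cases a; cases b; cases c) auto
    obtain v w where kl: "k = (b, w)" "l = (a, v)" "QQ.awalk b w c" "QQ.awalk a v b"
      using k l by (auto simp: paths_between_def)
    note v = awalk_left_arcs[OF kl(4)[unfolded abc]] and w = awalk_left_arcs[OF kl(3)[unfolded abc]]
    have "\<eta> x z (basis (x, left_arcs v @ left_arcs w))
        = cmp V (\<eta>o x) (\<eta>o y) (\<eta>o z) (\<eta> y z (basis (y, left_arcs w)))
          (\<eta> x y (basis (x, left_arcs v)))"
      using v w V.Fm_cmp[of x y z "basis (x, left_arcs v)"
          "basis (y, left_arcs w)"] ob abc by auto
    moreover have "\<eta>' x' z' (basis (x', right_arcs v @ right_arcs w))
        = cmp V' (\<eta>o' x') (\<eta>o' y') (\<eta>o' z') (\<eta>' y' z' (basis (y', right_arcs w)))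
          (\<eta>' x' y' (basis (x', right_arcs v)))"
      using v w V'.Fm_cmp[of x' y' z' "basis (x', right_arcs v)"
          "basis (y', right_arcs w)"] ob abc by auto
    ultimately show "split_paths a c (path_mult QQ (basis k) (basis l))
      = bilin_ext (free_prod_cmp V V' (\<eta>\<eta>o a) (\<eta>\<eta>o b) (\<eta>\<eta>o c))
          (split_paths b c (basis k)) (split_paths a b (basis l))"
      using kl abc by (auto simp: split_paths_def path_tensor_def)
  qed (intro fin_linear_comp[OF fin_linear_split_paths fin_linear_path_mult_right]
      fin_linear_comp[OF fin_linear_bilin_ext_right fin_linear_split_paths])+
qed (intro fin_linear_comp[OF fin_linear_split_paths fin_linear_path_mult_left]
    fin_linear_comp[OF fin_linear_bilin_ext_left fin_linear_split_paths])+

lemma kfunctor_split_paths: "kfunctor (vertex_kcat QQ) (free_prod V V') \<eta>\<eta>o split_paths"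
proof (intro kfunctor.intro QK.kcategory_axioms kcategory_free_prod kfunctor_axioms.intro)
  show "\<eta>\<eta>o a \<in> obj (free_prod V V')" if "a \<in> obj (vertex_kcat QQ)" for a
    using that V.Fo_obj V'.Fo_obj by auto
  show "split_paths a a (idm (vertex_kcat QQ) a) = idm (free_prod V V') (\<eta>\<eta>o a)"
    if "a \<in> obj (vertex_kcat QQ)" for a
    using that V.Fm_idm V'.Fm_idm by (auto simp: split_paths_def path_tensor_def)
  show "split_paths a c (cmp (vertex_kcat QQ) a b c g f)
      = cmp (free_prod V V') (\<eta>\<eta>o a) (\<eta>\<eta>o b) (\<eta>\<eta>o c) (split_paths b c g) (split_paths a b f)"
    if "a \<in> obj (vertex_kcat QQ)" "b \<in> obj (vertex_kcat QQ)" "c \<in> obj (vertex_kcat QQ)"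
      "f \<in> hom (vertex_kcat QQ) a b" "g \<in> hom (vertex_kcat QQ) b c" for a b c f g
    using that split_paths_cmp[of a b c f g] by (simp add: cmp_free_prod)
qed (use split_paths_hom module_hom.add[OF fin_linear_split_paths]
    module_hom.scale[OF fin_linear_split_paths] in auto)

text \<open>The path turns at the corner \<open>(fst b, snd a)\<close>: it follows \<open>f\<close>
  in the copy of \<open>Q\<close> over \<open>snd a\<close> and then \<open>g\<close> in the copy of
  \<open>Q'\<close> over \<open>fst b\<close>.\<close>

definition join :: "'v \<times> 'w \<Rightarrow> 'v \<times> 'w \<Rightarrow> (('v, 'a) path \<Rightarrow>\<^sub>0 'k) \<Rightarrow> (('w, 'b) path \<Rightarrow>\<^sub>0 'k) \<Rightarrow>
    ('v \<times> 'w, 'v \<times> 'b + 'a \<times> 'w) path \<Rightarrow>\<^sub>0 'k" where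
  "join a b f g = path_mult QQ (place_right (fst b) g) (place_left (snd a) f)"

lemma fin_linear_join_left: "fin_linear (\<lambda>f. join a b f g)"
  unfolding join_def by (rule fin_linear_comp[OF fin_linear_path_mult_right fin_linear_place_left])

lemma fin_linear_join_right: "fin_linear (join a b f)"
  unfolding join_def by (rule fin_linear_comp[OF fin_linear_path_mult_left fin_linear_place_right])

lemma join_single:
  assumes "Q.awalk x p y" "Q'.awalk x' q y'"
  shows "join (x, x') (y, y') (basis (x, p)) (basis (x', q))
      = basis ((x, x'), lift_left x' p @ lift_right y q)"
proof -
  have "QQ.awalk (x, x') (lift_left x' p) (y, x')"
    using assms by (auto simp: awalk_lift_left_iff)
  then have "QQ.cas (x, x') (lift_left x' p) (y, x')" by (auto simp: QQ.awalk_def)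
  then show ?thesis by (simp add: join_def)
qed

lemma join_hom:
  assumes "x \<in> verts Q" "y \<in> verts Q" "x' \<in> verts Q'" "y' \<in> verts Q'"
    and "f \<in> hom (vertex_kcat Q) x y" and "g \<in> hom (vertex_kcat Q') x' y'"
  shows "join (x, x') (y, y') f g \<in> hom (vertex_kcat QQ) (x, x') (y, y')"
  using QK.cmp_hom[of "(x, x')" "(y, x')" "(y, y')" "place_left x' f" "place_right y g"]
    place_left_hom[OF assms(3,5)] place_right_hom[OF assms(2,6)] assms(1-4) by (simp add: join_def)

text \<open>One of the two placed factors is a generator of \<open>box\<close>, and the other lies
  in the path algebra.\<close>

lemma join_in_box:
  assumes "x \<in> verts Q" "y \<in> verts Q" "x' \<in> verts Q'" "y' \<in> verts Q'"
    and f: "f \<in> hom (vertex_kcat Q) x y" and g: "g \<in> hom (vertex_kcat Q') x' y'"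
    and or: "f \<in> I \<or> g \<in> I'"
  shows "join (x, x') (y, y') f g \<in> box"
proof -
  have "f \<in> path_algebra Q" "g \<in> path_algebra Q'"
    using f g Q.hom_subset_path_algebra Q'.hom_subset_path_algebra by blast+
  then have "place_left x' f \<in> path_algebra QQ" "place_right y g \<in> path_algebra QQ"
    using assms place_left_path_algebra place_right_path_algebra by auto
  then show ?thesis
    unfolding join_def using or path_algebra_ideal_mult[OF box_is_ideal]
      place_left_in_box place_right_in_box assms by auto
qed

section \<open>Rewriting paths modulo the box ideal\<close>

lemma box_cons_left:
  assumes e: "QQ.awalk a [e] b" and d: "basis (b, v) - basis (b, w) \<in> box"
  shows "basis (a, e # v) - basis (a, e # w) \<in> box"
proof -
  \<comment> \<open>The arrow traversed first is the right-most factor, hence multiplication on the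
    right.\<close>
  from path_algebra_ideal_mult(2)[OF box_is_ideal d QQ.single_in_path_algebra[OF e, of 1]] e
  show ?thesis by (auto simp: path_mult_diff_left QQ.awalk_def)
qed

lemma box_append_right:
  assumes u: "QQ.awalk b u c" and v: "QQ.awalk a v b" and w: "QQ.awalk a w b"
    and d: "basis (a, v) - basis (a, w) \<in> box"
  shows "basis (a, v @ u) - basis (a, w @ u) \<in> box"
proof -
  from path_algebra_ideal_mult(1)[OF box_is_ideal d QQ.single_in_path_algebra[OF u, of 1]] v w
  show ?thesis by (auto simp: path_mult_diff_right QQ.awalk_def)
qed

lemma box_trans:
  "f - g \<in> box \<Longrightarrow> g - h \<in> box \<Longrightarrow> f - h \<in> box"
  using pscale.subspace_add[OF subspace_box, of "f - g" "g - h"] by simp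

text \<open>Each arrow of \<open>p\<close> is passed by one commuting square. Meanwhile \<beta>
  changes from the copy over the start of \<open>p\<close> to the copy over its end, and
  \<open>p\<close> from the copy over the head of \<beta> to the copy over its tail.\<close>

lemma box_move_right_arc:
  assumes "\<beta> \<in> arcs Q'"
  shows "Q.awalk x p y \<Longrightarrow>
    basis ((x, tail Q' \<beta>), Inl (x, \<beta>) # lift_left (head Q' \<beta>) p)
    - basis ((x, tail Q' \<beta>), lift_left (tail Q' \<beta>) p @ [Inl (y, \<beta>)]) \<in> box"
proof (induction p arbitrary: x)
  case Nil
  then show ?case by (auto simp: Q.awalk_Nil_iff pscale.subspace_0[OF subspace_box])
next
  case (Cons \<alpha> p)
  let ?t = "tail Q' \<beta>" and ?h = "head Q' \<beta>"
  have \<alpha>: "\<alpha> \<in> arcs Q" "tail Q \<alpha> = x" and p: "Q.awalk (head Q \<alpha>) p y"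
    using Cons.prems by (auto simp: Q.awalk_Cons_iff)
  have verts: "?t \<in> verts Q'" "?h \<in> verts Q'" using assms by auto
  \<comment> \<open>The relation is the path through \<open>Q\<close> first minus the other path;
    the sign is turned to match the direction of rewriting.\<close>
  have "- comm_relation Q Q' \<alpha> \<beta> \<in> box"
    using \<alpha> assms by (intro pscale.subspace_neg[OF subspace_box] comm_relation_in_box)
  then have "basis ((x, ?t), [Inl (x, \<beta>), Inr (\<alpha>, ?h)])
      - basis ((x, ?t), [Inr (\<alpha>, ?t), Inl (head Q \<alpha>, \<beta>)]) \<in> box"
    using \<alpha> by (simp add: comm_relation_def)
  moreover have "QQ.awalk (head Q \<alpha>, ?h) (lift_left ?h p) (y, ?h)"
    using p verts by (simp add: awalk_lift_left_iff)
  ultimately have 1: "basis ((x, ?t), [Inl (x, \<beta>), Inr (\<alpha>, ?h)] @ lift_left ?h p)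
      - basis ((x, ?t), [Inr (\<alpha>, ?t), Inl (head Q \<alpha>, \<beta>)] @ lift_left ?h p) \<in> box"
    using \<alpha> assms verts Cons.prems
    by (intro box_append_right[of "(head Q \<alpha>, ?h)"]) (auto simp: awalk_Cons QQ.awalk_Nil_iff)
  \<comment> \<open>The rest of the path is rewritten by the induction hypothesis behind the arrow
    \<alpha>.\<close>
  have 2: "basis ((x, ?t), Inr (\<alpha>, ?t) # Inl (head Q \<alpha>, \<beta>) # lift_left ?h p)
      - basis ((x, ?t), Inr (\<alpha>, ?t) # lift_left ?t p @ [Inl (y, \<beta>)]) \<in> box"
    using \<alpha> verts Cons.IH[OF p]
    by (intro box_cons_left[of _ _ "(head Q \<alpha>, ?t)"]) (auto simp: awalk_Cons QQ.awalk_Nil_iff)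
  show ?case using box_trans[OF 1] 2 by simp
qed

text \<open>Induction on the walk: a first arrow of \<open>Q\<close> is already in place, and a
  first arrow of \<open>Q'\<close> is moved behind the \<open>Q\<close>-part of the rest once that
  rest is in normal form.\<close>

lemma box_normal_form:
  "QQ.awalk (x, x') w (y, y') \<Longrightarrow> basis ((x, x'), w)
    - basis ((x, x'), lift_left x' (left_arcs w) @ lift_right y (right_arcs w)) \<in> box"
proof (induction w arbitrary: x x')
  case Nil
  then show ?case by (simp add: pscale.subspace_0[OF subspace_box])
next
  case (Cons e w)
  show ?case
  proof (cases e)
    case (Inl c)
    then obtain p \<beta> where e: "e = Inl (p, \<beta>)" by (cases c) auto
    have px: "p = x" "tail Q' \<beta> = x'" "x \<in> verts Q" and \<beta>: "\<beta> \<in> arcs Q'"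
      and w: "QQ.awalk (x, head Q' \<beta>) w (y, y')"
      using Cons.prems by (auto simp: e awalk_Cons)
    let ?h = "head Q' \<beta>"
    note lr = awalk_left_arcs[OF w]
    have verts: "x' \<in> verts Q'" "?h \<in> verts Q'" "y \<in> verts Q" using \<beta> px lr by auto
    have 1: "basis ((x, x'), e # w) - basis ((x, x'),
        e # lift_left ?h (left_arcs w) @ lift_right y (right_arcs w)) \<in> box"
      using Cons.IH[OF w] px \<beta> verts
      by (intro box_cons_left[of _ _ "(x, ?h)"]) (auto simp: e awalk_Cons QQ.awalk_Nil_iff)
    have 2: "basis ((x, x'), (e # lift_left ?h (left_arcs w))
          @ lift_right y (right_arcs w))
        - basis ((x, x'), (lift_left x' (left_arcs w) @ [Inl (y, \<beta>)])
          @ lift_right y (right_arcs w)) \<in> box"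
    proof (rule box_append_right)
      show "QQ.awalk (y, ?h) (lift_right y (right_arcs w)) (y, y')"
        using lr verts by (simp add: awalk_lift_right_iff)
      show "QQ.awalk (x, x') (e # lift_left ?h (left_arcs w)) (y, ?h)"
        using lr verts px \<beta> by (simp add: e awalk_Cons awalk_lift_left_iff)
      show "QQ.awalk (x, x') (lift_left x' (left_arcs w) @ [Inl (y, \<beta>)]) (y, ?h)"
        by (rule QQ.awalk_appendI[of _ _ "(y, x')"])
          (use lr verts px \<beta> in \<open>simp_all add: awalk_Cons QQ.awalk_Nil_iff awalk_lift_left_iff\<close>)
      show "basis ((x, x'), e # lift_left ?h (left_arcs w))
          - basis ((x, x'), lift_left x' (left_arcs w) @ [Inl (y, \<beta>)]) \<in> box"
        using box_move_right_arc[OF \<beta> conjunct1[OF lr]] px e by simp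
    qed
    show ?thesis using box_trans[OF 1] 2 by (simp add: e)
  next
    case (Inr c)
    then obtain \<alpha> q where e: "e = Inr (\<alpha>, q)" by (cases c) auto
    have w: "QQ.awalk (head Q \<alpha>, x') w (y, y')" and q: "q = x'" "tail Q \<alpha> = x" "\<alpha> \<in> arcs Q" "x' \<in> verts Q'"
      using Cons.prems by (auto simp: e awalk_Cons)
    then show ?thesis
      using box_cons_left[OF _ Cons.IH[OF w], of "(x, x')" e] by (simp add: e awalk_Cons QQ.awalk_Nil_iff)
  qed
qed

text \<open>An arbitrary preimage under \<eta>, in general not linear in \<open>F\<close>; by
  \<open>join_cong_left\<close> the choice does not matter modulo \<open>box\<close>.\<close>

definition rep :: "'v \<Rightarrow> 'v \<Rightarrow> 'm \<Rightarrow> ('v, 'a) path \<Rightarrow>\<^sub>0 'k" where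
  "rep x y F = (SOME f. f \<in> hom (vertex_kcat Q) x y \<and> \<eta> x y f = F)"

definition rep' :: "'w \<Rightarrow> 'w \<Rightarrow> 'n \<Rightarrow> ('w, 'b) path \<Rightarrow>\<^sub>0 'k" where
  "rep' x y G = (SOME g. g \<in> hom (vertex_kcat Q') x y \<and> \<eta>' x y g = G)"

lemma rep:
  assumes "x \<in> verts Q" "y \<in> verts Q" "F \<in> hom V (\<eta>o x) (\<eta>o y)"
  shows "rep x y F \<in> hom (vertex_kcat Q) x y \<and> \<eta> x y (rep x y F) = F"
  unfolding rep_def by (rule someI_ex) (use V.full[of x y] assms in auto)

lemma rep':
  assumes "x \<in> verts Q'" "y \<in> verts Q'" "G \<in> hom V' (\<eta>o' x) (\<eta>o' y)"
  shows "rep' x y G \<in> hom (vertex_kcat Q') x y \<and> \<eta>' x y (rep' x y G) = G"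
  unfolding rep'_def by (rule someI_ex) (use V'.full[of x y] assms in auto)

text \<open>Pairs are basis elements of the formal combinations, so even a nonlinear choice of
  representatives extends to a linear map; \<open>join_reps_rels\<close> shows that it respects the
  tensor relations modulo \<open>box\<close>.\<close>

definition join_reps :: "'v \<times> 'w \<Rightarrow> 'v \<times> 'w \<Rightarrow> (('m \<times> 'n) \<Rightarrow>\<^sub>0 'k) \<Rightarrow>
    ('v \<times> 'w, 'v \<times> 'b + 'a \<times> 'w) path \<Rightarrow>\<^sub>0 'k" where
  "join_reps a b = lin_ext (\<lambda>(F, G). join a b (rep (fst a) (fst b) F) (rep' (snd a) (snd b) G))"

lemma fin_linear_join_reps: "fin_linear (join_reps a b)"
  unfolding join_reps_def by (rule fin_linear_lin_ext)

lemma join_reps_simple [simp]: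
  "join_reps (x, x') (y, y') (Poly_Mapping.single (F, G) c)
    = pscale c (join (x, x') (y, y') (rep x y F) (rep' x' y' G))"
  by (simp add: join_reps_def)

lemmas join_diff_left = module_hom.diff[OF fin_linear_join_left]
  and join_diff_right = module_hom.diff[OF fin_linear_join_right]
  and join_add_left = module_hom.add[OF fin_linear_join_left]
  and join_add_right = module_hom.add[OF fin_linear_join_right]
  and join_scale_left = module_hom.scale[OF fin_linear_join_left]
  and join_scale_right = module_hom.scale[OF fin_linear_join_right]

section \<open>The inverse of splitting modulo the box ideal\<close>

context
  fixes x y x' y' assumes ob [simp]: "x \<in> verts Q" "y \<in> verts Q" "x' \<in> verts Q'" "y' \<in> verts Q'"
begin

abbreviation "hom_rels \<equiv> tensor_rels V V' (\<eta>o x, \<eta>o' x') (\<eta>o y, \<eta>o' y')"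

text \<open>The difference \<open>f - f'\<close> lies in \<open>I\<close>, so its join with
  \<open>g\<close> lies in \<open>box\<close>.\<close>

lemma join_cong_left:
  assumes "f \<in> hom (vertex_kcat Q) x y" "f' \<in> hom (vertex_kcat Q) x y" "\<eta> x y f = \<eta> x y f'"
    and "g \<in> hom (vertex_kcat Q') x' y'"
  shows "join (x, x') (y, y') f g - join (x, x') (y, y') f' g \<in> box"
proof -
  have "f - f' \<in> hom (vertex_kcat Q) x y"
    using assms pscale.subspace_diff[OF subspace_keys_subset, of f "paths_between Q x y" f'] by simp
  then show ?thesis
    using join_in_box[of x y x' y' "f - f'" g] \<eta>_eq_iff[of x y f f'] assms
    by (simp add: join_diff_left)
qed

lemma join_cong_right:
  assumes "g \<in> hom (vertex_kcat Q') x' y'" "g' \<in> hom (vertex_kcat Q') x' y'" "\<eta>' x' y' g = \<eta>' x' y' g'"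
    and "f \<in> hom (vertex_kcat Q) x y"
  shows "join (x, x') (y, y') f g - join (x, x') (y, y') f g' \<in> box"
proof -
  have "g - g' \<in> hom (vertex_kcat Q') x' y'"
    using assms pscale.subspace_diff[OF subspace_keys_subset, of g "paths_between Q' x' y'" g'] by simp
  then show ?thesis
    using join_in_box[of x y x' y' f "g - g'"] \<eta>'_eq_iff[of x' y' g g'] assms
    by (simp add: join_diff_right)
qed

text \<open>The representative of a sum and the sum of the representatives have the same image under
  \<eta>, and likewise for multiples; their joins therefore agree modulo \<open>box\<close>, which
  sends each relation into \<open>box\<close>.\<close>

lemma join_reps_rels:
  "hom_rels \<subseteq> {t. join_reps (x, x') (y, y') t \<in> box}"
proof (rule tensor_rels_subset)
  let ?a = "(x, x')" and ?b = "(y, y')"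
  have obV: "\<eta>o x \<in> obj V" "\<eta>o y \<in> obj V" "\<eta>o' x' \<in> obj V'" "\<eta>o' y' \<in> obj V'"
    using V.Fo_obj V'.Fo_obj by simp_all
  note diff = module_hom.diff[OF fin_linear_join_reps] and add = module_hom.add[OF fin_linear_join_reps]
    and scale = module_hom.scale[OF fin_linear_join_reps]
  show "pscale.subspace {t. join_reps ?a ?b t \<in> box}"
    by (rule module_hom.subspace_linear_preimage[OF fin_linear_join_reps subspace_box])
  show "simple (add V (\<eta>o x) (\<eta>o y) f g) h - simple f h - simple g h \<in> {t. join_reps ?a ?b t \<in> box}"
    if h: "f \<in> hom V (\<eta>o x) (\<eta>o y)" "g \<in> hom V (\<eta>o x) (\<eta>o y)" "h \<in> hom V' (\<eta>o' x') (\<eta>o' y')" for f g h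
  proof -
    note F = rep[OF ob(1,2) h(1)] and G = rep[OF ob(1,2) h(2)] and H = rep'[OF ob(3,4) h(3)]
      and FG = rep[OF ob(1,2) V.cod.add_hom[OF obV(1,2) h(1,2)]]
    have "rep x y f + rep x y g \<in> hom (vertex_kcat Q) x y"
      using V.dom.add_hom[of x y "rep x y f" "rep x y g"] F G by simp
    moreover have "\<eta> x y (rep x y f + rep x y g) = add V (\<eta>o x) (\<eta>o y) f g"
      using V.Fm_add[of x y "rep x y f" "rep x y g"] F G by simp
    ultimately have "join ?a ?b (rep x y (add V (\<eta>o x) (\<eta>o y) f g)) (rep' x' y' h)
        - join ?a ?b (rep x y f + rep x y g) (rep' x' y' h) \<in> box"
      using FG H by (intro join_cong_left) simp_all
    then show ?thesis by (simp add: diff add join_add_left diff_diff_eq)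
  qed
  show "simple f (add V' (\<eta>o' x') (\<eta>o' y') g h) - simple f g - simple f h \<in> {t. join_reps ?a ?b t \<in> box}"
    if h: "f \<in> hom V (\<eta>o x) (\<eta>o y)" "g \<in> hom V' (\<eta>o' x') (\<eta>o' y')" "h \<in> hom V' (\<eta>o' x') (\<eta>o' y')" for f g h
  proof -
    note F = rep[OF ob(1,2) h(1)] and G = rep'[OF ob(3,4) h(2)] and H = rep'[OF ob(3,4) h(3)]
      and GH = rep'[OF ob(3,4) V'.cod.add_hom[OF obV(3,4) h(2,3)]]
    have "rep' x' y' g + rep' x' y' h \<in> hom (vertex_kcat Q') x' y'"
      using V'.dom.add_hom[of x' y' "rep' x' y' g" "rep' x' y' h"] G H by simp
    moreover have "\<eta>' x' y' (rep' x' y' g + rep' x' y' h) = add V' (\<eta>o' x') (\<eta>o' y') g h"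
      using V'.Fm_add[of x' y' "rep' x' y' g" "rep' x' y' h"] G H by simp
    ultimately have "join ?a ?b (rep x y f) (rep' x' y' (add V' (\<eta>o' x') (\<eta>o' y') g h))
        - join ?a ?b (rep x y f) (rep' x' y' g + rep' x' y' h) \<in> box"
      using F GH by (intro join_cong_right) simp_all
    then show ?thesis by (simp add: diff add join_add_right diff_diff_eq)
  qed
  show "simple (scl V (\<eta>o x) (\<eta>o y) c f) g - pscale c (simple f g) \<in> {t. join_reps ?a ?b t \<in> box}"
    if h: "f \<in> hom V (\<eta>o x) (\<eta>o y)" "g \<in> hom V' (\<eta>o' x') (\<eta>o' y')" for c f g
  proof -
    note F = rep[OF ob(1,2) h(1)] and G = rep'[OF ob(3,4) h(2)]
      and cF = rep[OF ob(1,2) V.cod.scl_hom[OF obV(1,2) h(1)]]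
    have "pscale c (rep x y f) \<in> hom (vertex_kcat Q) x y"
      using V.dom.scl_hom[of x y "rep x y f"] F by simp
    moreover have "\<eta> x y (pscale c (rep x y f)) = scl V (\<eta>o x) (\<eta>o y) c f"
      using V.Fm_scl[of x y "rep x y f"] F by simp
    ultimately have "join ?a ?b (rep x y (scl V (\<eta>o x) (\<eta>o y) c f)) (rep' x' y' g)
        - join ?a ?b (pscale c (rep x y f)) (rep' x' y' g) \<in> box"
      using cF G by (intro join_cong_left) simp_all
    then show ?thesis by (simp add: diff join_scale_left)
  qed
  show "simple f (scl V' (\<eta>o' x') (\<eta>o' y') c g) - pscale c (simple f g) \<in> {t. join_reps ?a ?b t \<in> box}"
    if h: "f \<in> hom V (\<eta>o x) (\<eta>o y)" "g \<in> hom V' (\<eta>o' x') (\<eta>o' y')" for c f g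
  proof -
    note F = rep[OF ob(1,2) h(1)] and G = rep'[OF ob(3,4) h(2)]
      and cG = rep'[OF ob(3,4) V'.cod.scl_hom[OF obV(3,4) h(2)]]
    have "pscale c (rep' x' y' g) \<in> hom (vertex_kcat Q') x' y'"
      using V'.dom.scl_hom[of x' y' "rep' x' y' g"] G by simp
    moreover have "\<eta>' x' y' (pscale c (rep' x' y' g)) = scl V' (\<eta>o' x') (\<eta>o' y') c g"
      using V'.Fm_scl[of x' y' "rep' x' y' g"] G by simp
    ultimately have "join ?a ?b (rep x y f) (rep' x' y' (scl V' (\<eta>o' x') (\<eta>o' y') c g))
        - join ?a ?b (rep x y f) (pscale c (rep' x' y' g)) \<in> box"
      using F cG by (intro join_cong_right) simp_all
    then show ?thesis by (simp add: diff join_scale_right)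
  qed
qed

text \<open>For a single path, representatives of the images of its two parts are joined. Replacing
  them by the parts themselves changes the join only modulo \<open>box\<close>, and the join of the
  parts is the normal form of the path.\<close>

lemma join_reps_split_paths:
  assumes f: "f \<in> hom (vertex_kcat QQ) (x, x') (y, y')"
  shows "join_reps (x, x') (y, y') (split_paths (x, x') (y, y') f) - f \<in> box"
proof -
  let ?a = "(x, x')" and ?b = "(y, y')"
  have "f \<in> {f. join_reps ?a ?b (split_paths ?a ?b f) - f \<in> box}"
  proof (rule subspace_singles)
    show "pscale.subspace {f. join_reps ?a ?b (split_paths ?a ?b f) - f \<in> box}"
      by (rule module_hom.subspace_linear_preimage[OF _ subspace_box])
        (intro pscale_pair.module_hom_sub fin_linear_ident
          fin_linear_comp[OF fin_linear_join_reps fin_linear_split_paths])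
    fix k assume "k \<in> Poly_Mapping.keys f"
    then obtain w where k: "k = (?a, w)" and w: "QQ.awalk ?a w ?b"
      using f by (auto simp: paths_between_def)
    note lr = awalk_left_arcs[OF w]
    let ?p = "basis (x, left_arcs w) :: ('v, 'a) path \<Rightarrow>\<^sub>0 'k"
    let ?q = "basis (x', right_arcs w) :: ('w, 'b) path \<Rightarrow>\<^sub>0 'k"
    have p: "?p \<in> hom (vertex_kcat Q) x y" and q: "?q \<in> hom (vertex_kcat Q') x' y'" using lr by simp_all
    note P = rep[OF ob(1,2) V.Fm_hom[of x y, OF _ _ p]] and G = rep'[OF ob(3,4) V'.Fm_hom[of x' y', OF _ _ q]]
    have 1: "join ?a ?b (rep x y (\<eta> x y ?p)) (rep' x' y' (\<eta>' x' y' ?q))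
        - join ?a ?b ?p (rep' x' y' (\<eta>' x' y' ?q)) \<in> box"
      by (rule join_cong_left) (use P G p in simp_all)
    have 2: "join ?a ?b ?p (rep' x' y' (\<eta>' x' y' ?q)) - join ?a ?b ?p ?q \<in> box"
      by (rule join_cong_right) (use G p q in simp_all)
    have 3: "join ?a ?b ?p ?q - basis k \<in> box"
      using pscale.subspace_neg[OF subspace_box box_normal_form[OF w]] join_single[of x _ y x' _ y'] lr k
      by simp
    show "basis k \<in> {f. join_reps ?a ?b (split_paths ?a ?b f) - f \<in> box}"
      using box_trans[OF box_trans[OF 1 2] 3] by (simp add: k split_paths_def path_tensor_def)
  qed
  then show ?thesis by simp
qed

text \<open>The map \<open>f \<mapsto> \<eta> f \<otimes> G\<close> is linear modulo the bilinearity
  relations, so \<open>lin_ext_singles_diff\<close> applies.\<close>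

lemma rels_expand_left:
  assumes f: "f \<in> hom (vertex_kcat Q) x y" and G: "G \<in> hom V' (\<eta>o' x') (\<eta>o' y')"
  shows "lin_ext (\<lambda>p. simple (\<eta> x y (basis p)) G) f - simple (\<eta> x y f) G
    \<in> hom_rels"
proof (rule lin_ext_singles_diff[where A = "paths_between Q x y" and \<phi> = "\<lambda>f. simple (\<eta> x y f) G"])
  fix g h :: "('v, 'a) path \<Rightarrow>\<^sub>0 'k" and c
  assume g: "Poly_Mapping.keys g \<subseteq> paths_between Q x y"
  show "simple (\<eta> x y (pscale c g)) G - pscale c (simple (\<eta> x y g) G)
      \<in> hom_rels"
    using tensor_rels_scl_left[OF V.Fm_hom[of x y g] G, of c] V.Fm_scl[of x y g c] g by simp
  assume "Poly_Mapping.keys h \<subseteq> paths_between Q x y"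
  then show "simple (\<eta> x y (g + h)) G - simple (\<eta> x y g) G - simple (\<eta> x y h) G
      \<in> hom_rels"
    using tensor_rels_add_left[OF V.Fm_hom[of x y g] V.Fm_hom[of x y h] G] V.Fm_add[of x y g h] g
    by simp
qed (use f in simp_all)

lemma rels_expand_right:
  assumes g: "g \<in> hom (vertex_kcat Q') x' y'" and F: "F \<in> hom V (\<eta>o x) (\<eta>o y)"
  shows "lin_ext (\<lambda>q. simple F (\<eta>' x' y' (basis q))) g - simple F (\<eta>' x' y' g)
    \<in> hom_rels"
proof (rule lin_ext_singles_diff[where A = "paths_between Q' x' y'" and \<phi> = "\<lambda>g. simple F (\<eta>' x' y' g)"])
  fix g h :: "('w, 'b) path \<Rightarrow>\<^sub>0 'k" and c
  assume g: "Poly_Mapping.keys g \<subseteq> paths_between Q' x' y'"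
  show "simple F (\<eta>' x' y' (pscale c g)) - pscale c (simple F (\<eta>' x' y' g))
      \<in> hom_rels"
    using tensor_rels_scl_right[OF F V'.Fm_hom[of x' y' g], of c] V'.Fm_scl[of x' y' g c] g by simp
  assume "Poly_Mapping.keys h \<subseteq> paths_between Q' x' y'"
  then show "simple F (\<eta>' x' y' (g + h)) - simple F (\<eta>' x' y' g) - simple F (\<eta>' x' y' h)
      \<in> hom_rels"
    using tensor_rels_add_right[OF F V'.Fm_hom[of x' y' g] V'.Fm_hom[of x' y' h]]
      V'.Fm_add[of x' y' g h] g
    by simp
qed (use g in simp_all)

text \<open>If \<open>f\<close> and \<open>g\<close> are paths, the parts of the joined path are
  \<open>f\<close> and \<open>g\<close>, and equality holds before the relations. In general both
  factors are expanded in paths, which costs bilinearity relations, first on the right and then on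
  the left.\<close>

lemma split_paths_join:
  assumes f: "f \<in> hom (vertex_kcat Q) x y" and g: "g \<in> hom (vertex_kcat Q') x' y'"
  shows "split_paths (x, x') (y, y') (join (x, x') (y, y') f g) - simple (\<eta> x y f) (\<eta>' x' y' g)
    \<in> hom_rels"
proof -
  let ?a = "(x, x')" and ?b = "(y, y')"
  let ?\<mu> = "\<lambda>p q. simple (\<eta> x y (basis p)) (\<eta>' x' y' (basis q))"
  have "split_paths ?a ?b (join ?a ?b f g) = bilin_ext ?\<mu> f g"
  proof (rule fin_linear_eqI[of "\<lambda>f. split_paths ?a ?b (join ?a ?b f g)" "\<lambda>f. bilin_ext ?\<mu> f g"])
    fix k assume "k \<in> Poly_Mapping.keys f"
    then obtain p where k: "k = (x, p)" "Q.awalk x p y" using f by (auto simp: paths_between_def)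
    show "split_paths ?a ?b (join ?a ?b (basis k) g)
        = bilin_ext ?\<mu> (basis k) g"
    proof (rule fin_linear_eqI[of "\<lambda>g. split_paths ?a ?b (join ?a ?b (basis k) g)"])
      fix l assume "l \<in> Poly_Mapping.keys g"
      then obtain q where "l = (x', q)" "Q'.awalk x' q y'" using g by (auto simp: paths_between_def)
      then show "split_paths ?a ?b (join ?a ?b (basis k) (basis l))
          = bilin_ext ?\<mu> (basis k) (basis l)"
        using k by (simp add: join_single split_paths_def path_tensor_def)
    qed (intro fin_linear_comp[OF fin_linear_split_paths fin_linear_join_right] fin_linear_bilin_ext_right)+
  qed (intro fin_linear_comp[OF fin_linear_split_paths fin_linear_join_left] fin_linear_bilin_ext_left)+
  also have "\<dots> = lin_ext (\<lambda>p. lin_ext (?\<mu> p) g) f" by (rule bilin_ext_eq_left)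
  finally have eq: "split_paths ?a ?b (join ?a ?b f g) = lin_ext (\<lambda>p. lin_ext (?\<mu> p) g) f" .
  have "lin_ext (\<lambda>p. lin_ext (?\<mu> p) g) f
      - lin_ext (\<lambda>p. simple (\<eta> x y (basis p)) (\<eta>' x' y' g)) f \<in> hom_rels"
  proof (rule lin_ext_diff_in_subspace[OF pscale.subspace_span])
    fix p assume "p \<in> Poly_Mapping.keys f"
    then have "basis p \<in> hom (vertex_kcat Q) x y" using f by auto
    then show "lin_ext (?\<mu> p) g - simple (\<eta> x y (basis p)) (\<eta>' x' y' g) \<in> hom_rels"
      by (intro rels_expand_right[OF g] V.Fm_hom) simp_all
  qed
  moreover have "lin_ext (\<lambda>p. simple (\<eta> x y (basis p)) (\<eta>' x' y' g)) f
      - simple (\<eta> x y f) (\<eta>' x' y' g) \<in> hom_rels"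
    by (rule rels_expand_left[OF f]) (use V'.Fm_hom[OF _ _ g] in simp)
  ultimately show ?thesis
    unfolding eq using pscale.span_add by fastforce
qed

text \<open>The preimage is \<open>join_reps\<close> of \<open>t\<close>: it is a combination of
  paths between the two vertices, and on each pair in \<open>t\<close> splitting undoes joining
  modulo the relations by \<open>split_paths_join\<close>.\<close>

lemma split_paths_full:
  assumes t: "t \<in> hom (free_prod V V') (\<eta>o x, \<eta>o' x') (\<eta>o y, \<eta>o' y')"
  shows "\<exists>f\<in>hom (vertex_kcat QQ) (x, x') (y, y').
    split_paths (x, x') (y, y') f - t \<in> hom_rels"
proof -
  let ?a = "(x, x')" and ?b = "(y, y')"
  have reps: "\<exists>f g. F = \<eta> x y f \<and> G = \<eta>' x' y' g \<and> f \<in> hom (vertex_kcat Q) x y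
      \<and> g \<in> hom (vertex_kcat Q') x' y' \<and> join_reps ?a ?b (simple F G) = join ?a ?b f g"
    if "(F, G) \<in> Poly_Mapping.keys t" for F G
    using that t rep[OF ob(1,2), of F] rep'[OF ob(3,4), of G]
    by (intro exI[of _ "rep x y F"] exI[of _ "rep' x' y' G"]) auto
  have "t \<in> {t. join_reps ?a ?b t \<in> hom (vertex_kcat QQ) ?a ?b}"
  proof (rule subspace_singles)
    show "pscale.subspace {t. join_reps ?a ?b t \<in> hom (vertex_kcat QQ) ?a ?b}"
      by (rule module_hom.subspace_linear_preimage[OF fin_linear_join_reps])
        (simp add: subspace_keys_subset)
    fix k assume "k \<in> Poly_Mapping.keys t"
    then obtain f g where "f \<in> hom (vertex_kcat Q) x y" "g \<in> hom (vertex_kcat Q') x' y'"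
      "join_reps ?a ?b (basis k) = join ?a ?b f g"
      using reps[of "fst k" "snd k"] by auto
    then show "basis k \<in> {t. join_reps ?a ?b t \<in> hom (vertex_kcat QQ) ?a ?b}"
      using join_hom[of x y x' y' f g] by simp
  qed
  moreover have "t \<in> {t. split_paths ?a ?b (join_reps ?a ?b t) - t \<in> hom_rels}"
  proof (rule subspace_singles)
    show "pscale.subspace {t. split_paths ?a ?b (join_reps ?a ?b t) - t \<in> hom_rels}"
      by (rule module_hom.subspace_linear_preimage[OF _ pscale.subspace_span])
        (intro pscale_pair.module_hom_sub fin_linear_ident
          fin_linear_comp[OF fin_linear_split_paths fin_linear_join_reps])
    fix k assume "k \<in> Poly_Mapping.keys t"
    then show "basis k \<in> {t. split_paths ?a ?b (join_reps ?a ?b t) - t \<in> hom_rels}"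
      using reps[of "fst k" "snd k"] split_paths_join by (cases k) auto
  qed
  ultimately show ?thesis by blast
qed

end

end

section \<open>Ideals of the path algebra and ideals of the path category\<close>

context wf_digraph
begin

text \<open>A path determines its end point, so it contributes to one component only.\<close>

lemma path_component_of_hom:
  assumes f: "f \<in> hom (vertex_kcat G) x y"
  shows "path_component u v f = (if u = x \<and> v = y then f else 0)"
proof -
  have "path_component u v f = (if u = x \<and> v = y then id else (\<lambda>_. 0)) f"
    unfolding path_component_def
  proof (rule fin_linear_eqI[OF fin_linear_lin_ext])
    show "fin_linear (if u = x \<and> v = y then id else (\<lambda>_. 0))"
      using fin_linear_ident pscale_pair.module_hom_zero by (auto simp: id_def)
    fix a assume "a \<in> Poly_Mapping.keys f"
    then obtain p where "a = (x, p)" "awalk x p y" using f by (auto simp: paths_between_def)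
    then show "lin_ext (\<lambda>p. if p \<in> paths_between G u v then basis p else 0)
        (basis a) = (if u = x \<and> v = y then id else (\<lambda>_. 0)) (basis a)"
      using cas_end_unique by (auto simp: awalk_def)
  qed
  then show ?thesis by simp
qed

text \<open>Here q = e_z q e_y, and the product e_v e_z vanishes unless
  \<open>v = z\<close>.\<close>

lemma path_component_mult_left:
  assumes q: "awalk y q z" and f: "f \<in> path_algebra G"
  shows "path_component u v (path_mult G (basis (y, q)) f)
    = (if v = z then path_mult G (basis (y, q)) (path_component u y f) else 0)"
proof -
  let ?q = "basis (y, q)"
  \<comment> \<open>Writing the case distinction as a scalar keeps the right side visibly linear in
    \<open>f\<close>.\<close>
  let ?c = "if v = z then 1 else 0"
  have "path_component u v (path_mult G ?q f) = pscale ?c (path_mult G ?q (path_component u y f))"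
    unfolding path_component_def
  proof (rule fin_linear_eqI[where S = "\<lambda>f. lin_ext _ (path_mult G ?q f)"
        and T = "\<lambda>f. pscale ?c (path_mult G ?q (lin_ext _ f))"])
    fix a assume "a \<in> Poly_Mapping.keys f"
    then have "a \<in> paths G" using f by (auto simp: path_algebra_def)
    then obtain x p y' where a: "a = (x, p)" "awalk x p y'"
      by (metis in_paths_iff prod.exhaust)
    have "cas x p y \<longleftrightarrow> y = y'" using a cas_end_unique by (auto simp: awalk_def)
    moreover have "awalk x (p @ q) w \<longleftrightarrow> w = z" if "y = y'" for w
      using awalk_appendI[OF a(2), of q z] q that cas_end_unique[of x "p @ q" w z] by (auto simp: awalk_def)
    moreover have "awalk x p w \<longleftrightarrow> w = y'" for w
      using a cas_end_unique[of x p w y'] by (auto simp: awalk_def)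
    ultimately show "lin_ext (\<lambda>p. if p \<in> paths_between G u v then basis p else 0)
        (path_mult G ?q (basis a))
      = pscale ?c (path_mult G ?q (lin_ext (\<lambda>p. if p \<in> paths_between G u y then basis p else 0)
        (basis a)))"
      using a(1) by (auto simp: module_hom.zero[OF fin_linear_lin_ext] simp del: cas_append_iff awalk_append_iff)
  qed (intro fin_linear_comp[OF fin_linear_lin_ext fin_linear_path_mult_right]
      pscale_pair.module_hom_scale fin_linear_comp[OF fin_linear_path_mult_right fin_linear_lin_ext])+
  then show ?thesis by simp
qed

lemma path_component_mult_right:
  assumes p: "awalk x p y" and f: "f \<in> path_algebra G"
  shows "path_component u v (path_mult G f (basis (x, p)))
    = (if u = x then path_mult G (path_component y v f) (basis (x, p)) else 0)"
proof -
  let ?p = "basis (x, p)"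
  let ?c = "if u = x then 1 else 0"
  have "path_component u v (path_mult G f ?p) = pscale ?c (path_mult G (path_component y v f) ?p)"
    unfolding path_component_def
  proof (rule fin_linear_eqI[where S = "\<lambda>f. lin_ext _ (path_mult G f ?p)"
        and T = "\<lambda>f. pscale ?c (path_mult G (lin_ext _ f) ?p)"])
    fix a assume "a \<in> Poly_Mapping.keys f"
    then have "a \<in> paths G" using f by (auto simp: path_algebra_def)
    then obtain y' q z where a: "a = (y', q)" "awalk y' q z"
      by (metis in_paths_iff prod.exhaust)
    have "cas x p y' \<longleftrightarrow> y' = y" using p cas_end_unique by (auto simp: awalk_def)
    moreover have "awalk x (p @ q) w \<longleftrightarrow> w = z" if "y' = y" for w
      using awalk_appendI[OF p, of q z] a(2) that cas_end_unique[of x "p @ q" w z] by (auto simp: awalk_def)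
    moreover have "awalk y' q w \<longleftrightarrow> w = z" for w
      using a cas_end_unique[of y' q w z] by (auto simp: awalk_def)
    ultimately show "lin_ext (\<lambda>p. if p \<in> paths_between G u v then basis p else 0)
        (path_mult G (basis a) ?p)
      = pscale ?c (path_mult G (lin_ext (\<lambda>p. if p \<in> paths_between G y v then basis p else 0)
        (basis a)) ?p)"
      using a(1) p by (auto simp: module_hom.zero[OF fin_linear_lin_ext] awalk_def simp del: cas_append_iff awalk_append_iff)
  qed (intro fin_linear_comp[OF fin_linear_lin_ext fin_linear_path_mult_left]
      pscale_pair.module_hom_scale fin_linear_comp[OF fin_linear_path_mult_left fin_linear_lin_ext])+
  then show ?thesis by simp
qed

lemma fin_linear_path_component: "fin_linear (path_component x y)"
  unfolding path_component_def by (rule fin_linear_lin_ext)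

text \<open>The hull defining \<open>box\<close> ranges over ideals of the path algebra, but a
  kernel is an ideal of the category; this turns the second kind into the first. Multiplying by a
  single path carries one component to another, or to zero.\<close>

lemma path_algebra_ideal_of_kideal:
  fixes J :: "'a \<Rightarrow> 'a \<Rightarrow> (('a, 'b) path \<Rightarrow>\<^sub>0 'k::field) set"
  assumes "kideal (vertex_kcat G) J"
  shows "path_algebra_ideal G
    {f \<in> path_algebra G. \<forall>x\<in>verts G. \<forall>y\<in>verts G. path_component x y f \<in> J x y}" (is "path_algebra_ideal G ?I")
proof -
  interpret J: kideal "vertex_kcat G" J by (rule assms)
  have J_subspace: "pscale.subspace (J x y)" if "x \<in> verts G" "y \<in> verts G" for x y
    using J.ideal_zer[of x y] J.ideal_add[of x y] J.ideal_scl[of x y] that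
    by (intro pscale.subspaceI) simp_all
  have "?I = path_algebra G \<inter> (\<Inter>x\<in>verts G. \<Inter>y\<in>verts G. {f. path_component x y f \<in> J x y})"
    by auto
  also have "pscale.subspace \<dots>"
    by (intro pscale.subspace_inter pscale.subspace_Int subspace_path_algebra
        module_hom.subspace_linear_preimage[OF fin_linear_path_component] J_subspace)
  finally have subspace: "pscale.subspace ?I" .
  have "path_mult G g f \<in> ?I \<and> path_mult G f g \<in> ?I" if f: "f \<in> ?I" and g: "g \<in> path_algebra G" for f g
  proof -
    have fa: "f \<in> path_algebra G" using f by simp
    \<comment> \<open>Membership after multiplication is a linear condition on \<open>g\<close>, so
      \<open>g\<close> may be taken to be a path.\<close>
    have "g \<in> {g. path_mult G g f \<in> ?I} \<inter> {g. path_mult G f g \<in> ?I}"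
    proof (rule subspace_singles)
      show "pscale.subspace ({g. path_mult G g f \<in> ?I} \<inter> {g. path_mult G f g \<in> ?I})"
        by (intro pscale.subspace_inter subspace
            module_hom.subspace_linear_preimage[OF fin_linear_path_mult_left]
            module_hom.subspace_linear_preimage[OF fin_linear_path_mult_right])
      fix a assume "a \<in> Poly_Mapping.keys g"
      then have "a \<in> paths G" using g by (auto simp: path_algebra_def)
      then obtain y q z where a: "a = (y, q)" and q: "awalk y q z"
        by (metis in_paths_iff prod.exhaust)
      let ?a = "basis a :: ('a, 'b) path \<Rightarrow>\<^sub>0 'k"
      have yz: "y \<in> verts G" "z \<in> verts G" using q by auto
      have hom: "?a \<in> hom (vertex_kcat G) y z" using a q by simp
      have "?a \<in> path_algebra G" using hom hom_subset_path_algebra by blast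
      moreover have "path_component u v (path_mult G ?a f) \<in> J u v" if "u \<in> verts G" "v \<in> verts G" for u v
        using J.ideal_cmp_right[of u y z "path_component u y f" ?a] J.ideal_zer[of u v] that f yz hom
        unfolding a path_component_mult_left[OF q fa] by simp
      moreover have "path_component u v (path_mult G f ?a) \<in> J u v" if "u \<in> verts G" "v \<in> verts G" for u v
        using J.ideal_cmp_left[of y z v ?a "path_component z v f"] J.ideal_zer[of u v] that f yz hom
        unfolding a path_component_mult_right[OF q fa] by simp
      ultimately show "?a \<in> {g. path_mult G g f \<in> ?I} \<inter> {g. path_mult G f g \<in> ?I}"
        by (simp add: path_mult_in_path_algebra fa)
    qed
    then show ?thesis by blast
  qed
  then show ?thesis using subspace by (auto simp: path_algebra_ideal_def)
qed

lemma kideal_of_path_algebra_ideal: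
  fixes I :: "(('a, 'b) path \<Rightarrow>\<^sub>0 'k::field) set"
  assumes "path_algebra_ideal G I"
  shows "kideal (vertex_kcat G) (\<lambda>x y. {f \<in> hom (vertex_kcat G) x y. f \<in> I})"
proof -
  interpret K: kcategory "vertex_kcat G :: ('a, ('a, 'b) path \<Rightarrow>\<^sub>0 'k, 'k) kcat" by (rule kcategory_vertex_kcat)
  note subspace = path_algebra_ideal_subspace[OF assms]
  show ?thesis
  proof (intro kideal.intro K.kcategory_axioms kideal_axioms.intro, unfold vertex_kcat_simps(1))
    fix x y z and f g :: "('a, 'b) path \<Rightarrow>\<^sub>0 'k"
    assume "x \<in> verts G" "y \<in> verts G" "z \<in> verts G"
      "f \<in> {f \<in> hom (vertex_kcat G) x y. f \<in> I}" "g \<in> hom (vertex_kcat G) y z"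
    then show "cmp (vertex_kcat G) x y z g f \<in> {f \<in> hom (vertex_kcat G) x z. f \<in> I}"
      using K.cmp_hom[of x y z f g] subsetD[OF hom_subset_path_algebra, of g y z]
        path_algebra_ideal_mult(1)[OF assms, of f g] by simp
  next
    fix x y z and f g :: "('a, 'b) path \<Rightarrow>\<^sub>0 'k"
    assume "x \<in> verts G" "y \<in> verts G" "z \<in> verts G"
      "f \<in> hom (vertex_kcat G) x y" "g \<in> {f \<in> hom (vertex_kcat G) y z. f \<in> I}"
    then show "cmp (vertex_kcat G) x y z g f \<in> {f \<in> hom (vertex_kcat G) x z. f \<in> I}"
      using K.cmp_hom[of x y z f g] subsetD[OF hom_subset_path_algebra, of f x y]
        path_algebra_ideal_mult(2)[OF assms, of g f] by simp
  next
    fix x y and f g :: "('a, 'b) path \<Rightarrow>\<^sub>0 'k"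
    assume "x \<in> verts G" "y \<in> verts G"
      "f \<in> {f \<in> hom (vertex_kcat G) x y. f \<in> I}" "g \<in> {f \<in> hom (vertex_kcat G) x y. f \<in> I}"
    then show "add (vertex_kcat G) x y f g \<in> {f \<in> hom (vertex_kcat G) x y. f \<in> I}"
      using K.add_hom[of x y f g] pscale.subspace_add[OF subspace] by simp
  next
    fix x y f and c :: 'k
    assume "x \<in> verts G" "y \<in> verts G" "f \<in> {f \<in> hom (vertex_kcat G) x y. f \<in> I}"
    then show "scl (vertex_kcat G) x y c f \<in> {f \<in> hom (vertex_kcat G) x y. f \<in> I}"
      using K.scl_hom[of x y f c] pscale.subspace_scale[OF subspace] by simp
  qed (use pscale.subspace_0[OF subspace] in auto)
qed

end

section \<open>The kernel of splitting is the box ideal\<close>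

context presented_pair
begin

definition tensor_split where
  "tensor_split a b f
    = coset (free_prod V V') (tensor_rels V V') (\<eta>\<eta>o a) (\<eta>\<eta>o b) (split_paths a b f)"

lemma kfunctor_tensor_split: "kfunctor (vertex_kcat QQ) (tensor V V') \<eta>\<eta>o tensor_split"
  unfolding tensor_split_def[abs_def] tensor_eq_quot
  using kfunctor_comp[OF kfunctor_split_paths rels.kfunctor_coset] .

lemma tensor_split_eq_zer_iff:
  assumes "a \<in> verts QQ" "b \<in> verts QQ" "f \<in> hom (vertex_kcat QQ) a b"
  shows "tensor_split a b f = zer (tensor V V') (\<eta>\<eta>o a) (\<eta>\<eta>o b)
    \<longleftrightarrow> split_paths a b f \<in> tensor_rels V V' (\<eta>\<eta>o a) (\<eta>\<eta>o b)"
  unfolding tensor_split_def tensor_eq_quot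
  by (rule rels.coset_eq_zer_iff)
    (use assms split_paths_hom kfunctor.Fo_obj[OF kfunctor_split_paths] in auto)

definition split_kernel where
  "split_kernel a b = {f \<in> hom (vertex_kcat QQ) a b.
    split_paths a b f \<in> tensor_rels V V' (\<eta>\<eta>o a) (\<eta>\<eta>o b)}"

lemma kideal_split_kernel: "kideal (vertex_kcat QQ) split_kernel"
proof (rule kfunctor.kideal_kernel[OF kfunctor_tensor_split])
  fix a b assume "a \<in> obj (vertex_kcat QQ)" "b \<in> obj (vertex_kcat QQ)"
  then show "split_kernel a b
      = {f \<in> hom (vertex_kcat QQ) a b. tensor_split a b f = zer (tensor V V') (\<eta>\<eta>o a) (\<eta>\<eta>o b)}"
    unfolding split_kernel_def vertex_kcat_simps(1) using tensor_split_eq_zer_iff[of a b] by blast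
qed

text \<open>The kernel as a single ideal of the path algebra, so that minimality of the hull can be
  used for the comparison with \<open>box\<close>.\<close>

definition split_ideal where
  "split_ideal = {f \<in> path_algebra QQ.
    \<forall>a\<in>verts QQ. \<forall>b\<in>verts QQ. QQ.path_component a b f \<in> split_kernel a b}"

lemma split_ideal_is_ideal: "path_algebra_ideal QQ split_ideal"
  unfolding split_ideal_def by (rule QQ.path_algebra_ideal_of_kideal[OF kideal_split_kernel])

lemma split_kernel_zero: "a \<in> verts QQ \<Longrightarrow> b \<in> verts QQ \<Longrightarrow> 0 \<in> split_kernel a b"
  using kideal.ideal_zer[OF kideal_split_kernel, of a b] by simp

lemma comm_relation_in_split_ideal:
  assumes "\<alpha> \<in> arcs Q" "\<beta> \<in> arcs Q'"
  shows "comm_relation Q Q' \<alpha> \<beta> \<in> split_ideal"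
proof -
  let ?a = "(tail Q \<alpha>, tail Q' \<beta>)" and ?b = "(head Q \<alpha>, head Q' \<beta>)"
  have hom: "comm_relation Q Q' \<alpha> \<beta> \<in> hom (vertex_kcat QQ) ?a ?b"
    using comm_relation_hom[OF assms] .
  \<comment> \<open>The two paths around the square have the same arrows in each factor, so their
    difference vanishes before any relation is used.\<close>
  have "split_paths ?a ?b (comm_relation Q Q' \<alpha> \<beta>) = 0"
    by (simp add: comm_relation_def split_paths_def path_tensor_def
        module_hom.diff[OF fin_linear_lin_ext])
  then have "comm_relation Q Q' \<alpha> \<beta> \<in> split_kernel ?a ?b"
    using hom by (simp add: split_kernel_def pscale.span_zero)
  then show ?thesis
    using hom QQ.hom_subset_path_algebra[of ?a ?b] split_kernel_zero
    by (auto simp: split_ideal_def QQ.path_component_of_hom[OF hom])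
qed

text \<open>Paths in the copy over \<open>p\<close> never change their first coordinate, so
  components with another first coordinate vanish.\<close>

lemma path_component_place_right:
  assumes p: "p \<in> verts Q" and g: "g \<in> path_algebra Q'"
  shows "QQ.path_component (x, x') (y, y') (place_right p g)
    = (if x = p \<and> y = p then place_right p (Q'.path_component x' y' g) else 0)"
proof -
  let ?c = "if x = p \<and> y = p then 1 else 0"
  have "QQ.path_component (x, x') (y, y') (place_right p g)
      = pscale ?c (place_right p (Q'.path_component x' y' g))"
  proof (rule fin_linear_eqI[of "\<lambda>g. QQ.path_component (x, x') (y, y') (place_right p g)"
        "\<lambda>g. pscale ?c (place_right p (Q'.path_component x' y' g))"])
    fix k assume "k \<in> Poly_Mapping.keys g"
    obtain u bs where "k = (u, bs)" by (cases k)
    then show "QQ.path_component (x, x') (y, y') (place_right p (basis k))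
        = pscale ?c (place_right p (Q'.path_component x' y' (basis k)))"
      using p by (auto simp: QQ.path_component_def Q'.path_component_def awalk_lift_right_iff
          module_hom.zero[OF fin_linear_place_right])
  qed (intro fin_linear_comp[OF QQ.fin_linear_path_component fin_linear_place_right]
      pscale_pair.module_hom_scale fin_linear_comp[OF fin_linear_place_right Q'.fin_linear_path_component])+
  then show ?thesis by simp
qed

lemma path_component_place_left:
  assumes q: "q \<in> verts Q'" and f: "f \<in> path_algebra Q"
  shows "QQ.path_component (x, x') (y, y') (place_left q f)
    = (if x' = q \<and> y' = q then place_left q (Q.path_component x y f) else 0)"
proof -
  let ?c = "if x' = q \<and> y' = q then 1 else 0"
  have "QQ.path_component (x, x') (y, y') (place_left q f)
      = pscale ?c (place_left q (Q.path_component x y f))"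
  proof (rule fin_linear_eqI[of "\<lambda>f. QQ.path_component (x, x') (y, y') (place_left q f)"
        "\<lambda>f. pscale ?c (place_left q (Q.path_component x y f))"])
    fix k assume "k \<in> Poly_Mapping.keys f"
    obtain u as where "k = (u, as)" by (cases k)
    then show "QQ.path_component (x, x') (y, y') (place_left q (basis k))
        = pscale ?c (place_left q (Q.path_component x y (basis k)))"
      using q by (auto simp: QQ.path_component_def Q.path_component_def awalk_lift_left_iff
          module_hom.zero[OF fin_linear_place_left])
  qed (intro fin_linear_comp[OF QQ.fin_linear_path_component fin_linear_place_left]
      pscale_pair.module_hom_scale fin_linear_comp[OF fin_linear_place_left Q.fin_linear_path_component])+
  then show ?thesis by simp
qed

text \<open>The copy of \<open>g\<close> is its join with the trivial path at \<open>p\<close>. Up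
  to relations it splits into the image of that path tensored with the image of \<open>g\<close>,
  and the latter is zero.\<close>

lemma place_right_in_split_kernel:
  assumes p: "p \<in> verts Q" and v: "x' \<in> verts Q'" "y' \<in> verts Q'"
    and g: "g \<in> hom (vertex_kcat Q') x' y'" and gI: "g \<in> I'"
  shows "place_right p g \<in> split_kernel (p, x') (p, y')"
proof -
  let ?R = "tensor_rels V V' (\<eta>o p, \<eta>o' x') (\<eta>o p, \<eta>o' y')"
  let ?e = "basis (p, []) :: ('v, 'a) path \<Rightarrow>\<^sub>0 'k"
  have hom: "place_right p g \<in> hom (vertex_kcat QQ) (p, x') (p, y')"
    by (rule place_right_hom[OF p g])
  have "join (p, x') (p, y') ?e g = place_right p g"
    using QK.cmp_idm_right[OF _ _ hom] p v by (simp add: join_def)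
  moreover have e: "?e \<in> hom (vertex_kcat Q) p p" using p by (simp add: Q.awalk_Nil_iff)
  ultimately have "split_paths (p, x') (p, y') (place_right p g) - simple (\<eta> p p ?e) (\<eta>' x' y' g) \<in> ?R"
    using split_paths_join[OF p p v e g] by simp
  moreover have "\<eta>' x' y' g = zer V' (\<eta>o' x') (\<eta>o' y')"
    using V'.kernel[of x' y'] v g gI by auto
  then have "simple (\<eta> p p ?e) (\<eta>' x' y' g) \<in> ?R"
    using simple_zer_right[OF V.Fo_obj V'.Fo_obj V.Fo_obj V'.Fo_obj V.Fm_hom] p v e by simp
  ultimately have "split_paths (p, x') (p, y') (place_right p g) \<in> ?R"
    using pscale.span_add by fastforce
  then show ?thesis using hom by (simp add: split_kernel_def)
qed

lemma place_left_in_split_kernel: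
  assumes q: "q \<in> verts Q'" and v: "x \<in> verts Q" "y \<in> verts Q"
    and f: "f \<in> hom (vertex_kcat Q) x y" and fI: "f \<in> I"
  shows "place_left q f \<in> split_kernel (x, q) (y, q)"
proof -
  let ?R = "tensor_rels V V' (\<eta>o x, \<eta>o' q) (\<eta>o y, \<eta>o' q)"
  let ?e = "basis (q, []) :: ('w, 'b) path \<Rightarrow>\<^sub>0 'k"
  have hom: "place_left q f \<in> hom (vertex_kcat QQ) (x, q) (y, q)"
    by (rule place_left_hom[OF q f])
  have "join (x, q) (y, q) f ?e = place_left q f"
    using QK.cmp_idm_left[OF _ _ hom] q v by (simp add: join_def)
  moreover have e: "?e \<in> hom (vertex_kcat Q') q q" using q by (simp add: Q'.awalk_Nil_iff)
  ultimately have "split_paths (x, q) (y, q) (place_left q f) - simple (\<eta> x y f) (\<eta>' q q ?e) \<in> ?R"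
    using split_paths_join[OF v q q f e] by simp
  moreover have "\<eta> x y f = zer V (\<eta>o x) (\<eta>o y)"
    using V.kernel[of x y] v f fI by auto
  then have "simple (\<eta> x y f) (\<eta>' q q ?e) \<in> ?R"
    using simple_zer_left[OF V.Fo_obj V'.Fo_obj V.Fo_obj V'.Fo_obj V'.Fm_hom] q v e by simp
  ultimately have "split_paths (x, q) (y, q) (place_left q f) \<in> ?R"
    using pscale.span_add by fastforce
  then show ?thesis using hom by (simp add: split_kernel_def)
qed

lemma place_right_in_split_ideal:
  assumes p: "p \<in> verts Q" and g: "g \<in> I'"
  shows "place_right p g \<in> split_ideal"
proof -
  have ga: "g \<in> path_algebra Q'" using g ideal' by (auto simp: path_algebra_ideal_def)
  have "QQ.path_component (x, x') (y, y') (place_right p g) \<in> split_kernel (x, x') (y, y')"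
    if "x \<in> verts Q" "y \<in> verts Q" "x' \<in> verts Q'" "y' \<in> verts Q'" for x y x' y'
    unfolding path_component_place_right[OF p ga]
    using split_kernel_zero that Q'.path_component_ideal[OF ideal' g]
      place_right_in_split_kernel[OF p _ _ Q'.path_component_hom] by auto
  then show ?thesis using place_right_path_algebra[OF p ga] by (auto simp: split_ideal_def)
qed

lemma place_left_in_split_ideal:
  assumes q: "q \<in> verts Q'" and f: "f \<in> I"
  shows "place_left q f \<in> split_ideal"
proof -
  have fa: "f \<in> path_algebra Q" using f ideal by (auto simp: path_algebra_ideal_def)
  have "QQ.path_component (x, x') (y, y') (place_left q f) \<in> split_kernel (x, x') (y, y')"
    if "x \<in> verts Q" "y \<in> verts Q" "x' \<in> verts Q'" "y' \<in> verts Q'" for x y x' y'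
    unfolding path_component_place_left[OF q fa]
    using split_kernel_zero that Q.path_component_ideal[OF ideal f]
      place_left_in_split_kernel[OF q _ _ Q.path_component_hom] by auto
  then show ?thesis using place_left_path_algebra[OF q fa] by (auto simp: split_ideal_def)
qed

lemma box_subset_split_ideal: "box \<subseteq> split_ideal"
  unfolding box_ideal_def
  using place_right_in_split_ideal place_left_in_split_ideal comm_relation_in_split_ideal
  by (intro hull_minimal split_ideal_is_ideal) auto

lemma split_kernel_eq:
  assumes a: "a \<in> verts QQ" and b: "b \<in> verts QQ"
  shows "split_kernel a b = {f \<in> hom (vertex_kcat QQ) a b. f \<in> box}"
proof (intro equalityI subsetI)
  fix f assume f: "f \<in> split_kernel a b"
  obtain x x' y y' where ab: "a = (x, x')" "b = (y, y')" by (cases a; cases b)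
  have ob: "x \<in> verts Q" "y \<in> verts Q" "x' \<in> verts Q'" "y' \<in> verts Q'" using a b ab by simp_all
  have hom: "f \<in> hom (vertex_kcat QQ) a b" using f by (simp add: split_kernel_def)
  \<comment> \<open>Joining undoes splitting modulo \<open>box\<close>, so \<open>f\<close> differs
    from this element by an element of \<open>box\<close>.\<close>
  have "join_reps a b (split_paths a b f) \<in> box"
    using f join_reps_rels[OF ob] by (auto simp: split_kernel_def ab)
  moreover have "join_reps a b (split_paths a b f) - f \<in> box"
    using join_reps_split_paths[OF ob] hom ab by simp
  ultimately have "f \<in> box"
    using pscale.subspace_diff[OF subspace_box] by fastforce
  then show "f \<in> {f \<in> hom (vertex_kcat QQ) a b. f \<in> box}" using hom by simp
next
  fix f assume "f \<in> {f \<in> hom (vertex_kcat QQ) a b. f \<in> box}"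
  then have hom: "f \<in> hom (vertex_kcat QQ) a b" and "f \<in> split_ideal"
    using box_subset_split_ideal by auto
  \<comment> \<open>Membership in \<open>split_ideal\<close> speaks of components, and a morphism
    from \<open>a\<close> to \<open>b\<close> is its own component.\<close>
  then have "QQ.path_component a b f \<in> split_kernel a b"
    using a b unfolding split_ideal_def by blast
  then show "f \<in> split_kernel a b" by (simp add: QQ.path_component_of_hom[OF hom])
qed

lemma quotient_presentation_tensor:
  "quotient_presentation (vertex_kcat QQ) (tensor V V') \<eta>\<eta>o tensor_split
    (\<lambda>a b. {f \<in> hom (vertex_kcat QQ) a b. f \<in> box})"
proof (intro quotient_presentation.intro kfunctor_tensor_split quotient_presentation_axioms.intro)
  show "bij_betw \<eta>\<eta>o (obj (vertex_kcat QQ)) (obj (tensor V V'))"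
    using bij_betw_map_prod[OF V.bij_objs V'.bij_objs] by simp
  fix a b assume "a \<in> obj (vertex_kcat QQ)" "b \<in> obj (vertex_kcat QQ)"
  then have a: "a \<in> verts QQ" and b: "b \<in> verts QQ" by (simp_all del: prod_quiver_simps)
  show "{f \<in> hom (vertex_kcat QQ) a b. f \<in> box} = {f \<in> hom (vertex_kcat QQ) a b.
      tensor_split a b f = zer (tensor V V') (\<eta>\<eta>o a) (\<eta>\<eta>o b)}"
    unfolding split_kernel_eq[OF a b, symmetric] split_kernel_def
    using tensor_split_eq_zer_iff[OF a b] by blast
  obtain x x' y y' where ab: "a = (x, x')" "b = (y, y')" by (cases a; cases b)
  have ob: "x \<in> verts Q" "y \<in> verts Q" "x' \<in> verts Q'" "y' \<in> verts Q'" using a b ab by simp_all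
  show "hom (tensor V V') (\<eta>\<eta>o a) (\<eta>\<eta>o b) \<subseteq> tensor_split a b ` hom (vertex_kcat QQ) a b"
  proof
    fix N assume "N \<in> hom (tensor V V') (\<eta>\<eta>o a) (\<eta>\<eta>o b)"
    then obtain t where t: "t \<in> hom (free_prod V V') (\<eta>o x, \<eta>o' x') (\<eta>o y, \<eta>o' y')"
      and N: "N = coset (free_prod V V') (tensor_rels V V') (\<eta>\<eta>o a) (\<eta>\<eta>o b) t"
      by (auto simp: tensor_eq_quot rels.hom_quot ab)
    obtain f where f: "f \<in> hom (vertex_kcat QQ) a b"
      "split_paths a b f - t \<in> tensor_rels V V' (\<eta>o x, \<eta>o' x') (\<eta>o y, \<eta>o' y')"
      using split_paths_full[OF ob t] ab by auto
    have "tensor_split a b f = N"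
      unfolding tensor_split_def N using f t ab ob V.Fo_obj V'.Fo_obj
      by (intro coset_tensor_eqI) auto
    then show "N \<in> tensor_split a b ` hom (vertex_kcat QQ) a b" using f by blast
  qed
qed

end

section \<open>The isomorphism\<close>

text \<open>The vertex category of the theorem has one-entry lists as objects and cosets of
  one-by-one matrices as morphisms. Presenting it by \<open>C\<close> itself makes it available as
  \<open>V\<close> and \<open>V'\<close>.\<close>

lemma (in kideal) quotient_presentation_vertices:
  "quotient_presentation C
    (full_subcat (quot (add_hull C) (matrix_ideal C J)) ((\<lambda>x. [x]) ` obj C)) (\<lambda>x. [x])
    (\<lambda>x y f. coset (add_hull C) (matrix_ideal C J) [x] [y] (\<lambda>(i, j)\<in>{..<Suc 0} \<times> {..<Suc 0}. f)) J"
proof -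
  interpret M: kideal "add_hull C" "matrix_ideal C J" by (rule kideal_matrix_ideal)
  let ?S = "(\<lambda>x. [x]) ` obj C"
  let ?D = "full_subcat (quot (add_hull C) (matrix_ideal C J)) ?S"
  let ?m = "\<lambda>f. \<lambda>(i, j)\<in>{..<Suc 0} \<times> {..<Suc 0}. f"
  let ?F = "\<lambda>x y f. coset (add_hull C) (matrix_ideal C J) [x] [y] (?m f)"
  have m_hom: "?m f \<in> hom (add_hull C) [x] [y]" if "f \<in> hom C x y" for x y f
    using that by (auto simp: hom_add_hull)
  have D: "obj ?D = ?S" "hom ?D = hom (quot (add_hull C) (matrix_ideal C J))"
    "idm ?D = idm (quot (add_hull C) (matrix_ideal C J))"
    "zer ?D = zer (quot (add_hull C) (matrix_ideal C J))"
    "add ?D = add (quot (add_hull C) (matrix_ideal C J))"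
    "scl ?D = scl (quot (add_hull C) (matrix_ideal C J))"
    "cmp ?D = cmp (quot (add_hull C) (matrix_ideal C J))"
    by (auto simp: full_subcat_def)
  \<comment> \<open>Extensionality leaves a one-by-one matrix no freedom beyond its entry.\<close>
  have eqI: "M = ?m f" if "M \<in> hom (add_hull C) [x] [y]" "M (0, 0) = f" for M f x y
    by (rule extensionalityI[of _ "{..<Suc 0} \<times> {..<Suc 0}"]) (use that in \<open>auto simp: hom_add_hull\<close>)
  have ob: "[x] \<in> lists (obj C)" if "x \<in> obj C" for x using that by simp
  have m_idm: "idm (add_hull C) [x] = ?m (idm C x)" if "x \<in> obj C" for x
    by (rule eqI[OF idm_add_hull_hom[OF ob[OF that]]]) simp
  have m_cmp: "cmp (add_hull C) [x] [y] [z] (?m g) (?m f) = ?m (cmp C x y z g f)"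
    if "x \<in> obj C" "y \<in> obj C" "z \<in> obj C" "f \<in> hom C x y" "g \<in> hom C y z" for x y z f g
    by (rule eqI[OF add_hull_homs(5)])
      (use that m_hom cmp_add_hull_entry[of "[x]" "[y]" "[z]" "?m f" "?m g" 0 0]
        in \<open>simp_all add: add_zer cmp_hom\<close>)
  have m_add: "add (add_hull C) [x] [y] (?m f) (?m g) = ?m (add C x y f g)"
    if "x \<in> obj C" "y \<in> obj C" "f \<in> hom C x y" "g \<in> hom C x y" for x y f g
    by (rule eqI[OF add_hull_homs(2)]) (use that m_hom in simp_all)
  have m_scl: "scl (add_hull C) [x] [y] c (?m f) = ?m (scl C x y c f)"
    if "x \<in> obj C" "y \<in> obj C" "f \<in> hom C x y" for x y c f
    by (rule eqI[OF add_hull_homs(3)]) (use that m_hom in simp_all)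
  have funct: "kfunctor C ?D (\<lambda>x. [x]) ?F"
  proof (intro kfunctor.intro kcategory_axioms kfunctor_axioms.intro
      kcategory.kcategory_full_subcat M.kcategory_quot)
    fix x y z f g
    assume h: "x \<in> obj C" "y \<in> obj C" "z \<in> obj C" "f \<in> hom C x y" "g \<in> hom C y z"
    show "?F x z (cmp C x y z g f) = cmp ?D [x] [y] [z] (?F y z g) (?F x y f)"
      unfolding D using M.cmp_quot[of "[x]" "[y]" "[z]" "?m f" "?m g"] m_cmp[OF h] m_hom h by simp
  next
    fix x y f g
    assume h: "x \<in> obj C" "y \<in> obj C" "f \<in> hom C x y" "g \<in> hom C x y"
    show "?F x y (add C x y f g) = add ?D [x] [y] (?F x y f) (?F x y g)"
      unfolding D using M.add_quot[of "[x]" "[y]" "?m f" "?m g"] m_add[OF h] m_hom h by simp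
  next
    fix x y f c
    assume h: "x \<in> obj C" "y \<in> obj C" "f \<in> hom C x y"
    show "?F x y (scl C x y c f) = scl ?D [x] [y] c (?F x y f)"
      unfolding D using M.scl_quot[of "[x]" "[y]" "?m f" c] m_scl[OF h] m_hom h by simp
    show "?F x y f \<in> hom ?D [x] [y]"
      unfolding D M.hom_quot using m_hom h by blast
  next
    fix x assume x: "x \<in> obj C"
    show "[x] \<in> obj ?D" unfolding D using x by blast
    show "?F x x (idm C x) = idm ?D [x]" unfolding D M.idm_quot using m_idm[OF x] by simp
  qed
  show ?thesis
  proof (intro quotient_presentation.intro funct quotient_presentation_axioms.intro)
    show "bij_betw (\<lambda>x. [x]) (obj C) (obj ?D)"
      unfolding D by (auto simp: bij_betw_def inj_on_def)
    fix x y assume xy: "x \<in> obj C" "y \<in> obj C"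
    show "hom ?D [x] [y] \<subseteq> ?F x y ` hom C x y"
    proof
      fix N assume "N \<in> hom ?D [x] [y]"
      then obtain M where M: "M \<in> hom (add_hull C) [x] [y]"
        and N: "N = coset (add_hull C) (matrix_ideal C J) [x] [y] M"
        unfolding D M.hom_quot by blast
      have "M (0, 0) \<in> hom C x y" using M by (simp add: hom_add_hull)
      moreover have "N = ?F x y (M (0, 0))"
        unfolding N by (rule arg_cong[OF eqI[OF M refl], of "coset (add_hull C) (matrix_ideal C J) [x] [y]"])
      ultimately show "N \<in> ?F x y ` hom C x y" by blast
    qed
    have "?m f \<in> matrix_ideal C J [x] [y] \<longleftrightarrow> f \<in> J x y" if "f \<in> hom C x y" for f
      using m_hom[OF that] by (auto simp: matrix_ideal_def)
    then have "f \<in> J x y \<longleftrightarrow> ?F x y f = zer ?D [x] [y]" if "f \<in> hom C x y" for f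
      unfolding D using M.coset_eq_zer_iff[of "[x]" "[y]" "?m f"] m_hom that xy by simp
    then show "J x y = {f \<in> hom C x y. ?F x y f = zer ?D [x] [y]}"
      using ideal_sub[OF xy] by blast
  qed
qed

text \<open>The counterpart for the product quiver: its vertex category is a quotient of the
  category of one-by-one matrices, so the presentation has to start from that category for
  \<open>kcat_isomorphic_quot\<close> to give the first claim.\<close>

lemma (in quotient_presentation) quotient_presentation_singletons:
  "quotient_presentation (full_subcat (add_hull C) ((\<lambda>x. [x]) ` obj C)) D (\<lambda>xs. Fo (hd xs))
    (\<lambda>xs ys M. Fm (hd xs) (hd ys) (M (0, 0))) (matrix_ideal C J)"
proof -
  let ?C = "full_subcat (add_hull C) ((\<lambda>x. [x]) ` obj C)"
  have C: "obj ?C = (\<lambda>x. [x]) ` obj C" "hom ?C = hom (add_hull C)" "idm ?C = idm (add_hull C)"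
    "zer ?C = zer (add_hull C)" "add ?C = add (add_hull C)" "scl ?C = scl (add_hull C)"
    "cmp ?C = cmp (add_hull C)"
    by (auto simp: full_subcat_def)
  have entry: "M (0, 0) \<in> hom C x y" if "M \<in> hom (add_hull C) [x] [y]" for M x y
    using that by (simp add: hom_add_hull)
  have m_hom: "(\<lambda>(i, j)\<in>{..<Suc 0} \<times> {..<Suc 0}. f) \<in> hom (add_hull C) [x] [y]"
    if "f \<in> hom C x y" for x y f
    using that by (auto simp: hom_add_hull)
  have funct: "kfunctor ?C D (\<lambda>xs. Fo (hd xs)) (\<lambda>xs ys M. Fm (hd xs) (hd ys) (M (0, 0)))"
  proof (intro kfunctor.intro cod.kcategory_axioms kfunctor_axioms.intro
      kcategory.kcategory_full_subcat dom.kcategory_add_hull; (unfold C)?; (elim imageE)?; simp?)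
    fix x y z f g
    assume h: "x \<in> obj C" "y \<in> obj C" "z \<in> obj C" "f \<in> hom (add_hull C) [x] [y]"
      "g \<in> hom (add_hull C) [y] [z]"
    then show "Fm x z (cmp (add_hull C) [x] [y] [z] g f (0, 0))
        = cmp D (Fo x) (Fo y) (Fo z) (Fm y z (g (0, 0))) (Fm x y (f (0, 0)))"
      using dom.cmp_add_hull_entry[of "[x]" "[y]" "[z]" f g 0 0] entry[OF h(4)] entry[OF h(5)]
      by (simp add: dom.add_zer dom.cmp_hom Fm_cmp)
  qed (simp_all add: Fo_obj Fm_hom entry Fm_idm Fm_add Fm_scl)
  show ?thesis
  proof (intro quotient_presentation.intro funct quotient_presentation_axioms.intro)
    have "bij_betw (\<lambda>x. Fo (hd x)) ((\<lambda>x. [x]) ` obj C) (obj D)"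
      using bij_objs by (auto simp: bij_betw_def inj_on_def image_image)
    then show "bij_betw (\<lambda>xs. Fo (hd xs)) (obj ?C) (obj D)" unfolding C .
    fix xs ys assume "xs \<in> obj ?C" "ys \<in> obj ?C"
    then obtain x y where xs: "xs = [x]" "ys = [y]" and xy: "x \<in> obj C" "y \<in> obj C"
      unfolding C by blast
    show "hom D (Fo (hd xs)) (Fo (hd ys)) \<subseteq> (\<lambda>M. Fm (hd xs) (hd ys) (M (0, 0))) ` hom ?C xs ys"
    proof
      fix N assume "N \<in> hom D (Fo (hd xs)) (Fo (hd ys))"
      then obtain f where f: "f \<in> hom C x y" "N = Fm x y f" using full[OF xy] xs by auto
      then show "N \<in> (\<lambda>M. Fm (hd xs) (hd ys) (M (0, 0))) ` hom ?C xs ys"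
        unfolding C using m_hom[OF f(1)] xs by (intro image_eqI[where x = "\<lambda>(i, j)\<in>{..<Suc 0} \<times> {..<Suc 0}. f"]) simp_all
    qed
    show "matrix_ideal C J xs ys
        = {M \<in> hom ?C xs ys. Fm (hd xs) (hd ys) (M (0, 0)) = zer D (Fo (hd xs)) (Fo (hd ys))}"
      unfolding C using kernel[OF xy] entry by (auto simp: matrix_ideal_def xs)
  qed
qed

lemma kfunctor_into_full_subcat:
  assumes "kfunctor C (full_subcat D S) Fo Fm" and "kcategory D"
  shows "kfunctor C D Fo Fm"
proof -
  interpret F: kfunctor C "full_subcat D S" Fo Fm by (rule assms(1))
  show ?thesis
    using F.Fo_obj F.Fm_hom F.Fm_idm F.Fm_cmp F.Fm_add F.Fm_scl
    by (intro kfunctor.intro F.dom.kcategory_axioms assms(2) kfunctor_axioms.intro)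
      (simp_all add: full_subcat_def)
qed

lemma (in wf_digraph) generated_ideal_eq:
  "generated_ideal G I = matrix_ideal (vertex_kcat G) (\<lambda>x y. {f \<in> hom (vertex_kcat G) x y. f \<in> I})"
  unfolding generated_ideal_def[abs_def] matrix_ideal_def[abs_def] path_kcat_def
  using add_hull_entry_hom[of _ "vertex_kcat G"] by (intro ext) blast

text \<open>A list is the biproduct of its entries before the quotient is taken, and passing to
  cosets is a \<open>K\<close>-functor, which preserves biproducts.\<close>

lemma (in wf_digraph) path_kcat_mod_biproduct:
  fixes I :: "(('a, 'b) path \<Rightarrow>\<^sub>0 'k::field) set"
  assumes I: "path_algebra_ideal G I" and xs: "xs \<in> obj (path_kcat_mod G I)"
  shows "\<exists>zs \<iota> \<pi>. set zs \<subseteq> (\<lambda>x. [x]) ` verts G \<and> is_biproduct (path_kcat_mod G I) xs zs \<iota> \<pi>"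
proof -
  interpret J: kideal "vertex_kcat G" "\<lambda>x y. {f \<in> hom (vertex_kcat G) x y. f \<in> I}"
    by (rule kideal_of_path_algebra_ideal[OF I])
  interpret M: kideal "add_hull (vertex_kcat G)" "generated_ideal G I"
    unfolding generated_ideal_eq by (rule J.kideal_matrix_ideal)
  let ?K = "vertex_kcat G :: ('a, ('a, 'b) path \<Rightarrow>\<^sub>0 'k, 'k) kcat"
  have "xs \<in> lists (obj ?K)" using xs by (simp add: path_kcat_mod_def path_kcat_def)
  moreover from J.add_hull_biproduct[OF this] obtain \<iota> \<pi>
    where "is_biproduct (add_hull ?K) xs (map (\<lambda>x. [x]) xs) \<iota> \<pi>" by blast
  from kfunctor.is_biproduct_map[OF M.kfunctor_coset this] obtain \<iota>' \<pi>'
    where "is_biproduct (path_kcat_mod G I) xs (map (\<lambda>x. [x]) xs) \<iota>' \<pi>'"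
    by (auto simp: path_kcat_mod_def path_kcat_def)
  ultimately show ?thesis
    by (intro exI[of _ "map (\<lambda>x. [x]) xs"] exI[of _ \<iota>'] exI[of _ \<pi>']) auto
qed

lemma (in wf_digraph) kcategory_path_kcat_mod:
  assumes I: "path_algebra_ideal G I"
  shows "kcategory (path_kcat_mod G I)"
proof -
  interpret J: kideal "vertex_kcat G" "\<lambda>x y. {f \<in> hom (vertex_kcat G) x y. f \<in> I}"
    by (rule kideal_of_path_algebra_ideal[OF I])
  interpret M: kideal "add_hull (vertex_kcat G)" "generated_ideal G I"
    unfolding generated_ideal_eq by (rule J.kideal_matrix_ideal)
  show ?thesis unfolding path_kcat_mod_def path_kcat_def by (rule M.kcategory_quot)
qed

theorem proposition2p3:
  fixes Q :: "('v, 'a) pre_digraph" and Q' :: "('w, 'b) pre_digraph"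
    and I :: "(('v, 'a) path \<Rightarrow>\<^sub>0 'k::field) set" and I' :: "(('w, 'b) path \<Rightarrow>\<^sub>0 'k) set"
  assumes "strongly_locally_finite Q" and "strongly_locally_finite Q'"
    and "admissible Q I" and "admissible Q' I'"
  shows "kcat_isomorphic
      (path_kcat_mod_vertices (prod_quiver Q Q') (box_ideal Q I Q' I'))
      (tensor (path_kcat_mod_vertices Q I) (path_kcat_mod_vertices Q' I')) \<and>
    kcat_isomorphic
      (path_kcat_mod (prod_quiver Q Q') (box_ideal Q I Q' I'))
      (add_hull (tensor (path_kcat_mod_vertices Q I) (path_kcat_mod_vertices Q' I'))) \<and>
    kcat_equivalent
      (path_kcat_mod (prod_quiver Q Q') (box_ideal Q I Q' I'))
      (add_hull (tensor (path_kcat_mod Q I) (path_kcat_mod Q' I')))"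
proof (intro conjI)
  interpret quiver_pair Q Q'
    using assms(1,2) by (intro quiver_pair.intro) (auto simp: strongly_locally_finite_def)
  have I: "path_algebra_ideal Q I" and I': "path_algebra_ideal Q' I'"
    using Q.admissible_ideal Q'.admissible_ideal assms by blast+
  interpret J: kideal "vertex_kcat Q" "\<lambda>x y. {f \<in> hom (vertex_kcat Q) x y. f \<in> I}"
    by (rule Q.kideal_of_path_algebra_ideal[OF I])
  interpret J': kideal "vertex_kcat Q'" "\<lambda>x y. {f \<in> hom (vertex_kcat Q') x y. f \<in> I'}"
    by (rule Q'.kideal_of_path_algebra_ideal[OF I'])
  let ?V = "path_kcat_mod_vertices Q I" and ?V' = "path_kcat_mod_vertices Q' I'"
  let ?B = "box_ideal Q I Q' I'"
  \<comment> \<open>These facts present the two vertex categories by the path categories of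
    \<open>Q\<close> and \<open>Q'\<close>, as \<open>presented_pair\<close> requires.\<close>
  note V = J.quotient_presentation_vertices[folded Q.generated_ideal_eq path_kcat_def, folded path_kcat_mod_def,
      unfolded vertex_kcat_simps(1), folded path_kcat_mod_vertices_def]
    and V' = J'.quotient_presentation_vertices[folded Q'.generated_ideal_eq path_kcat_def, folded path_kcat_mod_def,
      unfolded vertex_kcat_simps(1), folded path_kcat_mod_vertices_def]
  \<comment> \<open>The existential hides the concrete functor; from here on only the presentation
    of the tensor product matters.\<close>
  have "\<exists>Fo Fm. quotient_presentation (vertex_kcat QQ) (tensor ?V ?V') Fo Fm
      (\<lambda>a b. {f \<in> hom (vertex_kcat QQ) a b. f \<in> ?B})"
    using presented_pair.quotient_presentation_tensor[OF presented_pair.intro[OF quiver_pair_axioms V V'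
      presented_pair_axioms.intro[OF I I']]] by blast
  then obtain Fo Fm where "quotient_presentation (vertex_kcat QQ) (tensor ?V ?V') Fo Fm
      (\<lambda>a b. {f \<in> hom (vertex_kcat QQ) a b. f \<in> ?B})" by blast
  then interpret P: quotient_presentation "vertex_kcat QQ" "tensor ?V ?V'" Fo Fm
    "\<lambda>a b. {f \<in> hom (vertex_kcat QQ) a b. f \<in> ?B}" .
  note gen = QQ.generated_ideal_eq[of ?B, symmetric]
  interpret H: quotient_presentation "add_hull (vertex_kcat QQ)" "add_hull (tensor ?V ?V')"
    "map Fo" "matrix_map Fm" "generated_ideal QQ ?B"
    using P.quotient_presentation_add_hull unfolding gen .
  have mod_eq: "quot (add_hull (vertex_kcat QQ)) (generated_ideal QQ ?B) = path_kcat_mod QQ ?B"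
    by (simp add: path_kcat_mod_def path_kcat_def)
  show "kcat_isomorphic (path_kcat_mod_vertices QQ ?B) (tensor ?V ?V')"
    \<comment> \<open>Restricting to one-entry lists commutes with the quotient by
      \<open>quot_full_subcat\<close>.\<close>
    using quotient_presentation.kcat_isomorphic_quot[OF P.quotient_presentation_singletons]
    unfolding gen quot_full_subcat mod_eq vertex_kcat_simps(1) path_kcat_mod_vertices_def .
  show "kcat_isomorphic (path_kcat_mod QQ ?B) (add_hull (tensor ?V ?V'))"
    using H.kcat_isomorphic_quot unfolding mod_eq .
  let ?C = "path_kcat_mod Q I" and ?C' = "path_kcat_mod Q' I'"
  let ?S = "(\<lambda>x. [x]) ` verts Q \<times> (\<lambda>x. [x]) ` verts Q'"
  interpret kcategory_pair ?C ?C'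
    by (intro kcategory_pair.intro Q.kcategory_path_kcat_mod Q'.kcategory_path_kcat_mod I I')
  interpret T: kcategory "tensor ?C ?C'" by (rule kcategory_tensor)
  \<comment> \<open>The target of the second claim is a full subcategory of the target of the third,
    namely on lists of pairs of vertices. The functor of the second claim is therefore fully
    faithful into the larger category, and essential surjectivity remains.\<close>
  have sub: "add_hull (tensor ?V ?V') = full_subcat (add_hull (tensor ?C ?C')) (lists ?S)"
    by (simp add: path_kcat_mod_vertices_def tensor_full_subcat add_hull_full_subcat)
  have "kfunctor (path_kcat_mod QQ ?B) (add_hull (tensor ?C ?C')) (map Fo) H.induced"
    using H.kfunctor_induced T.kcategory_add_hull unfolding mod_eq sub
    by (rule kfunctor_into_full_subcat)
  moreover have "fully_faithful (path_kcat_mod QQ ?B) (add_hull (tensor ?C ?C')) (map Fo) H.induced"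
    using H.fully_faithful_induced unfolding mod_eq sub by (simp add: fully_faithful_def full_subcat_def)
  moreover have "\<exists>c\<in>obj (path_kcat_mod QQ ?B). iso_objs (add_hull (tensor ?C ?C')) (map Fo c) d"
    if d: "d \<in> obj (add_hull (tensor ?C ?C'))" for d
  proof -
    \<comment> \<open>A pair of formal sums is a biproduct of pairs of vertices, by tensoring the
      decompositions of its two components.\<close>
    have bip: "\<exists>zs \<iota> \<pi>. set zs \<subseteq> ?S \<and> is_biproduct (tensor ?C ?C') x zs \<iota> \<pi>" if x: "x \<in> obj (tensor ?C ?C')" for x
    proof -
      obtain xs ys where x': "x = (xs, ys)" "xs \<in> obj ?C" "ys \<in> obj ?C'" using x by auto
      obtain zs \<iota> \<pi> where zs: "set zs \<subseteq> (\<lambda>x. [x]) ` verts Q" "is_biproduct ?C xs zs \<iota> \<pi>"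
        using Q.path_kcat_mod_biproduct[OF I x'(2)] by blast
      obtain zs' \<iota>' \<pi>' where zs': "set zs' \<subseteq> (\<lambda>x. [x]) ` verts Q'" "is_biproduct ?C' ys zs' \<iota>' \<pi>'"
        using Q'.path_kcat_mod_biproduct[OF I' x'(3)] by blast
      obtain ws \<kappa> \<rho> where "set ws \<subseteq> set zs \<times> set zs'" "is_biproduct (tensor ?C ?C') (xs, ys) ws \<kappa> \<rho>"
        using tensor_biproduct[OF zs(2) zs'(2)] by blast
      then show ?thesis using zs(1) zs'(1) x'(1) by blast
    qed
    have "d \<in> lists (obj (tensor ?C ?C'))" using d unfolding obj_add_hull .
    from T.add_hull_iso_lists[OF bip this]
    obtain zs where zs: "zs \<in> lists (obj (tensor ?C ?C') \<inter> ?S)" "iso_objs (add_hull (tensor ?C ?C')) zs d"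
      by blast
    have "zs \<in> obj (add_hull (tensor ?V ?V'))"
      unfolding sub using zs(1) by (simp add: full_subcat_def lists_Int_eq)
    \<comment> \<open>\<open>map Fo\<close> is bijective onto the formal sums of pairs of vertices,
      so this list is hit exactly and not just up to isomorphism.\<close>
    then have "zs \<in> map Fo ` obj (path_kcat_mod QQ ?B)"
      unfolding mod_eq[symmetric] H.obj_quot bij_betw_imp_surj_on[OF H.bij_objs] .
    then show ?thesis using zs(2) by blast
  qed
  ultimately show "kcat_equivalent (path_kcat_mod QQ ?B) (add_hull (tensor ?C ?C'))"
    unfolding kcat_equivalent_def by blast
qed

end
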